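(* For all sufficiently large square-free integers $d>0$, $$\sum_{r\in\mathcal{D}}2^{\omega(d)-\omega(\gcd(d,r))}\ge c\,d$$ for an absolute constant $c>0$, where $\mathcal{D}=\{r\in\mathbb{Z}: 0<r<d/4,\ r \text{ is a square modulo } d,\ r\neq\alpha^2+d\beta^2 \text{ for all } \alpha,\beta\in\mathbb{Q}\}$.
   Context: $\omega(n)$ denotes the number of distinct prime divisors of $n$. "$r$ is a square modulo $d$" means $r\equiv x^2\pmod d$ for some integer $x$. *)

theory Defs
  imports "HOL-Number_Theory.Number_Theory" "HOL-Computational_Algebra.Squarefree"
begin

definition omega :: "nat \<Rightarrow> nat" where
  "omega n = card (prime_factors n)"

definition is_square_mod :: "int \<Rightarrow> int \<Rightarrow> bool" where
  "is_square_mod r d \<longleftrightarrow> (\<exists>x::int. [r = x^2] (mod d))"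

definition Dset :: "nat \<Rightarrow> int set" where
  "Dset d = {r::int. 0 < r \<and> 4 * r < int d \<and> is_square_mod r (int d) \<and>
      (\<forall>\<alpha> \<beta> :: rat. of_int r \<noteq> \<alpha>^2 + of_nat d * \<beta>^2)}"

end

theory Submission
  imports Defs "HOL-Analysis.Convex"
begin

text \<open>
  The weight of \<open>r\<close> is at least the number of square roots of \<open>r\<close> modulo the odd part of \<open>d\<close>, so it
  suffices to find, counted with this multiplicity, a positive proportion of \<open>r < d/4\<close> for which
  \<open>r = \<alpha>\<^sup>2 + d \<beta>\<^sup>2\<close> is obstructed at some prime. A variance estimate shows that the squares
  modulo \<open>d\<close> are well distributed in progressions with somewhat more than \<open>\<surd>d\<close> terms; hence
  \<open>r\<close> may in addition be prescribed modulo small numbers.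

  Unless \<open>d \<equiv> 7 (mod 8)\<close>, some residue class modulo 8 is obstructed at 2. If \<open>d \<equiv> 7 (mod 8)\<close>, call an odd
  prime \<open>p\<close> bad if it does not split in \<open>\<rat>(\<surd>-d)\<close>: a positive proportion of the multiples of \<open>p\<close> is then
  obstructed at \<open>p\<close>. If the sum of \<open>1/p\<close> over the bad primes \<open>p \<le> d\<^sup>1\<^sup>/\<^sup>5\<close> is not small,
  inclusion-exclusion gives the claim. Otherwise Vinogradov's trick applies: the Jacobi symbol has
  small average over intervals of length \<open>10 \<surd>d\<close>, and an integer at which it is not 1 has a bad
  prime factor, so the sum of \<open>1/p\<close> over all bad primes up to \<open>44 \<surd>d\<close> is bounded below. By
  Chebyshev's estimate the primes close to \<open>\<surd>d\<close> contribute little, which leaves the inert primes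
  between \<open>d\<^sup>1\<^sup>/\<^sup>5\<close> and a power of \<open>d\<close> with exponent below 1/2, of which at most four divide a
  given \<open>r < d\<close>.
\<close>

section \<open>Equidistribution of squares\<close>

text \<open>Counting square roots instead of squares makes the mean exactly 1 and reduces the second
  moment to a count of divisors, without exponential sums. The error, of order sqrt(d tau(d)) with
  tau the number of divisors, permits residue classes only to moduli somewhat below d^(1/2), and
  this limit shapes the rest. If d = 7 mod 8, then -d is a 2-adic square and nothing is obstructed
  at 2, so odd primes are needed. A ramified p obstructs classes modulo p^2, which is affordable for
  p up to d^(1/5). An inert p obstructs every multiple of p that p^2 does not divide; since the
  multiples of p^2 need only an upper bound, p may come close to d^(1/2). The Jacobi symbol cancels
  only beyond d^(1/2), so a gap of primes around d^(1/2) is lost; it is short on a logarithmic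
  scale. One device serves both the root counts and the symbol: a sum over a progression is smoothed
  to a double sum over i + j, and Cauchy-Schwarz in i leaves a mean square over all
  residues.\<close>

lemma finite_int_interval_filter [simp]: "finite {v::int. 0 \<le> v \<and> v < b \<and> P v}"
  by (rule finite_subset[of _ "{0..<b}"]) auto

lemma mod_affine_bij:
  fixes n a c :: int
  assumes "n > 0" "coprime a n"
  shows "bij_betw (\<lambda>x. (a * x + c) mod n) {0..<n} {0..<n}"
proof -
  have inj: "inj_on (\<lambda>x. (a * x + c) mod n) {0..<n}"
  proof (rule inj_onI)
    fix x y assume xy: "x \<in> {0..<n}" "y \<in> {0..<n}" "(a * x + c) mod n = (a * y + c) mod n"
    then have "[a * x + c = a * y + c] (mod n)" by (simp add: cong_def)
    then have "[a * x = a * y] (mod n)" by (simp add: cong_add_rcancel)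
    then have "[x = y] (mod n)" using assms(2) by (simp add: cong_mult_lcancel)
    then show "x = y" using xy by (simp add: cong_def)
  qed
  moreover have "(\<lambda>x. (a * x + c) mod n) ` {0..<n} \<subseteq> {0..<n}"
    using assms by auto
  ultimately show ?thesis
    unfolding bij_betw_def using endo_inj_surj finite_atLeastLessThan_int by blast
qed

lemma sum_affine_mod:
  fixes n a c :: int and f :: "int \<Rightarrow> 'a::comm_monoid_add"
  assumes "n > 0" "coprime a n" "\<And>x. f (x mod n) = f x"
  shows "(\<Sum>x\<in>{0..<n}. f (a * x + c)) = sum f {0..<n}"
proof -
  have "(\<Sum>x\<in>{0..<n}. f (a * x + c)) = (\<Sum>x\<in>{0..<n}. f ((a * x + c) mod n))"
    using assms(3) by simp
  also have "\<dots> = sum f {0..<n}"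
    using mod_affine_bij[OF assms(1,2)] by (rule sum.reindex_bij_betw)
  finally show ?thesis .
qed

lemma sum_shift_mod:
  fixes n c :: int and f :: "int \<Rightarrow> 'a::comm_monoid_add"
  assumes "n > 0" "\<And>x. f (x mod n) = f x"
  shows "(\<Sum>x\<in>{0..<n}. f (x + c)) = sum f {0..<n}"
  using sum_affine_mod[of n 1 f c] assms by simp

text \<open>Cauchy-Schwarz over \<open>i\<close>; since \<open>I \<le> n\<close> and
  \<open>a\<close> is a unit, the points \<open>a * i + c\<close> are distinct modulo
  \<open>n\<close>, so the squares can be completed to a full period. A mean square over all
  residues thus controls a short stretch of a progression.\<close>

lemma bilinear_bound:
  fixes f :: "int \<Rightarrow> real" and n I J :: nat and a c :: int
  assumes n: "n > 0" and per: "\<And>x. f (x mod int n) = f x"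
    and cop: "coprime a (int n)" and I: "I \<le> n"
    and V: "(\<Sum>i\<in>{0..<int n}. (\<Sum>j<J. f (i + a * int j))\<^sup>2) \<le> V"
  shows "\<bar>\<Sum>i<I. \<Sum>j<J. f (a * int (i + j) + c)\<bar> \<le> sqrt (real I * V)"
proof -
  define F where "F = (\<lambda>i::int. \<Sum>j<J. f (i + a * int j))"
  have Fper: "F (x mod int n) = F x" for x
  proof -
    have "f (x mod int n + b) = f (x + b)" for b
      using per[of "x mod int n + b"] per[of "x + b"] by (simp add: mod_simps)
    then show ?thesis by (simp add: F_def)
  qed
  have sub: "(\<lambda>i. (a * int i + c) mod int n) ` {..<I} \<subseteq> {0..<int n}"
    using n by auto
  have inj: "inj_on (\<lambda>i. (a * int i + c) mod int n) {..<I}"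
  proof (rule inj_onI)
    fix x y assume xy: "x \<in> {..<I}" "y \<in> {..<I}"
      "(a * int x + c) mod int n = (a * int y + c) mod int n"
    have "inj_on (\<lambda>x. (a * x + c) mod int n) {0..<int n}"
      using bij_betw_imp_inj_on[OF mod_affine_bij[of "int n" a c]] n cop by simp
    from inj_onD[OF this xy(3)] have "int x = int y"
      using xy I by auto
    then show "x = y" by simp
  qed
  have "(\<Sum>i<I. (F (a * int i + c))\<^sup>2) = (\<Sum>i<I. (F ((a * int i + c) mod int n))\<^sup>2)"
    by (simp add: Fper)
  also have "\<dots> = (\<Sum>i\<in>(\<lambda>i. (a * int i + c) mod int n) ` {..<I}. (F i)\<^sup>2)"
    using inj by (simp add: sum.reindex)
  also have "\<dots> \<le> (\<Sum>i\<in>{0..<int n}. (F i)\<^sup>2)"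
    using sub by (intro sum_mono2) auto
  also have "\<dots> \<le> V" using V by (simp add: F_def)
  finally have "(\<Sum>i<I. (F (a * int i + c))\<^sup>2) * real I \<le> V * real I"
    by (rule mult_right_mono) simp
  moreover have "(\<Sum>i<I. F (a * int i + c))\<^sup>2 \<le> (\<Sum>i<I. (F (a * int i + c))\<^sup>2) * real (card {..<I})"
    by (rule sum_squared_le_sum_of_squares)
  ultimately have "(\<Sum>i<I. F (a * int i + c))\<^sup>2 \<le> real I * V"
    by (simp add: mult.commute)
  then have "\<bar>\<Sum>i<I. F (a * int i + c)\<bar> \<le> sqrt (real I * V)"
    by (metis real_sqrt_abs real_sqrt_le_mono)
  then show ?thesis by (simp add: F_def algebra_simps)
qed

text \<open>The weight that stands in for the indicator of squares: its mean over a period is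
  exactly 1, and for odd squarefree \<open>n\<close> it is bounded by the power of 2 in the
  theorem.\<close>

definition sqrt_count :: "nat \<Rightarrow> int \<Rightarrow> nat" where
  "sqrt_count n r = card {x\<in>{0..<int n}. int n dvd x\<^sup>2 - r}"

lemma dvd_diff_mod_iff: "(n::int) dvd x - (r mod n) \<longleftrightarrow> n dvd x - r"
  by (metis cong_iff_dvd_diff cong_def mod_mod_trivial)

lemma sqrt_count_mod [simp]: "sqrt_count n (r mod int n) = sqrt_count n r"
  by (simp add: sqrt_count_def dvd_diff_mod_iff)

lemma card_filter_eq_sum: "finite A \<Longrightarrow> card {x\<in>A. P x} = (\<Sum>x\<in>A. of_bool (P x))"
  by (simp add: Collect_conj_eq)

lemma sqrt_count_eq_sum: "sqrt_count n r = (\<Sum>x\<in>{0..<int n}. of_bool (int n dvd x\<^sup>2 - r))"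
  unfolding sqrt_count_def by (rule card_filter_eq_sum) simp

lemma sum_residue_class:
  fixes n a :: int
  assumes "n > 0"
  shows "(\<Sum>i\<in>{0..<n}. of_bool (n dvd a - i)) = (1::nat)"
proof -
  have "{i\<in>{0..<n}. n dvd a - i} = {a mod n}"
    using assms by (auto simp: mod_eq_dvd_iff[symmetric] cong_def mod_pos_pos_trivial)
  then show ?thesis
    by (subst card_filter_eq_sum[symmetric]) auto
qed

lemma sum_sqrt_count:
  assumes "n > 0"
  shows "(\<Sum>i\<in>{0..<int n}. sqrt_count n i) = n"
proof -
  have "(\<Sum>i\<in>{0..<int n}. sqrt_count n i)
      = (\<Sum>i\<in>{0..<int n}. \<Sum>x\<in>{0..<int n}. of_bool (int n dvd x\<^sup>2 - i))"
    by (simp add: sqrt_count_eq_sum del: sum_of_bool_eq)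
  also have "\<dots> = (\<Sum>x\<in>{0..<int n}. \<Sum>i\<in>{0..<int n}. of_bool (int n dvd x\<^sup>2 - i))"
    by (rule sum.swap)
  also have "\<dots> = n"
    using assms by (simp add: sum_residue_class del: sum_of_bool_eq)
  finally show ?thesis .
qed

text \<open>For given roots \<open>x\<close> and \<open>y\<close>, the second congruence determines
  \<open>i\<close> modulo \<open>n\<close>; only the difference of the two congruences remains as a
  condition on the pair.\<close>

lemma sum_sqrt_count_mult:
  assumes "n > 0"
  shows "(\<Sum>i\<in>{0..<int n}. sqrt_count n (i + b) * sqrt_count n (i + c))
     = card {(x,y). x \<in> {0..<int n} \<and> y \<in> {0..<int n} \<and> int n dvd x\<^sup>2 - y\<^sup>2 - (b - c)}"
proof -
  let ?R = "{0..<int n}"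
  have "(\<Sum>i\<in>?R. sqrt_count n (i + b) * sqrt_count n (i + c))
     = (\<Sum>i\<in>?R. \<Sum>x\<in>?R. \<Sum>y\<in>?R. of_bool (int n dvd x\<^sup>2 - (i+b) \<and> int n dvd y\<^sup>2 - (i+c)))"
    unfolding sqrt_count_eq_sum sum_product of_bool_conj ..
  also have "\<dots> = (\<Sum>x\<in>?R. \<Sum>y\<in>?R. \<Sum>i\<in>?R. of_bool (int n dvd x\<^sup>2 - (i+b) \<and> int n dvd y\<^sup>2 - (i+c)))"
    by (subst sum.swap, rule sum.cong[OF refl], rule sum.swap)
  also have "\<dots> = (\<Sum>x\<in>?R. \<Sum>y\<in>?R. of_bool (int n dvd x\<^sup>2 - y\<^sup>2 - (b - c)))"
  proof (intro sum.cong refl)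
    fix x y
    have eq: "int n dvd x\<^sup>2 - (i+b) \<and> int n dvd y\<^sup>2 - (i+c) \<longleftrightarrow>
       int n dvd x\<^sup>2 - y\<^sup>2 - (b - c) \<and> int n dvd (y\<^sup>2 - c) - i" for i
    proof -
      have "x\<^sup>2 - (i+b) = (x\<^sup>2 - y\<^sup>2 - (b - c)) + (y\<^sup>2 - c - i)" "y\<^sup>2 - (i+c) = y\<^sup>2 - c - i"
        by simp_all
      then show ?thesis by (metis dvd_add_left_iff)
    qed
    show "(\<Sum>i\<in>?R. of_bool (int n dvd x\<^sup>2 - (i+b) \<and> int n dvd y\<^sup>2 - (i+c))) =
        (of_bool (int n dvd x\<^sup>2 - y\<^sup>2 - (b - c)) :: nat)"
      unfolding eq of_bool_conj sum_distrib_left[symmetric]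
      using sum_residue_class[of "int n" "y\<^sup>2 - c"] assms by simp
  qed
  also have "\<dots> = (\<Sum>(x,y)\<in>?R \<times> ?R. of_bool (int n dvd x\<^sup>2 - y\<^sup>2 - (b - c)))"
    by (simp add: sum.cartesian_product del: sum_of_bool_eq)
  also have "\<dots> = card {z\<in>?R \<times> ?R. (case z of (x,y) \<Rightarrow> int n dvd x\<^sup>2 - y\<^sup>2 - (b - c))}"
    by (subst card_filter_eq_sum) (auto simp: case_prod_unfold)
  also have "{z\<in>?R \<times> ?R. (case z of (x,y) \<Rightarrow> int n dvd x\<^sup>2 - y\<^sup>2 - (b - c))} =
     {(x,y). x \<in> ?R \<and> y \<in> ?R \<and> int n dvd x\<^sup>2 - y\<^sup>2 - (b - c)}" by auto
  finally show ?thesis .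
qed

lemma card_dvd_interval:
  fixes g n :: nat
  assumes "g > 0" "g dvd n"
  shows "card {u\<in>{0..<int n}. int g dvd u} = n div g"
proof -
  have "{u\<in>{0..<int n}. int g dvd u} = (\<lambda>k. int g * int k) ` {..<n div g}"
  proof (intro equalityI subsetI)
    fix u assume u: "u \<in> {u\<in>{0..<int n}. int g dvd u}"
    then obtain k where k: "u = int g * k" by auto
    have "k \<ge> 0" using u k assms by (auto simp: zero_le_mult_iff)
    then obtain m where m: "k = int m" using nonneg_int_cases by blast
    have "g * m < n" using u k m by (auto simp flip: of_nat_mult)
    moreover obtain t where "n = g * t" using assms by auto
    ultimately have "m < n div g" using assms by simp
    then show "u \<in> (\<lambda>k. int g * int k) ` {..<n div g}" using k m by auto
  next
    fix u assume "u \<in> (\<lambda>k. int g * int k) ` {..<n div g}"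
    then obtain m where m: "u = int g * int m" "m < n div g" by auto
    obtain t where t: "n = g * t" using assms by auto
    then have "g * m < n" using m assms by simp
    then show "u \<in> {u\<in>{0..<int n}. int g dvd u}" using m by (auto simp flip: of_nat_mult)
  qed
  moreover have "inj_on (\<lambda>k. int g * int k) {..<n div g}"
    using assms by (auto simp: inj_on_def)
  ultimately show ?thesis by (simp add: card_image)
qed

text \<open>The gcd is one of the divisors \<open>g\<close> of \<open>n\<close> that divide
  \<open>u\<close>, so it is at most their sum. After exchanging sums each \<open>g\<close>
  contributes \<open>g * (n div g) = n\<close>.\<close>

lemma sum_gcd_le:
  fixes n :: nat
  assumes "n > 0"
  shows "(\<Sum>u\<in>{0..<int n}. nat (gcd u (int n))) \<le> n * card {g. g dvd n}"
proof -
  have fin: "finite {g. g dvd n}" using assms by simp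
  have "(\<Sum>u\<in>{0..<int n}. nat (gcd u (int n)))
     \<le> (\<Sum>u\<in>{0..<int n}. \<Sum>g\<in>{g. g dvd n}. if int g dvd u then g else 0)"
  proof (rule sum_mono)
    fix u :: int
    let ?g = "nat (gcd u (int n))"
    have g: "int ?g = gcd u (int n)" by simp
    have "?g dvd n" using g by (metis gcd_dvd2 of_nat_dvd_iff)
    moreover have "int ?g dvd u" by (simp add: g)
    ultimately have "?g = (if int ?g dvd u then ?g else 0)" "?g \<in> {g. g dvd n}" by simp_all
    then show "?g \<le> (\<Sum>g\<in>{g. g dvd n}. if int g dvd u then g else 0)"
      using fin member_le_sum[of ?g "{g. g dvd n}" "\<lambda>g. if int g dvd u then g else 0"] by simp
  qed
  also have "\<dots> = (\<Sum>g\<in>{g. g dvd n}. \<Sum>u\<in>{0..<int n}. if int g dvd u then g else 0)"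
    by (rule sum.swap)
  also have "\<dots> = (\<Sum>g\<in>{g. g dvd n}. n)"
  proof (rule sum.cong[OF refl])
    fix g assume g: "g \<in> {g. g dvd n}"
    then have g0: "g > 0" using assms by (auto intro: Nat.gr0I)
    have "(\<Sum>u\<in>{0..<int n}. if int g dvd u then g else 0) = (\<Sum>u\<in>{u\<in>{0..<int n}. int g dvd u}. g)"
      by (rule sum.inter_filter[symmetric]) simp
    also have "\<dots> = (n div g) * g"
      using card_dvd_interval[OF g0] g by (simp only: sum_constant) auto
    finally show "(\<Sum>u\<in>{0..<int n}. if int g dvd u then g else 0) = n" using g by simp
  qed
  also have "\<dots> = n * card {g. g dvd n}" by simp
  finally show ?thesis .
qed

lemma card_class_le:
  fixes g n :: nat and c :: int
  assumes "g > 0"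
  shows "card {v\<in>{0..<int n}. int g dvd v - c} \<le> n div g + 1"
proof -
  let ?A = "{v\<in>{0..<int n}. int g dvd v - c}"
  have inj: "inj_on (\<lambda>v. v div int g) ?A"
  proof (rule inj_onI)
    fix x y assume "x \<in> ?A" "y \<in> ?A" and d: "x div int g = y div int g"
    then have "int g dvd x - c" "int g dvd y - c" by auto
    then have "int g dvd (x - c) - (y - c)" by (rule dvd_diff)
    then have "x mod int g = y mod int g" by (simp add: mod_eq_dvd_iff)
    then show "x = y" using d by (metis div_mult_mod_eq)
  qed
  have "(\<lambda>v. v div int g) ` ?A \<subseteq> int ` {..n div g}"
  proof
    fix w assume "w \<in> (\<lambda>v. v div int g) ` ?A"
    then obtain v where v: "w = v div int g" "0 \<le> v" "v < int n" by auto
    have "w \<le> int n div int g" using v assms by (simp add: zdiv_mono1)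
    moreover have "w \<ge> 0" using v assms by (simp add: pos_imp_zdiv_nonneg_iff)
    ultimately show "w \<in> int ` {..n div g}"
      by (intro image_eqI[of _ _ "nat w"]) (auto simp: zdiv_int nat_le_iff)
  qed
  then have "card ((\<lambda>v. v div int g) ` ?A) \<le> card (int ` {..n div g})"
    by (intro card_mono) auto
  then show ?thesis using inj by (simp add: card_image)
qed

lemma card_class_le':
  fixes g n :: nat and c :: int
  assumes "g > 0" "g dvd n"
  shows "card {v\<in>{0..<int n}. int g dvd v - c} \<le> n div g"
proof (cases "n = 0")
  case False
  then have n0: "n > 0" by simp
  let ?A = "{v\<in>{0..<int n}. int g dvd v - c}"
  have "bij_betw (\<lambda>x. (x - c) mod int n) {0..<int n} {0..<int n}"
    using mod_affine_bij[of "int n" 1 "- c"] n0 by simp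
  then have inj: "inj_on (\<lambda>x. (x - c) mod int n) ?A"
    by (rule inj_on_subset[OF bij_betw_imp_inj_on]) auto
  have "(\<lambda>x. (x - c) mod int n) ` ?A \<subseteq> {u\<in>{0..<int n}. int g dvd u}"
  proof
    fix w assume "w \<in> (\<lambda>x. (x - c) mod int n) ` ?A"
    then obtain v where v: "w = (v - c) mod int n" "int g dvd v - c" by auto
    have "int g dvd int n" using assms by simp
    then have "int g dvd w" using v by (simp add: dvd_mod)
    then show "w \<in> {u\<in>{0..<int n}. int g dvd u}" using v n0 by auto
  qed
  then have "card ((\<lambda>x. (x - c) mod int n) ` ?A) \<le> card {u\<in>{0..<int n}. int g dvd u}"
    by (intro card_mono) auto
  then show ?thesis using inj card_dvd_interval[OF assms] by (simp add: card_image)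
qed simp

text \<open>If there is a solution \<open>w\<close>, all others are congruent to it modulo
  \<open>n div g\<close>, where \<open>g\<close> is the gcd of \<open>u\<close> and
  \<open>n\<close>, because \<open>u div g\<close> is invertible there.\<close>

lemma card_linear_cong_le:
  fixes n :: nat and u h :: int
  assumes "n > 0"
  shows "card {v\<in>{0..<int n}. int n dvd u * v - h} \<le> (if gcd u (int n) dvd h then nat (gcd u (int n)) else 0)"
proof (cases "{v\<in>{0..<int n}. int n dvd u * v - h} = {}")
  case False
  then obtain w where w: "int n dvd u * w - h" by auto
  define g where "g = nat (gcd u (int n))"
  have g: "int g = gcd u (int n)" by (simp add: g_def)
  have g0: "g > 0" using assms by (simp add: g_def)
  have gn: "g dvd n" using g by (metis gcd_dvd2 of_nat_dvd_iff)
  have "gcd u (int n) dvd u * w - h" using w dvd_trans gcd_dvd2 by blast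
  then have gh: "gcd u (int n) dvd h"
    by (metis dvd_diffD1 dvd_mult2 gcd_dvd1 dvd_diff_commute dvd_minus_iff diff_add_cancel dvd_add_right_iff)
  obtain m where m: "n = g * m" using gn by auto
  have m0: "m > 0" using assms m by (auto intro: Nat.gr0I)
  have sub: "{v\<in>{0..<int n}. int n dvd u * v - h} \<subseteq> {v\<in>{0..<int n}. int m dvd v - w}"
  proof safe
    fix v assume "int n dvd u * v - h"
    then have "int n dvd (u * v - h) - (u * w - h)" using w by (rule dvd_diff)
    then have d: "int n dvd u * (v - w)" by (simp add: algebra_simps)
    obtain u' where u': "u = int g * u'" using g by (metis gcd_dvd1 dvdE)
    have cop: "coprime u' (int m)"
    proof -
      have "gcd (int g * u') (int g * int m) = int g" using g u' m by simp
      then have "int g * gcd u' (int m) = int g" using gcd_mult_distrib_int[of "int g" u' "int m"] by simp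
      then show ?thesis using g0 by (simp add: coprime_iff_gcd_eq_1)
    qed
    have "int g * int m dvd int g * (u' * (v - w))" using d u' m by (simp add: mult.assoc)
    then have "int m dvd u' * (v - w)" using g0 by (simp add: dvd_mult_cancel_left)
    then show "int m dvd v - w" using cop by (metis coprime_commute coprime_dvd_mult_right_iff)
  qed
  have "card {v\<in>{0..<int n}. int n dvd u * v - h} \<le> card {v\<in>{0..<int n}. int m dvd v - w}"
    using sub by (intro card_mono) auto
  also have "\<dots> \<le> n div m" using m m0 by (intro card_class_le') auto
  also have "\<dots> = g" using m m0 by simp
  finally show ?thesis using gh g_def by simp
next
  case True
  show ?thesis unfolding True by simp
qed

text \<open>For each \<open>j'\<close> the index \<open>j\<close> lies in one class modulo
  \<open>g\<close>, which leaves at most \<open>L div g + 1\<close> values. The factor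
  \<open>g\<close> on the left is the weight with which these pairs are counted later.\<close>

lemma card_pairs_class_le:
  fixes g L :: nat and a :: int
  assumes "g > 0" "coprime a (int g)"
  shows "card {(j,j'). j < L \<and> j' < L \<and> int g dvd a * (int j - int j')} * g \<le> L\<^sup>2 + g * L"
proof -
  have "card {(j,j'). j < L \<and> j' < L \<and> int g dvd a * (int j - int j')}
     = card (SIGMA j':{..<L}. {j. j < L \<and> int g dvd a * (int j - int j')})"
    by (rule bij_betw_same_card[of "\<lambda>(x,y). (y,x)"])
       (auto simp: bij_betw_def inj_on_def image_def)
  also have "\<dots> = (\<Sum>j'<L. card {j. j < L \<and> int g dvd a * (int j - int j')})"
    by (subst card_SigmaI) auto
  also have "\<dots> \<le> (\<Sum>j'<L. L div g + 1)"
  proof (rule sum_mono)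
    fix j'
    have "card {j. j < L \<and> int g dvd a * (int j - int j')} = card (int ` {j. j < L \<and> int g dvd a * (int j - int j')})"
      by (simp add: card_image)
    also have "\<dots> \<le> card {v\<in>{0..<int L}. int g dvd v - int j'}"
    proof (rule card_mono)
      show "int ` {j. j < L \<and> int g dvd a * (int j - int j')} \<subseteq> {v\<in>{0..<int L}. int g dvd v - int j'}"
        using assms(2) by (auto simp: coprime_commute coprime_dvd_mult_right_iff)
    qed (rule finite_subset[of _ "{0..<int L}"], auto)
    also have "\<dots> \<le> L div g + 1" using assms(1) by (rule card_class_le)
    finally show "card {j. j < L \<and> int g dvd a * (int j - int j')} \<le> L div g + 1" .
  qed
  also have "\<dots> = L * (L div g + 1)" by simp
  finally have "card {(j,j'). j < L \<and> j' < L \<and> int g dvd a * (int j - int j')} * g \<le> L * (L div g + 1) * g"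
    by (rule mult_right_mono) simp
  also have "\<dots> = L * (L div g * g) + g * L" by (simp add: algebra_simps)
  also have "\<dots> \<le> L * L + g * L" by (intro add_mono mult_left_mono) auto
  finally show ?thesis by (simp add: power2_eq_square)
qed

text \<open>The map from \<open>(x, y)\<close> to \<open>(x - y, x + y)\<close> is injective modulo
  \<open>n\<close>, because 2 is invertible for odd \<open>n\<close>.\<close>

lemma card_square_diff_le:
  fixes n :: nat and h :: int
  assumes "odd n"
  shows "card {(x,y). x \<in> {0..<int n} \<and> y \<in> {0..<int n} \<and> int n dvd x\<^sup>2 - y\<^sup>2 - h}
     \<le> card {(u,v). u \<in> {0..<int n} \<and> v \<in> {0..<int n} \<and> int n dvd u * v - h}"
proof -
  let ?A = "{(x,y). x \<in> {0..<int n} \<and> y \<in> {0..<int n} \<and> int n dvd x\<^sup>2 - y\<^sup>2 - h}"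
  let ?B = "{(u,v). u \<in> {0..<int n} \<and> v \<in> {0..<int n} \<and> int n dvd u * v - h}"
  define F where "F = (\<lambda>(x,y). ((x - y) mod int n, (x + y) mod int n))"
  have n0: "n > 0" using assms by (auto intro: Nat.gr0I)
  have c2: "coprime (int n) 2" using assms by simp
  have finB: "finite ?B"
    by (rule finite_subset[of _ "{0..<int n} \<times> {0..<int n}"]) auto
  have inj: "inj_on F ?A"
  proof (rule inj_onI)
    fix z z' assume z: "z \<in> ?A" "z' \<in> ?A" "F z = F z'"
    obtain x y x' y' where xy: "z = (x,y)" "z' = (x',y')" by (metis surj_pair)
    have d1: "int n dvd (x - y) - (x' - y')" and d2: "int n dvd (x + y) - (x' + y')"
      using z xy by (simp_all add: F_def mod_eq_dvd_iff)
    have "int n dvd 2 * (x - x')" using dvd_add[OF d1 d2] by (simp add: algebra_simps)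
    then have 1: "int n dvd x - x'" using c2 coprime_dvd_mult_right_iff by blast
    have "int n dvd 2 * (y - y')" using dvd_diff[OF d2 d1] by (simp add: algebra_simps)
    then have 2: "int n dvd y - y'" using c2 coprime_dvd_mult_right_iff by blast
    have "x mod int n = x' mod int n" "y mod int n = y' mod int n"
      using 1 2 by (simp_all add: mod_eq_dvd_iff)
    then show "z = z'" using z xy by simp
  qed
  have "F ` ?A \<subseteq> ?B"
  proof
    fix w assume "w \<in> F ` ?A"
    then obtain x y where w: "w = ((x - y) mod int n, (x + y) mod int n)" and d: "int n dvd x\<^sup>2 - y\<^sup>2 - h"
      by (auto simp: F_def)
    have "((x - y) mod int n * ((x + y) mod int n)) mod int n = (x\<^sup>2 - y\<^sup>2) mod int n"
      by (simp add: mod_mult_eq power2_eq_square algebra_simps)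
    then have "int n dvd (x - y) mod int n * ((x + y) mod int n) - (x\<^sup>2 - y\<^sup>2)"
      by (simp add: mod_eq_dvd_iff)
    from dvd_add[OF this d] have "int n dvd (x - y) mod int n * ((x + y) mod int n) - h" by simp
    then show "w \<in> ?B" using w n0 by auto
  qed
  then show ?thesis using card_inj_on_le[OF inj _ finB] by blast
qed

text \<open>For fixed \<open>u\<close> with \<open>g\<close> the gcd of \<open>u\<close> and
  \<open>n\<close>, the pairs with \<open>g\<close> dividing \<open>a * (j - j')\<close> have total
  weight at most \<open>L\<^sup>2 + g * L\<close>. The \<open>L\<^sup>2\<close> parts add up to the
  squared mean; only the sum of the gcds is left as error.\<close>

lemma sqrt_count_pair_sum_le:
  fixes n L :: nat and a :: int
  assumes "odd n" "coprime a (int n)"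
  shows "(\<Sum>j<L. \<Sum>j'<L. card {(x,y). x \<in> {0..<int n} \<and> y \<in> {0..<int n} \<and>
            int n dvd x\<^sup>2 - y\<^sup>2 - (a * int j - a * int j')})
     \<le> n * L\<^sup>2 + L * (n * card {g. g dvd n})"
proof -
  have n0: "n > 0" using assms by (auto intro: Nat.gr0I)
  let ?R = "{0..<int n}"
  have "(\<Sum>j<L. \<Sum>j'<L. card {(x,y). x \<in> ?R \<and> y \<in> ?R \<and>
            int n dvd x\<^sup>2 - y\<^sup>2 - (a * int j - a * int j')})
     \<le> (\<Sum>j<L. \<Sum>j'<L. \<Sum>u\<in>?R. if gcd u (int n) dvd a * (int j - int j') then nat (gcd u (int n)) else 0)"
  proof (intro sum_mono)
    fix j j'
    have "card {(x,y). x \<in> ?R \<and> y \<in> ?R \<and> int n dvd x\<^sup>2 - y\<^sup>2 - (a * int j - a * int j')}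
       \<le> card {(u,v). u \<in> ?R \<and> v \<in> ?R \<and> int n dvd u * v - (a * int j - a * int j')}"
      using assms(1) by (rule card_square_diff_le)
    also have "{(u,v). u \<in> ?R \<and> v \<in> ?R \<and> int n dvd u * v - (a * int j - a * int j')}
       = (SIGMA u:?R. {v\<in>?R. int n dvd u * v - (a * int j - a * int j')})" by auto
    also have "card \<dots> = (\<Sum>u\<in>?R. card {v\<in>?R. int n dvd u * v - (a * int j - a * int j')})"
      by (rule card_SigmaI) (auto intro: finite_subset[of _ ?R])
    also have "\<dots> \<le> (\<Sum>u\<in>?R. if gcd u (int n) dvd a * (int j - int j') then nat (gcd u (int n)) else 0)"
      using card_linear_cong_le[OF n0] by (intro sum_mono) (simp add: right_diff_distrib)
    finally show "card {(x,y). x \<in> ?R \<and> y \<in> ?R \<and> int n dvd x\<^sup>2 - y\<^sup>2 - (a * int j - a * int j')}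
      \<le> (\<Sum>u\<in>?R. if gcd u (int n) dvd a * (int j - int j') then nat (gcd u (int n)) else 0)" .
  qed
  also have "\<dots> = (\<Sum>u\<in>?R. \<Sum>j<L. \<Sum>j'<L. if gcd u (int n) dvd a * (int j - int j') then nat (gcd u (int n)) else 0)"
    by (subst sum.swap[of _ "{..<L}" ?R]) (intro sum.cong refl sum.swap)
  also have "\<dots> \<le> (\<Sum>u\<in>?R. L\<^sup>2 + nat (gcd u (int n)) * L)"
  proof (rule sum_mono)
    fix u
    define g where "g = nat (gcd u (int n))"
    have g: "gcd u (int n) = int g" by (simp add: g_def)
    have g0: "g > 0" using n0 by (simp add: g_def)
    have gn: "g dvd n" using g by (metis gcd_dvd2 of_nat_dvd_iff)
    have cop: "coprime a (int g)"
      using assms(2) gn by (metis coprime_divisors dvd_refl of_nat_dvd_iff)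
    have "(\<Sum>j<L. \<Sum>j'<L. if int g dvd a * (int j - int j') then g else 0)
      = (\<Sum>z\<in>{..<L}\<times>{..<L}. if int g dvd a * (int (fst z) - int (snd z)) then g else 0)"
      by (simp add: sum.cartesian_product case_prod_unfold)
    also have "\<dots> = (\<Sum>z\<in>{z\<in>{..<L}\<times>{..<L}. int g dvd a * (int (fst z) - int (snd z))}. g)"
      by (rule sum.inter_filter[symmetric]) simp
    also have "\<dots> = card {z\<in>{..<L}\<times>{..<L}. int g dvd a * (int (fst z) - int (snd z))} * g"
      by (simp only: sum_constant) simp
    also have "{z\<in>{..<L}\<times>{..<L}. int g dvd a * (int (fst z) - int (snd z))}
       = {(j,j'). j < L \<and> j' < L \<and> int g dvd a * (int j - int j')}" by auto
    also have "card {(j,j'). j < L \<and> j' < L \<and> int g dvd a * (int j - int j')} * g \<le> L\<^sup>2 + g * L"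
      by (rule card_pairs_class_le[OF g0 cop])
    finally show "(\<Sum>j<L. \<Sum>j'<L. if gcd u (int n) dvd a * (int j - int j') then nat (gcd u (int n)) else 0)
       \<le> L\<^sup>2 + nat (gcd u (int n)) * L" by (simp only: g nat_int)
  qed
  also have "\<dots> = n * L\<^sup>2 + L * (\<Sum>u\<in>?R. nat (gcd u (int n)))"
    by (simp add: sum.distrib sum_distrib_left mult.commute)
  also have "\<dots> \<le> n * L\<^sup>2 + L * (n * card {g. g dvd n})"
    using sum_gcd_le[OF n0] by (intro add_left_mono mult_left_mono) auto
  finally show ?thesis .
qed

text \<open>
  Factoring \<open>x\<^sup>2 - y\<^sup>2\<close> turns the second moment into a count of solutions of \<open>u v \<equiv> a (j - j')\<close>, whose
  main term cancels exactly.
\<close>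

lemma sqrt_count_variance:
  fixes n L :: nat and a :: int
  assumes "odd n" "coprime a (int n)"
  shows "(\<Sum>i\<in>{0..<int n}. (\<Sum>j<L. real (sqrt_count n (i + a * int j)) - 1)\<^sup>2)
     \<le> real L * (real n * real (card {g. g dvd n}))"
proof -
  have n0: "n > 0" using assms by (auto intro: Nat.gr0I)
  let ?R = "{0..<int n}"
  define f where "f = (\<lambda>i. sqrt_count n i)"
  define T where "T = (\<lambda>i. \<Sum>j<L. real (f (i + a * int j)))"
  have T1: "(\<Sum>i\<in>?R. T i) = real L * real n"
  proof -
    have "(\<Sum>i\<in>?R. T i) = (\<Sum>j<L. \<Sum>i\<in>?R. real (f (i + a * int j)))"
      unfolding T_def by (rule sum.swap)
    also have "\<dots> = (\<Sum>j<L. real (\<Sum>i\<in>?R. f i))"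
      using sum_shift_mod[of "int n" f] n0 by (simp add: f_def flip: of_nat_sum)
    also have "\<dots> = real L * real n"
      using sum_sqrt_count[OF n0] by (simp add: f_def)
    finally show ?thesis .
  qed
  have T2: "(\<Sum>i\<in>?R. (T i)\<^sup>2) \<le> real (n * L\<^sup>2 + L * (n * card {g. g dvd n}))"
  proof -
    have "(\<Sum>i\<in>?R. (T i)\<^sup>2) = (\<Sum>i\<in>?R. \<Sum>j<L. \<Sum>j'<L. real (f (i + a * int j) * f (i + a * int j')))"
      by (simp add: T_def power2_eq_square sum_product)
    also have "\<dots> = (\<Sum>j<L. \<Sum>j'<L. \<Sum>i\<in>?R. real (f (i + a * int j) * f (i + a * int j')))"
      by (subst sum.swap, rule sum.cong[OF refl], rule sum.swap)
    also have "\<dots> = real (\<Sum>j<L. \<Sum>j'<L. \<Sum>i\<in>?R. f (i + a * int j) * f (i + a * int j'))"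
      by simp
    also have "(\<Sum>j<L. \<Sum>j'<L. \<Sum>i\<in>?R. f (i + a * int j) * f (i + a * int j'))
       \<le> n * L\<^sup>2 + L * (n * card {g. g dvd n})"
      using sqrt_count_pair_sum_le[OF assms, of L] sum_sqrt_count_mult[OF n0] by (simp add: f_def)
    finally show ?thesis by (simp only: of_nat_le_iff)
  qed
  have "(\<Sum>i\<in>?R. (\<Sum>j<L. real (sqrt_count n (i + a * int j)) - 1)\<^sup>2) = (\<Sum>i\<in>?R. (T i - real L)\<^sup>2)"
    by (simp add: T_def f_def sum_subtractf)
  also have "\<dots> = (\<Sum>i\<in>?R. (T i)\<^sup>2 - 2 * real L * T i + (real L)\<^sup>2)"
    by (intro sum.cong refl) (simp add: power2_eq_square algebra_simps)
  also have "\<dots> = (\<Sum>i\<in>?R. (T i)\<^sup>2) - 2 * real L * (\<Sum>i\<in>?R. T i) + real n * (real L)\<^sup>2"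
    by (simp add: sum.distrib sum_subtractf sum_distrib_left)
  also have "\<dots> \<le> real L * (real n * real (card {g. g dvd n}))"
    using T1 T2 by (simp add: power2_eq_square algebra_simps)
  finally show ?thesis .
qed

section \<open>From the mean square to root counts along progressions\<close>

lemma sqrt_count_bilinear:
  fixes n I J :: nat and a c :: int
  assumes "odd n" "coprime a (int n)" "I \<le> n"
  shows "\<bar>(\<Sum>i<I. \<Sum>j<J. real (sqrt_count n (a * int (i + j) + c))) - real I * real J\<bar>
    \<le> sqrt (real I * (real J * (real n * real (card {g. g dvd n}))))"
proof -
  have n0: "n > 0" using assms by (auto intro: Nat.gr0I)
  have "\<bar>\<Sum>i<I. \<Sum>j<J. real (sqrt_count n (a * int (i + j) + c)) - 1\<bar>
     \<le> sqrt (real I * (real J * (real n * real (card {g. g dvd n}))))"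
    using bilinear_bound[of n "\<lambda>x. real (sqrt_count n x) - 1" a I J _ c] n0 assms
      sqrt_count_variance[of n a J] by simp
  then show ?thesis by (simp add: sum_subtractf)
qed

text \<open>Each row of the \<open>L\<close> by \<open>L\<close> double sum over
  \<open>i + j\<close> consists of distinct terms of the sum over \<open>m < 2 * L\<close>. As the
  terms are nonnegative, the double sum is at most \<open>L\<close> times that sum.\<close>

lemma sqrt_count_lower:
  fixes n L :: nat and a c :: int
  assumes "odd n" "coprime a (int n)" "L \<le> n"
  shows "real L - sqrt (real n * real (card {g. g dvd n})) \<le> (\<Sum>m<2*L. real (sqrt_count n (a * int m + c)))"
proof (cases "L = 0")
  case False
  define S where "S = (\<Sum>m<2*L. real (sqrt_count n (a * int m + c)))"
  let ?E = "sqrt (real n * real (card {g. g dvd n}))"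
  have "(\<Sum>i<L. \<Sum>j<L. real (sqrt_count n (a * int (i + j) + c))) \<le> (\<Sum>i<L. S)"
  proof (rule sum_mono)
    fix i assume i: "i \<in> {..<L}"
    have "(\<Sum>j<L. real (sqrt_count n (a * int (i + j) + c)))
       = (\<Sum>m\<in>(\<lambda>j. i + j) ` {..<L}. real (sqrt_count n (a * int m + c)))"
      by (simp add: sum.reindex)
    also have "\<dots> \<le> S" unfolding S_def using i by (intro sum_mono2) auto
    finally show "(\<Sum>j<L. real (sqrt_count n (a * int (i + j) + c))) \<le> S" .
  qed
  then have "(\<Sum>i<L. \<Sum>j<L. real (sqrt_count n (a * int (i + j) + c))) \<le> real L * S" by simp
  moreover have "sqrt (real L * (real L * (real n * real (card {g. g dvd n})))) = real L * ?E"
    by (simp add: real_sqrt_mult)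
  ultimately have "real L * real L - real L * ?E \<le> real L * S"
    using sqrt_count_bilinear[OF assms, where J = L and c = c] by linarith
  then have "real L * (real L - ?E) \<le> real L * S" by (simp add: algebra_simps)
  then show ?thesis using False by (simp add: S_def)
qed simp

text \<open>Dual to the lower bound: after the shift of \<open>c\<close> by \<open>M - 1\<close>
  steps, every column \<open>j\<close> of a \<open>2 * M\<close> by \<open>M\<close> double sum
  contains all the wanted terms, namely at \<open>i = m + (M - 1) - j\<close>.\<close>

lemma sqrt_count_upper:
  fixes n M :: nat and a c :: int
  assumes "odd n" "coprime a (int n)" "2 * M \<le> n"
  shows "(\<Sum>m<M. real (sqrt_count n (a * int m + c))) \<le> 2 * real M + sqrt (2 * (real n * real (card {g. g dvd n})))"
proof (cases "M = 0")
  case False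
  define S where "S = (\<Sum>m<M. real (sqrt_count n (a * int m + c)))"
  let ?E = "sqrt (2 * (real n * real (card {g. g dvd n})))"
  define c' where "c' = c - a * (int M - 1)"
  define f where "f = (\<lambda>m. real (sqrt_count n (a * int m + c')))"
  have "real M * S = (\<Sum>j<M. S)" by simp
  also have "\<dots> \<le> (\<Sum>j<M. \<Sum>i<2*M. f (i + j))"
  proof (rule sum_mono)
    fix j assume j: "j \<in> {..<M}"
    have "S = (\<Sum>m<M. f ((m + (M - 1) - j) + j))"
      unfolding S_def f_def
    proof (intro sum.cong refl)
      fix m
      have "int (m + (M - 1) - j + j) = int m + (int M - 1)" using j by auto
      then show "real (sqrt_count n (a * int m + c)) = real (sqrt_count n (a * int (m + (M - 1) - j + j) + c'))"
        by (simp add: c'_def algebra_simps)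
    qed
    also have "\<dots> = (\<Sum>i\<in>(\<lambda>m. m + (M - 1) - j) ` {..<M}. f (i + j))"
      using j by (subst sum.reindex) (auto simp: inj_on_def)
    also have "\<dots> \<le> (\<Sum>i<2*M. f (i + j))"
      using j by (intro sum_mono2) (auto simp: f_def)
    finally show "S \<le> (\<Sum>i<2*M. f (i + j))" .
  qed
  also have "\<dots> = (\<Sum>i<2*M. \<Sum>j<M. f (i + j))" by (rule sum.swap)
  also have "\<dots> \<le> real (2 * M) * real M + sqrt (real (2 * M) * (real M * (real n * real (card {g. g dvd n}))))"
    using sqrt_count_bilinear[OF assms, where J = M and c = c'] unfolding f_def by linarith
  also have "real (2 * M) * (real M * (real n * real (card {g. g dvd n})))
     = (real M)\<^sup>2 * (2 * (real n * real (card {g. g dvd n})))" by (simp add: power2_eq_square)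
  also have "sqrt \<dots> = real M * ?E" by (simp add: real_sqrt_mult)
  finally have "real M * S \<le> real M * (2 * real M + ?E)" by (simp add: algebra_simps)
  then show ?thesis using False by (simp add: S_def)
qed simp

section \<open>Root counts modulo squarefree numbers and the weight of the theorem\<close>

lemma sqrt_count_coprime_mult:
  assumes "coprime m n" "m > 0" "n > 0"
  shows "sqrt_count (m * n) r = sqrt_count m r * sqrt_count n r"
proof -
  let ?S = "\<lambda>k. {x\<in>{0..<int k}. int k dvd x\<^sup>2 - r}"
  have dvd_mod: "int k dvd (x mod int k)\<^sup>2 - r \<longleftrightarrow> int k dvd x\<^sup>2 - r" for k x
  proof -
    have "((x mod int k)\<^sup>2 - r) mod int k = (x\<^sup>2 - r) mod int k"
      by (metis mod_diff_left_eq power_mod)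
    then show ?thesis by (simp only: dvd_eq_mod_eq_0)
  qed
  have cop: "coprime (int m) (int n)" using assms by simp
  have "bij_betw (\<lambda>x. (x mod int m, x mod int n)) (?S (m * n)) (?S m \<times> ?S n)"
  proof (rule bij_betw_imageI)
    show "inj_on (\<lambda>x. (x mod int m, x mod int n)) (?S (m * n))"
    proof (rule inj_onI)
      fix x y assume xy: "x \<in> ?S (m * n)" "y \<in> ?S (m * n)"
        "(x mod int m, x mod int n) = (y mod int m, y mod int n)"
      then have "int m dvd x - y" "int n dvd x - y" by (simp_all add: mod_eq_dvd_iff)
      then have "int (m * n) dvd x - y" using cop by (simp add: divides_mult)
      then have "x mod int (m * n) = y mod int (m * n)" by (simp only: mod_eq_dvd_iff)
      then show "x = y" using xy by simp
    qed
    show "(\<lambda>x. (x mod int m, x mod int n)) ` ?S (m * n) = ?S m \<times> ?S n"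
    proof (intro equalityI subsetI)
      fix z assume "z \<in> (\<lambda>x. (x mod int m, x mod int n)) ` ?S (m * n)"
      then obtain x where z: "z = (x mod int m, x mod int n)" and x: "int (m * n) dvd x\<^sup>2 - r" by auto
      have "int m dvd x\<^sup>2 - r" "int n dvd x\<^sup>2 - r"
        using x by (auto intro: dvd_mult_left dvd_mult_right)
      then show "z \<in> ?S m \<times> ?S n" using z assms by (simp add: dvd_mod)
    next
      fix z assume "z \<in> ?S m \<times> ?S n"
      then obtain u v where z: "z = (u, v)" "u \<in> ?S m" "v \<in> ?S n" by auto
      obtain x where x: "[x = u] (mod int m)" "[x = v] (mod int n)"
        using binary_chinese_remainder_int[OF cop] by blast
      define w where "w = x mod int (m * n)"
      have w: "w mod int m = u" "w mod int n = v"
        using x z by (simp_all add: w_def cong_def mod_mod_cancel)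
      have "int m dvd w\<^sup>2 - r" using z dvd_mod[of m w] w by simp
      moreover have "int n dvd w\<^sup>2 - r" using z dvd_mod[of n w] w by simp
      ultimately have "int (m * n) dvd w\<^sup>2 - r" using cop by (simp add: divides_mult)
      moreover have "w \<in> {0..<int (m * n)}" using assms by (simp add: w_def)
      ultimately show "z \<in> (\<lambda>x. (x mod int m, x mod int n)) ` ?S (m * n)"
        using z w by (intro image_eqI[of _ _ w]) auto
    qed
  qed
  then have "card (?S (m * n)) = card (?S m \<times> ?S n)" by (rule bij_betw_same_card)
  then show ?thesis by (simp add: sqrt_count_def card_cartesian_product)
qed

lemma squarefree_mult_imp_coprime:
  fixes a b :: nat
  assumes "squarefree (a * b)"
  shows "coprime a b"
proof -
  have "(gcd a b)\<^sup>2 dvd a * b" by (simp add: power2_eq_square mult_dvd_mono)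
  from squarefreeD[OF assms this] show ?thesis by (simp only: nat_dvd_1_iff_1 coprime_iff_gcd_eq_1)
qed

text \<open>With \<open>g\<close> the gcd of \<open>t\<close> and \<open>x\<close> and
  \<open>t = g * t'\<close>, coprimality forces \<open>t'\<close> to divide \<open>g\<close>. So the
  square of \<open>t'\<close> divides \<open>t\<close>, and \<open>t'\<close> is a unit.\<close>

lemma squarefree_dvd_power2:
  fixes t :: nat and x :: int
  assumes "squarefree t" "int t dvd x\<^sup>2"
  shows "int t dvd x"
proof -
  define g where "g = gcd (int t) x"
  have g0: "g \<noteq> 0" using assms(1) by (auto simp: g_def)
  obtain t' x' where tx: "int t = g * t'" "x = g * x'"
    unfolding g_def by (meson dvdE gcd_dvd1 gcd_dvd2)
  have "g * gcd t' x' = g * 1" unfolding g_def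
    by (metis g_def gcd_mult_distrib_int mult.right_neutral abs_of_nonneg gcd_ge_0_int tx)
  then have cop: "coprime t' x'" using g0 unfolding coprime_iff_gcd_eq_1 by (metis mult_left_cancel)
  have "g * t' dvd g * (g * x'\<^sup>2)" using assms(2) tx by (simp add: power2_eq_square mult_ac)
  then have "t' dvd g * x'\<^sup>2" using g0 by (simp add: dvd_mult_cancel_left)
  then have "t' dvd g" using cop by (simp add: coprime_dvd_mult_left_iff)
  then have "t'\<^sup>2 dvd int t" using tx by (simp add: power2_eq_square mult_dvd_mono)
  then have "int ((nat \<bar>t'\<bar>)\<^sup>2) dvd int t" by simp
  then have "(nat \<bar>t'\<bar>)\<^sup>2 dvd t" by (simp only: int_dvd_int_iff)
  then have "nat \<bar>t'\<bar> = 1" using squarefreeD[OF assms(1)] by simp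
  then have "\<bar>t'\<bar> = 1" by linarith
  then have "int t dvd g" using tx by (simp add: abs_if split: if_splits)
  then show ?thesis by (simp add: g_def)
qed

lemma sqrt_count_dvd:
  assumes "squarefree t" "int t dvd r"
  shows "sqrt_count t r = 1"
proof -
  have t0: "t > 0" using assms(1) by (auto intro: Nat.gr0I)
  have "{x\<in>{0..<int t}. int t dvd x\<^sup>2 - r} = {0}"
  proof (intro equalityI subsetI)
    fix x assume "x \<in> {x\<in>{0..<int t}. int t dvd x\<^sup>2 - r}"
    then have x: "0 \<le> x" "x < int t" "int t dvd x\<^sup>2 - r" by auto
    have "int t dvd (x\<^sup>2 - r) + r" using x(3) assms(2) by (rule dvd_add)
    then have "int t dvd x" using squarefree_dvd_power2[OF assms(1), of x] by simp
    then show "x \<in> {0}" using x zdvd_not_zless[of x "int t"] by force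
  qed (use assms t0 in auto)
  then show ?thesis by (simp add: sqrt_count_def)
qed

lemma sqrt_count_prime_le:
  assumes "prime p"
  shows "sqrt_count p r \<le> 2"
proof (cases "{x\<in>{0..<int p}. int p dvd x\<^sup>2 - r} = {}")
  case False
  then obtain w where w: "0 \<le> w" "w < int p" "int p dvd w\<^sup>2 - r" by auto
  have "{x\<in>{0..<int p}. int p dvd x\<^sup>2 - r} \<subseteq> {w, (- w) mod int p}"
  proof
    fix x assume "x \<in> {x\<in>{0..<int p}. int p dvd x\<^sup>2 - r}"
    then have x: "0 \<le> x" "x < int p" "int p dvd x\<^sup>2 - r" by auto
    have "int p dvd (x\<^sup>2 - r) - (w\<^sup>2 - r)" using x(3) w(3) by (rule dvd_diff)
    then have "int p dvd (x - w) * (x - (- w))" by (simp add: power2_eq_square algebra_simps)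
    then have "int p dvd x - w \<or> int p dvd x - (- w)"
      using assms by (simp add: prime_dvd_mult_iff)
    then have "x mod int p = w mod int p \<or> x mod int p = (- w) mod int p"
      by (simp only: mod_eq_dvd_iff)
    then show "x \<in> {w, (- w) mod int p}" using x w by auto
  qed
  then have "sqrt_count p r \<le> card {w, (- w) mod int p}"
    unfolding sqrt_count_def by (intro card_mono) auto
  also have "\<dots> \<le> 2" by (simp add: card_insert_if)
  finally show ?thesis .
next
  case True
  show ?thesis unfolding sqrt_count_def True by simp
qed

text \<open>Peeling off one prime at a time: a prime dividing \<open>r\<close> has the single root
  0, any other prime has at most two roots. The bound is the weight of the theorem by
  \<open>omega_diff_gcd\<close>.\<close>

lemma sqrt_count_le_power2:
  assumes "squarefree n"
  shows "sqrt_count n r \<le> 2 ^ card {q\<in>prime_factors n. \<not> int q dvd r}"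
  using assms
proof (induction n rule: less_induct)
  case (less n)
  have n0: "n > 0" using less.prems by (auto intro: Nat.gr0I)
  show ?case
  proof (cases "n = 1")
    case True
    have "sqrt_count 1 r = 1" by (rule sqrt_count_dvd) auto
    then show ?thesis using True by simp
  next
    case False
    then obtain p where p: "prime p" "p dvd n" using prime_factor_nat by blast
    then obtain m where m: "n = p * m" by auto
    have p1: "p > 1" using p prime_gt_1_nat by blast
    have m0: "m > 0" using n0 m by auto
    have cop: "coprime p m" using less.prems m squarefree_mult_imp_coprime by blast
    have sqm: "squarefree m" using less.prems m squarefree_multD by blast
    have npm: "\<not> p dvd m" using cop p prime_nat_iff
      by (metis coprime_common_divisor_nat dvd_refl less_irrefl p1 nat_dvd_1_iff_1)
    have IH: "sqrt_count m r \<le> 2 ^ card {q\<in>prime_factors m. \<not> int q dvd r}"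
      using less.IH[of m] sqm m p1 m0 by auto
    have pf: "prime_factors n = insert p (prime_factors m)"
      using m m0 p p1 by (simp add: prime_factors_product prime_prime_factors)
    have pnm: "p \<notin> prime_factors m" using npm by (auto simp: prime_factors_dvd)
    have eq: "sqrt_count n r = sqrt_count p r * sqrt_count m r"
      unfolding m using cop p1 m0 by (intro sqrt_count_coprime_mult) auto
    show ?thesis
    proof (cases "int p dvd r")
      case True
      have "squarefree p" using p by (simp add: squarefree_prime)
      then have "sqrt_count p r = 1" using True by (rule sqrt_count_dvd)
      moreover have "{q\<in>prime_factors n. \<not> int q dvd r} = {q\<in>prime_factors m. \<not> int q dvd r}"
        using pf True by auto
      ultimately show ?thesis using IH eq by simp
    next
      case False
      have "{q\<in>prime_factors n. \<not> int q dvd r} = insert p {q\<in>prime_factors m. \<not> int q dvd r}"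
        using pf False by auto
      then have "card {q\<in>prime_factors n. \<not> int q dvd r} = Suc (card {q\<in>prime_factors m. \<not> int q dvd r})"
        using pnm by simp
      moreover have "sqrt_count n r \<le> 2 * 2 ^ card {q\<in>prime_factors m. \<not> int q dvd r}"
        unfolding eq using sqrt_count_prime_le[OF p(1)] IH by (rule mult_le_mono)
      ultimately show ?thesis by simp
    qed
  qed
qed

text \<open>The subtraction on naturals does not truncate, since the prime factors of the gcd are
  among those of \<open>d\<close>.\<close>

lemma omega_diff_gcd:
  assumes "d > 0" "r > 0"
  shows "omega d - omega (gcd d (nat r)) = card {q\<in>prime_factors d. \<not> int q dvd r}"
proof -
  have g: "prime_factors (gcd d (nat r)) = {q\<in>prime_factors d. int q dvd r}"
  proof -
    have "int q dvd r \<longleftrightarrow> q dvd nat r" for q using assms by (metis int_dvd_int_iff int_nat_eq less_imp_le)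
    then show ?thesis using assms by (auto simp: prime_factors_dvd)
  qed
  have "card {q\<in>prime_factors d. \<not> int q dvd r} = card (prime_factors d - {q\<in>prime_factors d. int q dvd r})"
    by (rule arg_cong[of _ _ card]) auto
  also have "\<dots> = card (prime_factors d) - card {q\<in>prime_factors d. int q dvd r}"
    by (rule card_Diff_subset) auto
  finally show ?thesis by (simp add: omega_def g)
qed

section \<open>Sums of Jacobi symbols\<close>

lemma Legendre_cong:
  assumes "[a = b] (mod p)"
  shows "Legendre a p = Legendre b p"
proof -
  have "[x = a] (mod p) \<longleftrightarrow> [x = b] (mod p)" for x
    using assms by (simp add: cong_def)
  moreover have "[a = 0] (mod p) \<longleftrightarrow> [b = 0] (mod p)"
    using assms by (simp add: cong_def)
  ultimately show ?thesis unfolding Legendre_def QuadRes_def by simp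
qed

lemma Legendre_mod [simp]: "Legendre (a mod p) p = Legendre a p"
  by (rule Legendre_cong) simp

lemma Legendre_cases: "Legendre a p = -1 \<or> Legendre a p = 0 \<or> Legendre a p = 1"
  by (simp add: Legendre_def)

lemma Legendre_eq_0_iff: "Legendre a p = 0 \<longleftrightarrow> p dvd a"
  by (simp add: Legendre_def cong_0_iff)

text \<open>Turns congruences from Euler's criterion into equalities between symbols, whose values
  lie in {-1, 0, 1}.\<close>

lemma cong_small_eq:
  fixes a b :: int
  assumes "[a = b] (mod int p)" "\<bar>a\<bar> \<le> 1" "\<bar>b\<bar> \<le> 1" "p > 2"
  shows "a = b"
proof (rule ccontr)
  assume "a \<noteq> b"
  moreover have "int p dvd a - b" using assms(1) by (simp add: cong_iff_dvd_diff)
  ultimately have "int p \<le> \<bar>a - b\<bar>" using dvd_imp_le_int[of "a - b" "int p"] by simp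
  then show False using assms by linarith
qed

lemma Legendre_mult:
  assumes "prime p" "p > 2"
  shows "Legendre (a * b) (int p) = Legendre a (int p) * Legendre b (int p)"
proof (rule cong_small_eq[OF _ _ _ assms(2)])
  let ?k = "(p - 1) div 2"
  have "[Legendre (a * b) (int p) = (a * b) ^ ?k] (mod int p)"
    by (rule euler_criterion[OF assms])
  moreover have "[Legendre a (int p) * Legendre b (int p) = a ^ ?k * b ^ ?k] (mod int p)"
    by (intro cong_mult euler_criterion[OF assms])
  ultimately show "[Legendre (a * b) (int p) = Legendre a (int p) * Legendre b (int p)] (mod int p)"
    unfolding power_mult_distrib by (metis cong_sym cong_trans)
  show "\<bar>Legendre (a * b) (int p)\<bar> \<le> 1"
    using Legendre_cases[of "a * b" "int p"] by auto
  show "\<bar>Legendre a (int p) * Legendre b (int p)\<bar> \<le> 1"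
    using Legendre_cases[of a "int p"] Legendre_cases[of b "int p"] by auto
qed

text \<open>Squaring is not injective on the residues, as 1 and \<open>p - 1\<close> have the same
  square; on a finite set it is therefore not surjective.\<close>

lemma ex_nonresidue:
  assumes "prime p" "p > 2"
  obtains g where "Legendre g (int p) = -1"
proof -
  let ?R = "{0..<int p}"
  let ?f = "\<lambda>x::int. x\<^sup>2 mod int p"
  have "?f (int p - 1) = ?f 1"
  proof -
    have "(int p - 1)\<^sup>2 - 1\<^sup>2 = int p * (int p - 2)" by (simp add: power2_eq_square algebra_simps)
    then have "int p dvd (int p - 1)\<^sup>2 - 1\<^sup>2" by simp
    then show ?thesis by (simp only: mod_eq_dvd_iff)
  qed
  moreover have "int p - 1 \<in> ?R" "1 \<in> ?R" "int p - 1 \<noteq> 1" using assms by auto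
  ultimately have ninj: "\<not> inj_on ?f ?R" by (metis inj_onD)
  have sub: "?f ` ?R \<subseteq> ?R" using assms by auto
  have "?f ` ?R \<noteq> ?R"
    using ninj by (metis eq_card_imp_inj_on finite_atLeastLessThan_int)
  then obtain g where g: "g \<in> ?R" "g \<notin> ?f ` ?R" using sub by blast
  have "\<not> QuadRes (int p) g"
  proof
    assume "QuadRes (int p) g"
    then obtain y where "[y\<^sup>2 = g] (mod int p)" by (auto simp: QuadRes_def)
    then have "?f (y mod int p) = g" using g by (simp add: cong_def power_mod)
    moreover have "y mod int p \<in> ?R" using assms by simp
    ultimately show False using g(2) by blast
  qed
  moreover have "\<not> [g = 0] (mod int p)"
  proof
    assume "[g = 0] (mod int p)"
    then have "g = ?f 0" using g by (simp add: cong_def)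
    moreover have "0 \<in> ?R" using assms by simp
    ultimately show False using g(2) by blast
  qed
  ultimately show ?thesis using that[of g] by (simp add: Legendre_def)
qed

text \<open>Multiplication by a nonresidue permutes the residues and changes the sign of the
  sum.\<close>

lemma sum_Legendre:
  assumes "prime p" "p > 2"
  shows "(\<Sum>x\<in>{0..<int p}. Legendre x (int p)) = 0"
proof -
  obtain g where g: "Legendre g (int p) = -1" using ex_nonresidue[OF assms] .
  then have "\<not> int p dvd g" using Legendre_eq_0_iff[of g "int p"] by auto
  then have cop: "coprime g (int p)"
    using assms(1) prime_imp_coprime[of "int p" g] by (simp add: coprime_commute)
  have "(\<Sum>x\<in>{0..<int p}. Legendre (g * x + 0) (int p)) = (\<Sum>x\<in>{0..<int p}. Legendre x (int p))"
    by (rule sum_affine_mod) (use cop assms in auto)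
  then show ?thesis by (simp add: Legendre_mult[OF assms] g sum_negf)
qed

lemma sum_Legendre_affine:
  assumes "prime p" "p > 2" "\<not> int p dvd a"
  shows "(\<Sum>x\<in>{0..<int p}. Legendre (a * x + c) (int p)) = 0"
proof -
  have cop: "coprime a (int p)"
    using assms prime_imp_coprime[of "int p" a] by (simp add: coprime_commute)
  have "(\<Sum>x\<in>{0..<int p}. Legendre (a * x + c) (int p)) = (\<Sum>x\<in>{0..<int p}. Legendre x (int p))"
    by (rule sum_affine_mod) (use cop assms in auto)
  then show ?thesis using sum_Legendre[OF assms(1,2)] by simp
qed

section \<open>Mean square of the Jacobi symbol along progressions\<close>

text \<open>This is the Jacobi symbol only for squarefree \<open>d\<close>, as each prime factor is taken once.\<close>

definition jacobi :: "nat \<Rightarrow> int \<Rightarrow> int" where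
  "jacobi d n = (\<Prod>q\<in>prime_factors d. Legendre n (int q))"

lemma odd_prime_factor_gt_2:
  fixes d q :: nat
  assumes "odd d" "q \<in> prime_factors d"
  shows "prime q" "q > 2"
proof -
  show "prime q" using assms by auto
  then have "q \<ge> 2" by (rule prime_ge_2_nat)
  moreover have "q \<noteq> 2" using assms by auto
  ultimately show "q > 2" by simp
qed

lemma jacobi_cong:
  assumes "[a = b] (mod int d)"
  shows "jacobi d a = jacobi d b"
  unfolding jacobi_def
proof (intro prod.cong refl Legendre_cong)
  fix q assume "q \<in> prime_factors d"
  then have "int q dvd int d" by auto
  then show "[a = b] (mod int q)" using assms cong_dvd_modulus by blast
qed

lemma jacobi_mod [simp]: "jacobi d (a mod int d) = jacobi d a"
  by (rule jacobi_cong) simp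

lemma jacobi_mult: "odd d \<Longrightarrow> jacobi d (a * b) = jacobi d a * jacobi d b"
  unfolding jacobi_def prod.distrib[symmetric]
  by (intro prod.cong refl Legendre_mult odd_prime_factor_gt_2)

lemma jacobi_cases: "jacobi d n = -1 \<or> jacobi d n = 0 \<or> jacobi d n = 1"
proof -
  have "(\<Prod>q\<in>A. Legendre n (int q)) \<in> {-1, 0, 1}" if "finite A" for A
    using that
  proof induction
    case (insert q A)
    then show ?case using Legendre_cases[of n "int q"] by auto
  qed simp
  then show ?thesis unfolding jacobi_def by (metis finite_set_mset insertE singletonD)
qed

lemma jacobi_1 [simp]: "odd d \<Longrightarrow> jacobi d 1 = 1"
proof -
  assume "odd d"
  have "Legendre 1 (int q) = 1" if "q \<in> prime_factors d" for q
  proof -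
    have "prime q" using that by (rule in_prime_factors_imp_prime)
    then have "q > 1" by (rule prime_gt_1_nat)
    then have "\<not> [1 = 0] (mod int q)"
      by (simp add: cong_0_iff)
    moreover have "QuadRes (int q) 1" unfolding QuadRes_def by (rule exI[of _ 1]) simp
    ultimately show ?thesis by (simp add: Legendre_def)
  qed
  then show ?thesis by (simp add: jacobi_def)
qed

lemma jacobi_nonzero_coprime:
  assumes "d > 0" "jacobi d v \<noteq> 0"
  shows "coprime v (int d)"
proof (rule ccontr)
  assume "\<not> coprime v (int d)"
  then have "\<not> coprime (nat \<bar>v\<bar>) d" by (simp add: coprime_int_iff[symmetric])
  then obtain q where q: "prime q" "q dvd nat \<bar>v\<bar>" "q dvd d"
    by (metis coprime_iff_gcd_eq_1 gcd_nat.bounded_iff prime_factor_nat)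
  then have "int q dvd v" by simp
  then have "Legendre v (int q) = 0" by (simp add: Legendre_eq_0_iff)
  moreover have "q \<in> prime_factors d" using q assms by (simp add: prime_factors_dvd)
  ultimately show False using assms(2) by (auto simp: jacobi_def)
qed

lemma squarefree_not_dvd_prime:
  fixes d :: nat and h :: int
  assumes "squarefree d" "\<not> int d dvd h"
  obtains p where "prime p" "p dvd d" "\<not> int p dvd h"
proof -
  define g where "g = gcd d (nat \<bar>h\<bar>)"
  have gd: "g dvd d" and gh: "g dvd nat \<bar>h\<bar>" unfolding g_def by (rule gcd_dvd1, rule gcd_dvd2)
  obtain t where t: "d = g * t" using gd by auto
  have "t \<noteq> 1" using t gh assms(2) by auto
  then obtain p where p: "prime p" "p dvd t" using prime_factor_nat by blast
  have "\<not> int p dvd h"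
  proof
    assume "int p dvd h"
    then have "p dvd nat \<bar>h\<bar>" by simp
    moreover have "p dvd d" using p t by simp
    ultimately have "p dvd g" unfolding g_def by (intro gcd_greatest)
    then have "p\<^sup>2 dvd d" using p t by (simp add: power2_eq_square mult_dvd_mono)
    then have "p dvd 1" using assms(1) squarefreeD by blast
    then show False using p by auto
  qed
  then show ?thesis using that[of p] p t by simp
qed

lemma jacobi_split:
  assumes "prime p" "\<not> p dvd m" "m > 0"
  shows "jacobi (p * m) n = Legendre n (int p) * jacobi m n"
proof -
  have "prime_factors (p * m) = insert p (prime_factors m)"
    using assms by (subst prime_factors_product) (auto simp: prime_prime_factors)
  moreover have "p \<notin> prime_factors m" using assms by auto
  ultimately show ?thesis by (simp add: jacobi_def)
qed

text \<open>Some prime \<open>p\<close> dividing \<open>d\<close> does not divide \<open>h\<close>.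
  Shifting \<open>v\<close> by multiples of \<open>m = d div p\<close> changes only the Legendre
  factor at \<open>p\<close>, whose argument then runs through all residues modulo \<open>p\<close>;
  averaging over these shifts gives 0.\<close>

lemma sum_jacobi_progression:
  fixes d :: nat and i h :: int
  assumes d: "odd d" "squarefree d" and h: "\<not> int d dvd h"
  shows "(\<Sum>v\<in>{0..<int d}. jacobi d (i + v * h)) = 0"
proof -
  obtain p where p: "prime p" "p dvd d" "\<not> int p dvd h"
    using squarefree_not_dvd_prime[OF d(2) h] .
  obtain m where m: "d = p * m" using p by auto
  have d0: "d > 0" using d by (auto intro: Nat.gr0I)
  then have m0: "m > 0" using m by (auto intro: Nat.gr0I)
  have p2: "p > 2" using odd_prime_factor_gt_2[OF d(1), of p] p d0 by (simp add: prime_factors_dvd)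
  have npm: "\<not> p dvd m"
  proof
    assume "p dvd m"
    then have "p\<^sup>2 dvd d" using m by (simp add: power2_eq_square mult_dvd_mono)
    then have "p dvd 1" using d(2) squarefreeD by blast
    then show False using p by auto
  qed
  define F where "F = (\<lambda>v. jacobi d (i + v * h))"
  have Fper: "F (v mod int d) = F v" for v
  proof -
    have "(i + v mod int d * h) mod int d = (i + v * h) mod int d"
      by (metis mod_add_right_eq mod_mult_left_eq)
    then show ?thesis unfolding F_def by (intro jacobi_cong) (simp add: cong_def)
  qed
  have "int p * (\<Sum>v\<in>{0..<int d}. F v) = (\<Sum>w\<in>{0..<int p}. \<Sum>v\<in>{0..<int d}. F v)" by simp
  also have "\<dots> = (\<Sum>w\<in>{0..<int p}. \<Sum>v\<in>{0..<int d}. F (v + int m * w))"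
    using sum_shift_mod[of "int d" F] Fper d0 by simp
  also have "\<dots> = (\<Sum>v\<in>{0..<int d}. \<Sum>w\<in>{0..<int p}. F (v + int m * w))" by (rule sum.swap)
  also have "\<dots> = (\<Sum>v\<in>{0..<int d}. 0)"
  proof (rule sum.cong[OF refl])
    fix v
    have "F (v + int m * w) = jacobi m (i + v * h) * Legendre (int m * h * w + (i + v * h)) (int p)" for w
    proof -
      have eq: "i + (v + int m * w) * h = (i + v * h) + int m * (w * h)" by (simp add: algebra_simps)
      have "jacobi m ((i + v * h) + int m * (w * h)) = jacobi m (i + v * h)"
        by (rule jacobi_cong) (simp add: cong_def)
      then have "F (v + int m * w) = Legendre ((i + v * h) + int m * (w * h)) (int p) * jacobi m (i + v * h)"
        unfolding F_def m eq using jacobi_split[OF p(1) npm m0] by simp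
      then show ?thesis by (simp add: algebra_simps)
    qed
    then have "(\<Sum>w\<in>{0..<int p}. F (v + int m * w))
       = jacobi m (i + v * h) * (\<Sum>w\<in>{0..<int p}. Legendre (int m * h * w + (i + v * h)) (int p))"
      by (simp add: sum_distrib_left)
    also have "\<not> int p dvd int m * h"
      using p npm by (simp add: prime_dvd_mult_iff)
    then have "(\<Sum>w\<in>{0..<int p}. Legendre (int m * h * w + (i + v * h)) (int p)) = 0"
      by (rule sum_Legendre_affine[OF p(1) p2])
    finally show "(\<Sum>w\<in>{0..<int p}. F (v + int m * w)) = 0" by simp
  qed
  finally show ?thesis using p by (simp add: F_def)
qed

text \<open>
  The left-hand side does not change when \<open>a\<close> is replaced by another unit, so it can be averaged over all
  \<open>v\<close> modulo \<open>d\<close>; then the terms with \<open>j \<noteq> j'\<close> vanish.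
\<close>

lemma jacobi_variance:
  fixes d J :: nat and a :: int
  assumes d: "odd d" "squarefree d" and J: "J \<le> d" and a: "coprime a (int d)"
  shows "(\<Sum>i\<in>{0..<int d}. (\<Sum>j<J. jacobi d (i + a * int j))\<^sup>2) \<le> int d * int J"
proof -
  let ?R = "{0..<int d}"
  have d0: "d > 0" using d by (auto intro: Nat.gr0I)
  define A where "A = (\<lambda>v. \<Sum>i\<in>?R. (\<Sum>j<J. jacobi d (i + v * int j))\<^sup>2)"
  define U where "U = {v\<in>?R. jacobi d v \<noteq> 0}"
  define \<phi> where "\<phi> = (\<Sum>i\<in>?R. (jacobi d i)\<^sup>2)"
  have sq: "(jacobi d v)\<^sup>2 = 1" if "jacobi d v \<noteq> 0" for v
    using jacobi_cases[of d v] that by auto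
  \<comment> \<open>Substituting \<open>v * i\<close> for \<open>i\<close> pulls the factor
    \<open>jacobi d v\<close> out of the inner sum, and its square is 1.\<close>
  have AU: "A v = A 1" if "jacobi d v \<noteq> 0" for v
  proof -
    have cop: "coprime v (int d)" using jacobi_nonzero_coprime[OF d0 that] .
    define G where "G = (\<lambda>i. (\<Sum>j<J. jacobi d (i + v * int j))\<^sup>2)"
    have Gper: "G (x mod int d) = G x" for x
    proof -
      have "jacobi d (x mod int d + b) = jacobi d (x + b)" for b
        by (rule jacobi_cong) (simp add: cong_def mod_simps)
      then show ?thesis by (simp add: G_def)
    qed
    have "A v = (\<Sum>i\<in>?R. G (v * i + 0))"
      unfolding A_def using sum_affine_mod[of "int d" v G 0] Gper d0 cop by (simp add: G_def)
    also have "\<dots> = (\<Sum>i\<in>?R. (\<Sum>j<J. jacobi d (i + 1 * int j))\<^sup>2)"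
    proof (rule sum.cong[OF refl])
      fix i
      have "(\<Sum>j<J. jacobi d (v * i + 0 + v * int j)) = jacobi d v * (\<Sum>j<J. jacobi d (i + 1 * int j))"
        by (simp add: sum_distrib_left jacobi_mult[OF d(1), symmetric] distrib_left)
      then show "G (v * i + 0) = (\<Sum>j<J. jacobi d (i + 1 * int j))\<^sup>2"
        unfolding G_def by (simp add: power_mult_distrib sq[OF that])
    qed
    finally show ?thesis by (simp add: A_def)
  qed
  have cardU: "int (card U) = \<phi>"
  proof -
    have "\<phi> = (\<Sum>i\<in>?R. if jacobi d i \<noteq> 0 then 1 else 0)"
      unfolding \<phi>_def by (intro sum.cong refl) (auto simp: sq)
    also have "\<dots> = (\<Sum>i\<in>U. 1)" unfolding U_def by (rule sum.inter_filter[symmetric]) simp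
    finally show ?thesis by simp
  qed
  have phi0: "\<phi> > 0"
  proof -
    have "1 mod int d \<in> U" using d0 d by (simp add: U_def)
    moreover have "finite U" by (simp add: U_def)
    ultimately show ?thesis using cardU by (metis card_gt_0_iff empty_iff of_nat_0_less_iff)
  qed
  have off: "(\<Sum>v\<in>?R. \<Sum>i\<in>?R. jacobi d (i + v * int j) * jacobi d (i + v * int j'))
     = (if j = j' then int d * \<phi> else 0)" if "j < J" "j' < J" for j j'
  proof -
    have "(\<Sum>i\<in>?R. jacobi d (i + v * int j) * jacobi d (i + v * int j'))
       = (\<Sum>i\<in>?R. jacobi d i * jacobi d (i + v * (int j' - int j)))" for v
    proof -
      have "(\<Sum>i\<in>?R. (\<lambda>x. jacobi d x * jacobi d (x + v * (int j' - int j))) (i + v * int j))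
         = (\<Sum>i\<in>?R. jacobi d i * jacobi d (i + v * (int j' - int j)))"
      proof (rule sum_shift_mod)
        fix x
        have "jacobi d (x mod int d + b) = jacobi d (x + b)" for b
          by (rule jacobi_cong) (simp add: cong_def mod_simps)
        then show "jacobi d (x mod int d) * jacobi d (x mod int d + v * (int j' - int j)) =
          jacobi d x * jacobi d (x + v * (int j' - int j))" by simp
      qed (use d0 in simp)
      then show ?thesis by (simp add: algebra_simps)
    qed
    then have "(\<Sum>v\<in>?R. \<Sum>i\<in>?R. jacobi d (i + v * int j) * jacobi d (i + v * int j'))
      = (\<Sum>v\<in>?R. \<Sum>i\<in>?R. jacobi d i * jacobi d (i + v * (int j' - int j)))" by simp
    also have "\<dots> = (\<Sum>i\<in>?R. jacobi d i * (\<Sum>v\<in>?R. jacobi d (i + v * (int j' - int j))))"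
      by (subst sum.swap) (simp add: sum_distrib_left)
    also have "\<dots> = (if j = j' then int d * \<phi> else 0)"
    proof (cases "j = j'")
      case True
      have "(\<Sum>i\<in>?R. jacobi d i * (int d * jacobi d i)) = int d * \<phi>"
        unfolding \<phi>_def sum_distrib_left by (intro sum.cong refl) (simp add: power2_eq_square)
      then show ?thesis using True by simp
    next
      case False
      have "\<not> int d dvd int j' - int j"
      proof
        assume "int d dvd int j' - int j"
        then have "int d \<le> \<bar>int j' - int j\<bar>" using False dvd_imp_le_int[of "int j' - int j" "int d"] by simp
        then show False using that J by linarith
      qed
      then show ?thesis using False sum_jacobi_progression[OF d] by simp
    qed
    finally show ?thesis .
  qed
  \<comment> \<open>\<open>A\<close> has the same value on all \<phi> elements of \<open>U\<close>;
    extending the sum to every \<open>v\<close> adds only nonnegative terms and makes the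
    orthogonality relation \<open>off\<close> applicable.\<close>
  have "\<phi> * A 1 = (\<Sum>v\<in>U. A v)"
    using AU cardU by (simp add: U_def)
  also have "\<dots> \<le> (\<Sum>v\<in>?R. A v)"
    by (intro sum_mono2) (auto simp: U_def A_def intro: sum_nonneg)
  also have "\<dots> = (\<Sum>v\<in>?R. \<Sum>i\<in>?R. \<Sum>j<J. \<Sum>j'<J. jacobi d (i + v * int j) * jacobi d (i + v * int j'))"
    by (simp add: A_def power2_eq_square sum_product)
  also have "\<dots> = (\<Sum>v\<in>?R. \<Sum>j<J. \<Sum>j'<J. \<Sum>i\<in>?R. jacobi d (i + v * int j) * jacobi d (i + v * int j'))"
    by (rule sum.cong[OF refl], subst sum.swap, rule sum.cong[OF refl], rule sum.swap)
  also have "\<dots> = (\<Sum>j<J. \<Sum>j'<J. \<Sum>v\<in>?R. \<Sum>i\<in>?R. jacobi d (i + v * int j) * jacobi d (i + v * int j'))"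
    by (subst sum.swap, rule sum.cong[OF refl], rule sum.swap)
  also have "\<dots> = (\<Sum>j<J. \<Sum>j'<J. if j = j' then int d * \<phi> else 0)"
    using off by (intro sum.cong refl) auto
  also have "\<dots> = int J * (int d * \<phi>)"
    by (simp add: sum.delta)
  finally have "\<phi> * A 1 \<le> \<phi> * (int d * int J)" by (simp add: mult_ac)
  then have "A 1 \<le> int d * int J" using phi0 by simp
  moreover have "A a = A 1"
  proof (rule AU)
    show "jacobi d a \<noteq> 0"
    proof
      assume "jacobi d a = 0"
      then obtain q where q: "q \<in> prime_factors d" "int q dvd a"
        by (auto simp: jacobi_def Legendre_eq_0_iff)
      then have "int q dvd int d" by auto
      then have "is_unit (int q)" using q a by (meson coprime_common_divisor)
      then have "q = 1" by simp
      moreover have "prime q" using q(1) by (rule in_prime_factors_imp_prime)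
      ultimately show False by simp
    qed
  qed
  ultimately show ?thesis by (simp add: A_def)
qed

lemma jacobi_bilinear:
  fixes d I J :: nat and a c :: int
  assumes "odd d" "squarefree d" "I \<le> d" "J \<le> d" "coprime a (int d)"
  shows "\<bar>\<Sum>i<I. \<Sum>j<J. real_of_int (jacobi d (a * int (i + j) + c))\<bar> \<le> sqrt (real I * (real d * real J))"
proof (rule bilinear_bound)
  show "d > 0" using assms(1) by (rule odd_pos)
  have "real_of_int (\<Sum>i\<in>{0..<int d}. (\<Sum>j<J. jacobi d (i + a * int j))\<^sup>2) \<le> real_of_int (int d * int J)"
    using jacobi_variance[OF assms(1,2,4,5)] by (rule of_int_le_iff[THEN iffD2])
  then show "(\<Sum>i\<in>{0..<int d}. (\<Sum>j<J. real_of_int (jacobi d (i + a * int j)))\<^sup>2) \<le> real d * real J"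
    by simp
qed (use assms in auto)

text \<open>By multiplicativity. It is applied in contrapositive form: an integer at which the
  symbol is not 1 has a prime factor with the same property.\<close>

lemma jacobi_eq_1I:
  fixes n :: nat
  assumes "odd d" "n > 0" "\<And>p. prime p \<Longrightarrow> p dvd n \<Longrightarrow> jacobi d (int p) = 1"
  shows "jacobi d (int n) = 1"
  using assms(2,3)
proof (induction n rule: less_induct)
  case (less n)
  show ?case
  proof (cases "n = 1")
    case False
    then obtain p where p: "prime p" "p dvd n" using prime_factor_nat by blast
    then obtain m where m: "n = p * m" by auto
    have "m < n" "m > 0" using m less.prems(1) prime_gt_1_nat[OF p(1)] by auto
    then have "jacobi d (int m) = 1" using less.IH[of m] less.prems(2) m by simp
    then show ?thesis using less.prems(2)[OF p] m jacobi_mult[OF assms(1)] by simp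
  qed (use assms(1) in simp)
qed

section \<open>Reciprocity: the symbol modulo \<open>d\<close> detects splitting\<close>

lemma neg_one_power_half_mult:
  fixes a b :: nat
  assumes "odd a" "odd b"
  shows "(-1::int) ^ ((a * b - 1) div 2) = (-1) ^ ((a - 1) div 2) * (-1) ^ ((b - 1) div 2)"
proof -
  obtain k l where kl: "a = 2 * k + 1" "b = 2 * l + 1" using assms by (meson oddE)
  have "a * b - 1 = 2 * (2 * (k * l) + k + l)" using kl by (simp add: algebra_simps)
  then have "(a * b - 1) div 2 = 2 * (k * l) + k + l" by simp
  then show ?thesis using kl by (simp add: power_add)
qed

lemma neg_one_power_half_prod:
  assumes "finite A" "\<And>q. q \<in> A \<Longrightarrow> odd q"
  shows "(\<Prod>q\<in>A. (-1::int) ^ ((q - 1) div 2)) = (-1) ^ ((\<Prod>A - 1) div 2) \<and> odd (\<Prod>A :: nat)"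
  using assms
proof (induction A rule: finite_induct)
  case (insert q A)
  then show ?case using neg_one_power_half_mult[of q "\<Prod>A"] by simp
qed simp

lemma squarefree_prod_prime_factors:
  fixes d :: nat
  assumes "squarefree d"
  shows "\<Prod>(prime_factors d) = d"
proof -
  have d0: "d \<noteq> 0" using assms by (metis not_squarefree_0)
  have "d = (\<Prod>p\<in>prime_factors d. p ^ multiplicity p d)"
    using prime_factorization_nat[of d] d0 by simp
  also have "\<dots> = (\<Prod>p\<in>prime_factors d. p)"
    using assms d0 by (intro prod.cong refl) (simp add: squarefree_factorial_semiring')
  finally show ?thesis by simp
qed

lemma Legendre_prod:
  assumes "prime p" "p > 2" "finite A"
  shows "Legendre (\<Prod>q\<in>A. f q) (int p) = (\<Prod>q\<in>A. Legendre (f q) (int p))"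
  using assms(3)
proof induction
  case empty
  have "QuadRes (int p) 1" unfolding QuadRes_def by (rule exI[of _ 1]) simp
  moreover have "\<not> [1 = 0] (mod int p)" using assms by (auto simp: cong_0_iff)
  ultimately show ?case by (simp add: Legendre_def)
qed (simp add: Legendre_mult[OF assms(1,2)])

text \<open>Reciprocity at each prime \<open>q\<close> dividing \<open>d\<close> produces signs with
  product \<open>(-1) ^ ((d - 1) div 2 * ((p - 1) div 2))\<close>. As \<open>d\<close> is 3 modulo
  4, this is \<open>(-1) ^ ((p - 1) div 2)\<close>, the symbol of -1 modulo
  \<open>p\<close>.\<close>

lemma jacobi_reciprocity:
  assumes d: "odd d" "squarefree d" "d mod 4 = 3" and p: "prime p" "p > 2" "\<not> p dvd d"
  shows "jacobi d (int p) = Legendre (- int d) (int p)"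
proof -
  let ?k = "(p - 1) div 2"
  have "int d = (\<Prod>q\<in>prime_factors d. int q)"
    by (subst squarefree_prod_prime_factors[OF d(2), symmetric]) (rule of_nat_prod)
  then have "Legendre (int d) (int p) = (\<Prod>q\<in>prime_factors d. Legendre (int q) (int p))"
    using Legendre_prod[OF p(1,2), of "prime_factors d" int] by simp
  then have "jacobi d (int p) * Legendre (int d) (int p)
     = (\<Prod>q\<in>prime_factors d. Legendre (int p) (int q) * Legendre (int q) (int p))"
    by (simp add: jacobi_def prod.distrib)
  also have "\<dots> = (\<Prod>q\<in>prime_factors d. ((-1) ^ ((q - 1) div 2)) ^ ?k)"
  proof (rule prod.cong[OF refl])
    fix q assume q: "q \<in> prime_factors d"
    have "q \<noteq> p" using q p by auto
    then show "Legendre (int p) (int q) * Legendre (int q) (int p) = ((-1) ^ ((q - 1) div 2)) ^ ?k"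
      using Quadratic_Reciprocity[of p q] p odd_prime_factor_gt_2[OF d(1) q]
      by (simp add: power_mult[symmetric] mult.commute)
  qed
  also have "\<dots> = (\<Prod>q\<in>prime_factors d. (-1) ^ ((q - 1) div 2)) ^ ?k"
    by (rule prod_power_distrib[symmetric])
  also have "(\<Prod>q\<in>prime_factors d. (-1::int) ^ ((q - 1) div 2)) = (-1) ^ ((d - 1) div 2)"
  proof -
    have "odd q" if "q \<in> prime_factors d" for q
      using d(1) in_prime_factors_imp_dvd[OF that] by (meson dvd_trans)
    then show ?thesis
      using neg_one_power_half_prod[of "prime_factors d"]
      unfolding squarefree_prod_prime_factors[OF d(2)] by blast
  qed
  also have "\<dots> = -1"
  proof -
    have "(d - 1) div 2 = 2 * (d div 4) + 1" using d(3) by presburger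
    then show ?thesis by simp
  qed
  finally have 1: "jacobi d (int p) * Legendre (int d) (int p) = (-1) ^ ?k" .
  have L1: "Legendre (-1) (int p) = (-1) ^ ?k"
  proof (rule cong_small_eq[OF euler_criterion[OF p(1,2)] _ _ p(2)])
    show "\<bar>Legendre (-1) (int p)\<bar> \<le> 1" using Legendre_cases[of "-1" "int p"] by auto
  qed (simp add: power_abs)
  have "Legendre (- int d) (int p) = Legendre (-1) (int p) * Legendre (int d) (int p)"
    using Legendre_mult[OF p(1,2), of "-1" "int d"] by simp
  then have "jacobi d (int p) * Legendre (- int d) (int p)
      = (jacobi d (int p) * Legendre (int d) (int p)) * Legendre (-1) (int p)"
    by (simp only: mult_ac)
  also have "\<dots> = (-1) ^ ?k * (-1) ^ ?k" unfolding 1 L1 ..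
  also have "\<dots> = 1" by (simp flip: power_add)
  finally show ?thesis
    using jacobi_cases[of d "int p"] Legendre_cases[of "- int d" "int p"] by auto
qed

section \<open>Local obstructions\<close>

definition norm_free :: "nat \<Rightarrow> int \<Rightarrow> bool" where
  "norm_free d r \<longleftrightarrow> (\<forall>\<alpha> \<beta> :: rat. of_int r \<noteq> \<alpha>\<^sup>2 + of_nat d * \<beta>\<^sup>2)"

text \<open>Infinite descent on the absolute value of \<open>c\<close>: a common factor
  \<open>p\<close> can be cancelled forever, so every integral solution has \<open>c = 0\<close>. A
  rational representation would give one with \<open>c\<close> the product of the two
  denominators.\<close>

lemma norm_freeI:
  assumes p: "p > 1"
    and div: "\<And>a b c :: int. r * c\<^sup>2 = a\<^sup>2 + int d * b\<^sup>2 \<Longrightarrow> int p dvd a \<and> int p dvd b \<and> int p dvd c"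
  shows "norm_free d r"
proof -
  have no: "c = 0" if "r * c\<^sup>2 = a\<^sup>2 + int d * b\<^sup>2" for a b c
    using that
  proof (induction "nat \<bar>c\<bar>" arbitrary: a b c rule: less_induct)
    case less
    obtain a' b' c' where abc: "a = int p * a'" "b = int p * b'" "c = int p * c'"
      using div[OF less.prems] by (meson dvdE)
    have "(int p)\<^sup>2 * (r * c'\<^sup>2) = (int p)\<^sup>2 * (a'\<^sup>2 + int d * b'\<^sup>2)"
      using less.prems unfolding abc by (simp add: power_mult_distrib algebra_simps)
    then have eq: "r * c'\<^sup>2 = a'\<^sup>2 + int d * b'\<^sup>2" using p by simp
    show "c = 0"
    proof (rule ccontr)
      assume "c \<noteq> 0"
      then have c': "c' \<noteq> 0" using abc by auto
      then have "\<bar>c'\<bar> * 1 < \<bar>c'\<bar> * int p" using p by (intro mult_strict_left_mono) auto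
      then have "nat \<bar>c'\<bar> < nat \<bar>c\<bar>" using abc by (simp add: abs_mult mult.commute)
      then show False using less.hyps eq c' by blast
    qed
  qed
  show ?thesis unfolding norm_free_def
  proof (intro allI notI)
    fix \<alpha> \<beta> :: rat
    assume eq: "of_int r = \<alpha>\<^sup>2 + of_nat d * \<beta>\<^sup>2"
    obtain a k where a: "\<alpha> = of_int a / of_int k" "k \<noteq> 0"
      by (metis Fract_of_int_quotient Rat_cases less_irrefl)
    obtain b l where b: "\<beta> = of_int b / of_int l" "l \<noteq> 0"
      by (metis Fract_of_int_quotient Rat_cases less_irrefl)
    have "of_int r * (of_int k * of_int l)\<^sup>2 = (of_int a * of_int l)\<^sup>2 + of_nat d * (of_int b * of_int k :: rat)\<^sup>2"
      unfolding eq a(1) b(1) using a(2) b(2) by (simp add: field_simps power2_eq_square)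
    then have "(of_int (r * (k * l)\<^sup>2) :: rat) = of_int ((a * l)\<^sup>2 + int d * (b * k)\<^sup>2)" by simp
    then have "r * (k * l)\<^sup>2 = (a * l)\<^sup>2 + int d * (b * k)\<^sup>2" by (simp only: of_int_eq_iff)
    then have "k * l = 0" by (rule no)
    then show False using a b by simp
  qed
qed

lemma square_mod_8:
  fixes x :: int
  shows "x\<^sup>2 mod 8 = 1 \<or> even x \<and> (x\<^sup>2 mod 8 = 0 \<or> x\<^sup>2 mod 8 = 4)"
proof -
  have "x mod 8 \<in> {0, 1, 2, 3, 4, 5, 6, 7}" by auto
  moreover have "x\<^sup>2 mod 8 = (x mod 8)\<^sup>2 mod 8" by (simp add: power_mod)
  moreover have "even x \<longleftrightarrow> even (x mod 8)" by presburger
  ultimately show ?thesis by auto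
qed

text \<open>A finite check. As 1 is the only odd square class modulo 8, the conclusion says that all
  three roots are even, which feeds the descent at 2.\<close>

lemma square_classes_mod_8:
  fixes A B C D R :: int
  assumes "A \<in> {0, 1, 4}" "B \<in> {0, 1, 4}" "C \<in> {0, 1, 4}"
    and "(D, R) \<in> {(1, 3), (5, 3), (3, 2), (2, 5), (6, 5)}"
    and "(R * C) mod 8 = (A + D * B) mod 8"
  shows "A \<noteq> 1 \<and> B \<noteq> 1 \<and> C \<noteq> 1"
  using assms by (elim insertE emptyE) simp_all

text \<open>These are classes with 2-adic Hilbert symbol \<open>(r, -d) = -1\<close>.\<close>

lemma norm_free_2adic:
  assumes "(d mod 8, r mod 8) \<in> {(1, 3), (5, 3), (3, 2), (2, 5), (6, 5)}"
  shows "norm_free d r"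
proof (rule norm_freeI[of 2])
  fix a b c :: int
  assume eq: "r * c\<^sup>2 = a\<^sup>2 + int d * b\<^sup>2"
  have 1: "(r * c\<^sup>2) mod 8 = ((r mod 8) * (c\<^sup>2 mod 8)) mod 8"
    by (simp add: mod_mult_eq)
  have 2: "(a\<^sup>2 + int d * b\<^sup>2) mod 8 = (a\<^sup>2 mod 8 + (int d mod 8) * (b\<^sup>2 mod 8)) mod 8"
    by (metis mod_add_eq mod_mult_eq mod_add_right_eq mod_mod_trivial)
  have eq8: "((r mod 8) * (c\<^sup>2 mod 8)) mod 8 = (a\<^sup>2 mod 8 + (int d mod 8) * (b\<^sup>2 mod 8)) mod 8"
    using 1 2 unfolding eq by (rule trans[OF sym])
  have "(int m, r') \<in> {(1, 3), (5, 3), (3, 2), (2, 5), (6, 5)}"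
    if "(m, r') \<in> {(1, 3), (5, 3), (3, 2), (2, 5), (6, 5)}" for m :: nat and r' :: int
    using that by auto
  from this[OF assms] have "(int d mod 8, r mod 8) \<in> {(1, 3), (5, 3), (3, 2), (2, 5), (6, 5)}"
    unfolding zmod_int of_nat_numeral .
  moreover have "x\<^sup>2 mod 8 \<in> {0, 1, 4}" for x :: int using square_mod_8[of x] by auto
  ultimately have "a\<^sup>2 mod 8 \<noteq> 1 \<and> b\<^sup>2 mod 8 \<noteq> 1 \<and> c\<^sup>2 mod 8 \<noteq> 1"
    using eq8 by (intro square_classes_mod_8)
  then show "int 2 dvd a \<and> int 2 dvd b \<and> int 2 dvd c"
    using square_mod_8[of a] square_mod_8[of b] square_mod_8[of c] by simp
qed simp

text \<open>If \<open>p\<close> did not divide \<open>b\<close>, then \<open>a / b\<close> would be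
  a square root of \<open>- d\<close> modulo \<open>p\<close>. So \<open>p\<close> divides
  \<open>b\<close> and \<open>a\<close>, hence \<open>p\<^sup>2\<close> divides
  \<open>r * c\<^sup>2\<close>; as \<open>r\<close> has only one factor \<open>p\<close>, also
  \<open>c\<close> is divisible by \<open>p\<close>.\<close>

lemma norm_free_inert:
  assumes p: "prime p" "\<not> p dvd d" "Legendre (- int d) (int p) = -1"
    and r: "int p dvd r" "\<not> int (p\<^sup>2) dvd r"
  shows "norm_free d r"
proof (rule norm_freeI[of p])
  show "p > 1" using p prime_gt_1_nat by blast
  have pp: "prime (int p)" using p by simp
  fix a b c :: int
  assume eq: "r * c\<^sup>2 = a\<^sup>2 + int d * b\<^sup>2"
  have pb: "int p dvd b"
  proof (rule ccontr)
    assume nb: "\<not> int p dvd b"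
    then have "coprime b (int p)" using prime_imp_coprime[OF pp] by (simp add: coprime_commute)
    then obtain e where e: "[b * e = 1] (mod int p)" using cong_solve_coprime_int by blast
    have "[a\<^sup>2 + int d * b\<^sup>2 = 0] (mod int p)" using r(1) by (simp add: eq[symmetric] cong_0_iff)
    then have "int p dvd a\<^sup>2 + int d * b\<^sup>2" by (simp add: cong_0_iff)
    then have 1: "int p dvd (a\<^sup>2 + int d * b\<^sup>2) * e\<^sup>2" by simp
    have "int p dvd b * e - 1" using e by (simp add: cong_iff_dvd_diff)
    then have "int p dvd (b * e - 1) * ((b * e + 1) * int d)" by simp
    then have "int p dvd (a\<^sup>2 + int d * b\<^sup>2) * e\<^sup>2 - (b * e - 1) * ((b * e + 1) * int d)"
      using 1 by (intro dvd_diff)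
    also have "(a\<^sup>2 + int d * b\<^sup>2) * e\<^sup>2 - (b * e - 1) * ((b * e + 1) * int d) = (a * e)\<^sup>2 - (- int d)"
      by (simp add: power2_eq_square algebra_simps)
    finally have "QuadRes (int p) (- int d)"
      unfolding QuadRes_def by (auto simp: cong_iff_dvd_diff)
    then show False using p(3) by (simp add: Legendre_def split: if_splits)
  qed
  moreover have pa: "int p dvd a"
  proof -
    have "int p dvd a\<^sup>2 + int d * b\<^sup>2" using r(1) by (simp add: eq[symmetric])
    moreover have "int p dvd int d * b\<^sup>2" using pb by (simp add: power2_eq_square)
    ultimately have "int p dvd a\<^sup>2" by (simp add: dvd_add_left_iff)
    then show ?thesis using pp prime_dvd_power by blast
  qed
  moreover have "int p dvd c"
  proof (rule ccontr)
    assume "\<not> int p dvd c"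
    then have cop: "coprime ((int p)\<^sup>2) (c\<^sup>2)" using prime_imp_coprime[OF pp] by simp
    have "(int p)\<^sup>2 dvd a\<^sup>2" "(int p)\<^sup>2 dvd b\<^sup>2" using pa pb by (simp_all add: dvd_power_same)
    then have "(int p)\<^sup>2 dvd r * c\<^sup>2" unfolding eq by simp
    then have "(int p)\<^sup>2 dvd r" using cop by (simp add: coprime_dvd_mult_left_iff)
    then show False using r(2) by simp
  qed
  ultimately show "int p dvd a \<and> int p dvd b \<and> int p dvd c" by simp
qed

text \<open>First \<open>p\<close> divides \<open>a\<close>; dividing the equation by
  \<open>p\<close> gives \<open>u * c\<^sup>2 = p * a'\<^sup>2 + e * b\<^sup>2\<close>. If
  \<open>c\<close> were invertible modulo \<open>p\<close>, then \<open>u * e\<close> would be the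
  square of \<open>e * b / c\<close>.\<close>

lemma norm_free_ramified:
  assumes p: "prime p" "\<not> p dvd e" "Legendre (u * int e) (int p) = -1"
  shows "norm_free (p * e) (int p * u)"
proof (rule norm_freeI[of p])
  show p1: "p > 1" using p prime_gt_1_nat by blast
  have pp: "prime (int p)" using p by simp
  fix a b c :: int
  assume eq: "int p * u * c\<^sup>2 = a\<^sup>2 + int (p * e) * b\<^sup>2"
  then have "a\<^sup>2 = int p * (u * c\<^sup>2 - int e * b\<^sup>2)" by (simp add: algebra_simps)
  then have "int p dvd a\<^sup>2" by simp
  then have pa: "int p dvd a" using pp prime_dvd_power by blast
  then obtain a' where a': "a = int p * a'" by auto
  have "int p * (u * c\<^sup>2) = int p * (int p * a'\<^sup>2 + int e * b\<^sup>2)"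
    using eq a' by (simp add: power2_eq_square algebra_simps)
  then have eq2: "u * c\<^sup>2 = int p * a'\<^sup>2 + int e * b\<^sup>2" using p1 by simp
  have pc: "int p dvd c"
  proof (rule ccontr)
    assume nc: "\<not> int p dvd c"
    then have "coprime c (int p)" using prime_imp_coprime[OF pp] by (simp add: coprime_commute)
    then obtain f where f: "[c * f = 1] (mod int p)" using cong_solve_coprime_int by blast
    then have "int p dvd c * f - 1" by (simp add: cong_iff_dvd_diff)
    then have "int p dvd (c * f - 1) * ((c * f + 1) * (u * int e)) - int p * (a'\<^sup>2 * f\<^sup>2 * int e)"
      by (intro dvd_diff) auto
    moreover have "(c * f - 1) * ((c * f + 1) * (u * int e)) = u * c\<^sup>2 * (f\<^sup>2 * int e) - u * int e"
      by (simp add: power2_eq_square algebra_simps)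
    ultimately have "int p dvd (int e * b * f)\<^sup>2 - u * int e"
      unfolding eq2 by (simp add: power2_eq_square algebra_simps)
    then have "QuadRes (int p) (u * int e)"
      unfolding QuadRes_def cong_iff_dvd_diff by blast
    then show False using p(3) by (simp add: Legendre_def split: if_splits)
  qed
  moreover have "int p dvd b"
  proof -
    have "int p dvd u * c\<^sup>2 - int p * a'\<^sup>2" using pc by (intro dvd_diff) (auto simp: power2_eq_square)
    then have "int p dvd int e * b\<^sup>2" using eq2 by simp
    then have "int p dvd b\<^sup>2" using pp p(2) by (simp add: prime_dvd_mult_iff)
    then show ?thesis using pp prime_dvd_power by blast
  qed
  ultimately show "int p dvd a \<and> int p dvd b \<and> int p dvd c" using pa by simp
qed

definition bad_prime :: "nat \<Rightarrow> nat \<Rightarrow> bool" where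
  "bad_prime d p \<longleftrightarrow> prime p \<and> p > 2 \<and> (p dvd d \<or> Legendre (- int d) (int p) = -1)"

text \<open>The symbols of \<open>u * e\<close> sum to 0 and none of them vanishes, so both signs
  occur equally often. The factor \<open>e\<close> is the cofactor of \<open>p\<close> in
  \<open>d\<close> from \<open>norm_free_ramified\<close>.\<close>

lemma card_nonresidues:
  assumes p: "prime p" "p > 2" and e: "\<not> int p dvd e"
  shows "2 * card {u\<in>{1..<p}. Legendre (int u * e) (int p) = -1} = p - 1"
proof -
  let ?N = "{u\<in>{1..<p}. Legendre (int u * e) (int p) = -1}"
  let ?P = "{u\<in>{1..<p}. Legendre (int u * e) (int p) = 1}"
  have nz: "Legendre (int u * e) (int p) \<noteq> 0" if "u \<in> {1..<p}" for u
  proof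
    assume "Legendre (int u * e) (int p) = 0"
    then have "int p dvd int u * e" by (simp only: Legendre_eq_0_iff)
    then have "p dvd u" using p e by (simp add: prime_dvd_mult_iff)
    then show False using that dvd_imp_le[of p u] by simp
  qed
  have un: "{1..<p} = ?N \<union> ?P" using nz Legendre_cases by blast
  have "(0::int) = (\<Sum>x\<in>{0..<int p}. Legendre (e * x + 0) (int p))"
    using sum_Legendre_affine[OF p e, of 0] by simp
  also have "\<dots> = (\<Sum>u\<in>{0..<p}. Legendre (int u * e) (int p))"
  proof -
    have "{0..<int p} = int ` {0..<p}" by (simp add: image_int_atLeastLessThan)
    then show ?thesis by (simp add: sum.reindex mult.commute)
  qed
  also have "\<dots> = (\<Sum>u\<in>{1..<p}. Legendre (int u * e) (int p))"
    by (rule sum.mono_neutral_right) (auto simp: Legendre_eq_0_iff Suc_le_eq)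
  also have "\<dots> = (\<Sum>u\<in>?N. Legendre (int u * e) (int p)) + (\<Sum>u\<in>?P. Legendre (int u * e) (int p))"
    by (subst un, rule sum.union_disjoint) auto
  also have "\<dots> = (\<Sum>u\<in>?N. -1) + (\<Sum>u\<in>?P. 1)"
    by (intro arg_cong2[of _ _ _ _ "(+)"] sum.cong) auto
  finally have "card ?N = card ?P" by simp
  moreover have "card {1..<p} = card ?N + card ?P"
    by (subst un, rule card_Un_disjoint) auto
  ultimately show ?thesis by simp
qed

text \<open>Puts both kinds of bad primes into one form: at a ramified prime half of the nonzero
  classes \<open>u\<close> are obstructed, at an inert prime all of them. A class modulo
  \<open>p\<^sup>2\<close> is needed because \<open>r\<close> must be exactly divisible by
  \<open>p\<close>.\<close>

lemma bad_prime_classes: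
  assumes bad: "bad_prime d p" and d: "squarefree d"
  obtains U where "U \<subseteq> {1..<p}" "p - 1 \<le> 2 * card U"
    "\<And>r u. u \<in> U \<Longrightarrow> r mod int (p\<^sup>2) = int (p * u) \<Longrightarrow> norm_free d r"
proof (cases "p dvd d")
  case True
  have p: "prime p" "p > 2" using bad by (auto simp: bad_prime_def)
  obtain e where e: "d = p * e" using True by auto
  have ne: "\<not> p dvd e"
  proof
    assume "p dvd e"
    then have "p\<^sup>2 dvd d" using e by (simp add: power2_eq_square mult_dvd_mono)
    then have "p dvd 1" using d squarefreeD by blast
    then show False using p by auto
  qed
  let ?U = "{u\<in>{1..<p}. Legendre (int u * int e) (int p) = -1}"
  have "norm_free d r" if u: "u \<in> ?U" "r mod int (p\<^sup>2) = int (p * u)" for r u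
  proof -
    define k where "k = r div int (p\<^sup>2)"
    have "r = int (p\<^sup>2) * k + int (p * u)"
      using u(2) mult_div_mod_eq[of "int (p\<^sup>2)" r] by (simp add: k_def)
    then have r: "r = int p * (int u + int p * k)" by (simp add: power2_eq_square algebra_simps)
    have "Legendre ((int u + int p * k) * int e) (int p) = Legendre (int u * int e) (int p)"
      by (rule Legendre_cong) (simp add: cong_iff_dvd_diff algebra_simps)
    then show ?thesis unfolding r e using u norm_free_ramified[OF p(1) ne, of "int u + int p * k"] by simp
  qed
  then show ?thesis using card_nonresidues[OF p, of "int e"] ne by (intro that[of ?U]) auto
next
  case False
  have p: "prime p" "p > 2" "Legendre (- int d) (int p) = -1"
    using bad False by (auto simp: bad_prime_def)
  have "norm_free d r" if u: "u \<in> {1..<p}" "r mod int (p\<^sup>2) = int (p * u)" for r u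
  proof (rule norm_free_inert[OF p(1) False p(3)])
    have "int p dvd int (p * u)" by simp
    then have "int p dvd r mod int (p\<^sup>2)" using u by simp
    moreover have "int p dvd int (p\<^sup>2)" by (simp add: power2_eq_square)
    ultimately show "int p dvd r" by (metis dvd_mod_iff)
    show "\<not> int (p\<^sup>2) dvd r"
    proof
      assume "int (p\<^sup>2) dvd r"
      then have "int (p * u) = 0" using u(2) by simp
      then show False using u(1) p(2) by simp
    qed
  qed
  then show ?thesis using p by (intro that[of "{1..<p}"]) auto
qed

section \<open>Counting obstructed residues\<close>

text \<open>The bound \<open>X\<close> is kept apart from the modulus of the root count: for even
  \<open>d\<close> the range is given by \<open>d\<close>, the roots are counted modulo its odd
  part.\<close>

definition candidates :: "nat \<Rightarrow> int set" where
  "candidates X = {r. 0 < r \<and> 4 * r < int X}"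

lemma finite_candidates [simp]: "finite (candidates X)"
  by (rule finite_subset[of _ "{0..int X}"]) (auto simp: candidates_def)

text \<open>The factor 2 comes from the \<open>2 * M\<close> by \<open>M\<close> double sum in
  \<open>sqrt_count_upper\<close>; the quantity also dominates the error in
  \<open>sqrt_count_lower\<close>.\<close>

definition count_error :: "nat \<Rightarrow> real" where
  "count_error n = sqrt (2 * (real n * real (card {g. g dvd n})))"

lemma count_error_mono:
  assumes "n dvd d" "d > 0"
  shows "sqrt (real n * real (card {g. g dvd n})) \<le> count_error d"
    and "count_error n \<le> count_error d"
proof -
  have "n \<le> d" using assms by (rule dvd_imp_le)
  moreover have "card {g. g dvd n} \<le> card {g. g dvd d}"
    using assms by (intro card_mono) (auto intro: dvd_trans)
  ultimately have *: "real n * real (card {g. g dvd n}) \<le> real d * real (card {g. g dvd d})"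
    by (intro mult_mono) auto
  then show "count_error n \<le> count_error d" by (simp add: count_error_def)
  have "real n * real (card {g. g dvd n}) \<le> 2 * (real d * real (card {g. g dvd d}))"
    using * by (smt (verit) mult_nonneg_nonneg of_nat_0_le_iff)
  then show "sqrt (real n * real (card {g. g dvd n})) \<le> count_error d" by (simp add: count_error_def)
qed

lemma squarefree_coprime_part:
  fixes d q :: nat
  assumes "squarefree d"
  obtains t n where "d = t * n" "t dvd q" "coprime q n"
proof -
  define t where "t = gcd q d"
  obtain n where n: "d = t * n" unfolding t_def by (meson dvdE gcd_dvd2)
  have "coprime q n"
  proof (rule ccontr)
    assume "\<not> coprime q n"
    then obtain l where l: "prime l" "l dvd q" "l dvd n"
      by (metis coprime_iff_gcd_eq_1 gcd_nat.bounded_iff prime_factor_nat)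
    then have "l dvd d" using n by simp
    then have "l dvd t" using l unfolding t_def by (intro gcd_greatest)
    then have "l\<^sup>2 dvd d" using l n by (simp add: power2_eq_square mult_dvd_mono)
    then have "l dvd 1" using assms squarefreeD by blast
    then show False using l by auto
  qed
  moreover have "t dvd q" unfolding t_def by (rule gcd_dvd1)
  ultimately show ?thesis using n that by blast
qed

text \<open>This admits progressions whose step shares the factor \<open>t\<close> with the modulus:
  along multiples of \<open>t\<close> that factor has exactly one root, and the mean square is
  applied modulo the coprime part \<open>n\<close>.\<close>

lemma sqrt_count_reduce:
  assumes "squarefree (t * n)" "int t dvd r"
  shows "sqrt_count (t * n) r = sqrt_count n r"
proof -
  have "t * n \<noteq> 0" using assms(1) by (metis not_squarefree_0)
  then have "sqrt_count (t * n) r = sqrt_count t r * sqrt_count n r"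
    using squarefree_mult_imp_coprime[OF assms(1)] by (intro sqrt_count_coprime_mult) auto
  moreover have "sqrt_count t r = 1"
    using squarefree_multD(1)[OF assms(1)] assms(2) by (rule sqrt_count_dvd)
  ultimately show ?thesis by simp
qed

text \<open>The candidates in the class contain the \<open>2 * L\<close> terms
  \<open>k * m + c\<close>, to which \<open>sqrt_count_lower\<close> applies modulo
  \<open>n\<close>. The case \<open>t > 1\<close> is for ramified primes,
  \<open>X \<noteq> d\<close> for even discriminants.\<close>

lemma class_sum_lower:
  fixes d t n k c X :: nat
  assumes d: "odd d" "squarefree d" "d = t * n" and k: "coprime k n" "t dvd k" "k > 0"
    and c: "t dvd c" "0 < c" "c \<le> k" and X: "d \<le> X" "X \<le> 2 * d"
  shows "real X / (8 * real k) - 2 - count_error d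
     \<le> (\<Sum>r\<in>{r\<in>candidates X. r mod int k = int c mod int k}. real (sqrt_count d r))"
proof -
  \<comment> \<open>There are \<open>2 * L\<close> terms, each at most \<open>2 * L * k\<close>, and
    four times that must stay strictly below \<open>X\<close>; hence the 8 and the
    \<open>X - 1\<close>.\<close>
  define L where "L = (X - 1) div (8 * k)"
  have n: "odd n" using d by auto
  have d0: "d > 0" using d(1) by (rule odd_pos)
  have L8: "8 * k * L < X"
  proof -
    have "8 * k * L \<le> X - 1" unfolding L_def by simp
    then show ?thesis using d0 X by linarith
  qed
  \<comment> \<open>The terms may not run past a period modulo \<open>n = d div t\<close>; this
    holds because \<open>t \<le> k\<close> shortens the progression by at least the same
    factor.\<close>
  have Ln: "L \<le> n"
  proof (rule ccontr)
    assume "\<not> L \<le> n"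
    then have "n < L" by simp
    have "t \<le> k" using k by (simp add: dvd_imp_le)
    have "8 * (t * n) \<le> 8 * k * L" using \<open>t \<le> k\<close> \<open>n < L\<close> by (simp add: mult_le_mono)
    then show False using L8 X d d0 by simp
  qed
  have Llow: "real L \<ge> real X / (8 * real k) - 2"
  proof -
    have "X - 1 < 8 * k * (L + 1)" unfolding L_def using k(3)
      by (metis add.commute dividend_less_times_div mult_pos_pos mult.commute plus_1_eq_Suc Suc_eq_plus1 zero_less_numeral mult_Suc_right)
    then have "X \<le> 8 * k * (L + 1)" by linarith
    then have "real X \<le> real (8 * k * (L + 1))" by (simp only: of_nat_le_iff)
    then have "real X \<le> 8 * real k * (real L + 1)" by (simp add: algebra_simps)
    then have "real X / (8 * real k) \<le> real L + 1" using k(3) by (simp add: divide_le_eq mult.commute)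
    then show ?thesis by simp
  qed
  let ?f = "\<lambda>m::nat. int k * int m + int c"
  have tr: "int t dvd ?f m" for m using k c by simp
  have "real L - sqrt (real n * real (card {g. g dvd n})) \<le> (\<Sum>m<2*L. real (sqrt_count n (?f m)))"
    using n k Ln by (intro sqrt_count_lower) auto
  also have "\<dots> = (\<Sum>m<2*L. real (sqrt_count d (?f m)))"
    using sqrt_count_reduce[of t n] d tr by simp
  also have "\<dots> = (\<Sum>r\<in>?f ` {..<2*L}. real (sqrt_count d r))"
    using k(3) by (subst sum.reindex) (auto simp: inj_on_def)
  also have "\<dots> \<le> (\<Sum>r\<in>{r\<in>candidates X. r mod int k = int c mod int k}. real (sqrt_count d r))"
  proof (intro sum_mono2)
    show "?f ` {..<2*L} \<subseteq> {r\<in>candidates X. r mod int k = int c mod int k}"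
    proof
      fix r assume "r \<in> ?f ` {..<2*L}"
      then obtain m where m: "m < 2 * L" "r = ?f m" by auto
      have "k * m + c \<le> k * (m + 1)" using c by simp
      also have "\<dots> \<le> k * (2 * L)" using m by (intro mult_le_mono) auto
      finally have "4 * (k * m + c) < X" using L8 by simp
      then have "int (4 * (k * m + c)) < int X" by (simp only: of_nat_less_iff)
      then have "4 * r < int X" using m by simp
      then show "r \<in> {r\<in>candidates X. r mod int k = int c mod int k}"
        using m c by (simp add: candidates_def add_nonneg_pos)
    qed
  qed auto
  finally show ?thesis using Llow count_error_mono(1)[of n d] d d0 by simp
qed

text \<open>The multiples of \<open>q\<close> below \<open>d / 4\<close> are the terms
  \<open>q * (m + 1)\<close> with \<open>m < M\<close>. The factor that \<open>q\<close> shares with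
  \<open>d\<close> is split off, so the bound is uniform in \<open>q\<close>.\<close>

lemma multiple_sum_upper:
  fixes d q :: nat
  assumes d: "odd d" "squarefree d" and q: "q > 0"
  shows "(\<Sum>r\<in>{r\<in>candidates d. int q dvd r}. real (sqrt_count d r)) \<le> real d / (2 * real q) + count_error d"
proof -
  obtain t n where tn: "d = t * n" "t dvd q" "coprime q n"
    using squarefree_coprime_part[OF d(2)] .
  have d0: "d > 0" using d(1) by (rule odd_pos)
  define M where "M = d div (4 * q)"
  have Mq: "4 * q * M \<le> d" unfolding M_def by simp
  have Mn: "2 * M \<le> n"
  proof (rule ccontr)
    assume "\<not> 2 * M \<le> n"
    then have "n < 2 * M" by simp
    have "t \<le> q" using tn q by (simp add: dvd_imp_le)
    have "2 * (t * n) \<le> 2 * (q * (2 * M))" using \<open>t \<le> q\<close> \<open>n < 2 * M\<close> by (intro mult_le_mono) auto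
    also have "\<dots> = 4 * q * M" by simp
    finally have "2 * d \<le> d" using Mq tn(1) by linarith
    then show False using d0 by simp
  qed
  let ?f = "\<lambda>m::nat. int q * int m + int q"
  have tr: "int t dvd ?f m" for m using tn by simp
  have "{r\<in>candidates d. int q dvd r} \<subseteq> ?f ` {..<M}"
  proof
    fix r assume "r \<in> {r\<in>candidates d. int q dvd r}"
    then have r: "0 < r" "4 * r < int d" "int q dvd r" by (auto simp: candidates_def)
    then obtain j where j: "r = int q * j" by auto
    have "j > 0" using r j q by (simp add: zero_less_mult_iff)
    then obtain m where m: "j = int m + 1" by (metis zero_less_imp_eq_int of_nat_Suc Suc_pred add.commute plus_1_eq_Suc)
    have "int (4 * q * (m + 1)) < int d" using r j m by (simp add: algebra_simps)
    then have "4 * q * (m + 1) < d" by (simp only: of_nat_less_iff)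
    then have "m + 1 \<le> M" unfolding M_def using q
      by (simp add: less_eq_div_iff_mult_less_eq mult.commute)
    then show "r \<in> ?f ` {..<M}" using j m by (intro image_eqI[of _ _ m]) (auto simp: algebra_simps)
  qed
  then have "(\<Sum>r\<in>{r\<in>candidates d. int q dvd r}. real (sqrt_count d r)) \<le> (\<Sum>r\<in>?f ` {..<M}. real (sqrt_count d r))"
    by (intro sum_mono2) auto
  also have "\<dots> = (\<Sum>m<M. real (sqrt_count d (?f m)))"
    using q by (subst sum.reindex) (auto simp: inj_on_def)
  also have "\<dots> = (\<Sum>m<M. real (sqrt_count n (?f m)))"
    using sqrt_count_reduce[of t n] d tn(1) tr by simp
  also have "\<dots> \<le> 2 * real M + count_error n"
    unfolding count_error_def using d tn Mn by (intro sqrt_count_upper) auto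
  also have "count_error n \<le> count_error d" using tn d0 by (intro count_error_mono) auto
  also have "2 * real M \<le> real d / (2 * real q)"
  proof -
    have "real (4 * q * M) \<le> real d" using Mq by (simp only: of_nat_le_iff)
    then show ?thesis using q by (simp add: field_simps)
  qed
  finally show ?thesis by simp
qed

text \<open>One of \<open>x\<close> and \<open>x + d0\<close> has the parity that makes the
  difference even, since \<open>d0\<close> is odd.\<close>

lemma is_square_mod_double:
  assumes "odd d0" "int d0 dvd x\<^sup>2 - r"
  shows "is_square_mod r (int (2 * d0))"
proof -
  obtain y where y: "int d0 dvd y\<^sup>2 - r" "even (y\<^sup>2 - r)"
  proof (cases "even (x\<^sup>2 - r)")
    case False
    have eq: "(x + int d0)\<^sup>2 - r = (x\<^sup>2 - r) + int d0 * (2 * x + int d0)"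
      by (simp add: power2_eq_square algebra_simps)
    have "int d0 dvd (x + int d0)\<^sup>2 - r" unfolding eq using assms(2) by simp
    moreover have "even ((x + int d0)\<^sup>2 - r)" unfolding eq using False assms(1) by simp
    ultimately show ?thesis using that by blast
  qed (use that assms in blast)
  have "coprime (2::int) (int d0)" using assms(1) by simp
  then have "2 * int d0 dvd y\<^sup>2 - r" using y by (intro divides_mult)
  then have "[r = y\<^sup>2] (mod int (2 * d0))" by (simp add: cong_iff_dvd_diff dvd_diff_commute)
  then show ?thesis unfolding is_square_mod_def by blast
qed

text \<open>The bridge from weighted counts to the theorem: elements without a root contribute 0,
  the others are squares modulo \<open>d\<close> and lie in \<open>Dset d\<close>, with weight at
  least the root count.\<close>

lemma Dset_sum_ge:
  assumes d: "squarefree d" "odd d0" "d = d0 \<or> d = 2 * d0"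
    and A: "A \<subseteq> {r\<in>candidates d. norm_free d r}"
  shows "(\<Sum>r\<in>A. real (sqrt_count d0 r)) \<le> (\<Sum>r\<in>Dset d. 2 ^ (omega d - omega (gcd d (nat r))))"
proof -
  have d0: "d > 0" using d by (metis not_squarefree_0 gr0I)
  have finA: "finite A" using A by (rule finite_subset) simp
  have finD: "finite (Dset d)"
    by (rule finite_subset[OF _ finite_candidates[of d]]) (auto simp: Dset_def candidates_def)
  define A' where "A' = {r\<in>A. sqrt_count d0 r > 0}"
  have "(\<Sum>r\<in>A. real (sqrt_count d0 r)) = (\<Sum>r\<in>A'. real (sqrt_count d0 r))"
    unfolding A'_def using finA by (intro sum.mono_neutral_right) auto
  also have "\<dots> \<le> (\<Sum>r\<in>A'. 2 ^ (omega d - omega (gcd d (nat r))))"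
  proof (rule sum_mono)
    fix r assume "r \<in> A'"
    then have r: "r > 0" using A by (auto simp: A'_def candidates_def)
    have "squarefree d0" using d by (metis squarefree_multD(2))
    then have "sqrt_count d0 r \<le> 2 ^ card {q\<in>prime_factors d0. \<not> int q dvd r}"
      by (rule sqrt_count_le_power2)
    also have "\<dots> \<le> 2 ^ card {q\<in>prime_factors d. \<not> int q dvd r}"
    proof (intro power_increasing card_mono)
      have "d0 dvd d" using d by auto
      then have "prime_factors d0 \<subseteq> prime_factors d" using d0 by (intro dvd_prime_factors) auto
      then show "{q\<in>prime_factors d0. \<not> int q dvd r} \<subseteq> {q\<in>prime_factors d. \<not> int q dvd r}" by blast
    qed auto
    also have "card {q\<in>prime_factors d. \<not> int q dvd r} = omega d - omega (gcd d (nat r))"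
      using omega_diff_gcd[OF d0 r] by simp
    finally show "real (sqrt_count d0 r) \<le> 2 ^ (omega d - omega (gcd d (nat r)))"
      by (metis of_nat_le_iff of_nat_numeral of_nat_power)
  qed
  also have "\<dots> \<le> (\<Sum>r\<in>Dset d. 2 ^ (omega d - omega (gcd d (nat r))))"
  proof (rule sum_mono2[OF finD])
    show "A' \<subseteq> Dset d"
    proof
      fix r assume r: "r \<in> A'"
      then have "{x\<in>{0..<int d0}. int d0 dvd x\<^sup>2 - r} \<noteq> {}"
        unfolding A'_def sqrt_count_def by (metis (no_types, lifting) card.empty less_irrefl mem_Collect_eq)
      then obtain x where x: "int d0 dvd x\<^sup>2 - r" by blast
      have "is_square_mod r (int d)"
        using d(3)
      proof
        assume "d = d0"
        then have "[r = x\<^sup>2] (mod int d)" using x by (simp add: cong_iff_dvd_diff dvd_diff_commute)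
        then show ?thesis unfolding is_square_mod_def by blast
      qed (use is_square_mod_double[OF d(2) x] in simp)
      then show "r \<in> Dset d" using r A by (auto simp: A'_def Dset_def candidates_def norm_free_def)
    qed
  qed auto
  finally show ?thesis .
qed

lemma Dset_sum_2adic:
  assumes d: "squarefree d" "d mod 8 \<noteq> 7"
  shows "real d / 64 - 2 - count_error d \<le> (\<Sum>r\<in>Dset d. 2 ^ (omega d - omega (gcd d (nat r))))"
proof -
  have d0: "d > 0" using d by (metis not_squarefree_0 gr0I)
  have n4: "d mod 8 \<noteq> 0" "d mod 8 \<noteq> 4"
  proof -
    have "\<not> 2\<^sup>2 dvd d"
    proof
      assume "2\<^sup>2 dvd d"
      then have "(2::nat) dvd 1" using d(1) squarefreeD by blast
      then show False by simp
    qed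
    then have "\<not> 4 dvd d" by simp
    then show "d mod 8 \<noteq> 0" "d mod 8 \<noteq> 4" by presburger+
  qed
  have "d mod 8 = 1 \<or> d mod 8 = 2 \<or> d mod 8 = 3 \<or> d mod 8 = 5 \<or> d mod 8 = 6"
    using n4 d(2) by presburger
  then have mods: "d mod 8 \<in> {1, 2, 3, 5, 6}" by simp
  \<comment> \<open>The class of \<open>r\<close> paired with \<open>d mod 8\<close> in
    \<open>norm_free_2adic\<close>: 5 for 2 and 6, 2 for 3, and 3 for 1 and 5.\<close>
  define c :: nat where "c = (if even d then 5 else if d mod 8 = 3 then 2 else 3)"
  have par: "even d \<longleftrightarrow> even (d mod 8)" by presburger
  have cl: "norm_free d r" if "r mod int 8 = int c mod int 8" for r
    by (rule norm_free_2adic) (use that mods par in \<open>auto simp: c_def\<close>)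
  define e where "e = (if even d then d div 2 else d)"
  have e: "odd e" "d = e \<or> d = 2 * e" "e \<le> d" "d \<le> 2 * e"
    using mods by (auto simp: e_def) presburger+
  have sqe: "squarefree e" using d(1) e(2) by (metis squarefree_multD(2))
  have "real d / 64 - 2 - count_error d \<le> real d / (8 * real 8) - 2 - count_error e"
  proof -
    have "e dvd d" using e by auto
    then show ?thesis using count_error_mono(2)[of e d] d0 by simp
  qed
  also have "\<dots> \<le> (\<Sum>r\<in>{r\<in>candidates d. r mod int 8 = int c mod int 8}. real (sqrt_count e r))"
  proof (rule class_sum_lower[of e 1 e 8 c d])
    have "coprime (2 ^ 3) e" using e(1) by (simp del: power_numeral)
    then show "coprime 8 e" by simp
  qed (use e sqe in \<open>auto simp: c_def\<close>)
  also have "\<dots> \<le> (\<Sum>r\<in>Dset d. 2 ^ (omega d - omega (gcd d (nat r))))"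
    using cl by (intro Dset_sum_ge[OF d(1) e(1,2)]) auto
  finally show ?thesis .
qed

section \<open>Obstructed multiples of a single bad prime\<close>

definition bad_multiples :: "nat \<Rightarrow> nat \<Rightarrow> int set" where
  "bad_multiples d p = {r\<in>candidates d. norm_free d r \<and> int p dvd r}"

lemma finite_bad_multiples [simp]: "finite (bad_multiples d p)"
  by (simp add: bad_multiples_def)

text \<open>At least \<open>p / 3\<close> disjoint classes modulo \<open>p\<^sup>2\<close> are
  obstructed. Each has main term \<open>d / (8 * p\<^sup>2)\<close>, of which \<open>large\<close>
  lets the error take at most half.\<close>

lemma bad_multiples_lower:
  assumes d: "odd d" "squarefree d" and p: "bad_prime d p"
    and large: "2 + count_error d \<le> real d / (16 * (real p)\<^sup>2)"
  shows "real d / (48 * real p) \<le> (\<Sum>r\<in>bad_multiples d p. real (sqrt_count d r))"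
proof -
  have pp: "prime p" "p > 2" using p by (auto simp: bad_prime_def)
  obtain U where U: "U \<subseteq> {1..<p}" "p - 1 \<le> 2 * card U"
    "\<And>r u. u \<in> U \<Longrightarrow> r mod int (p\<^sup>2) = int (p * u) \<Longrightarrow> norm_free d r"
    using bad_prime_classes[OF p d(2)] by blast
  have finU: "finite U" using U(1) finite_subset by blast
  obtain t n where tn: "d = t * n" "t dvd p" "coprime p n"
    using squarefree_coprime_part[OF d(2)] .
  define C where "C = (\<lambda>u. {r\<in>candidates d. r mod int (p\<^sup>2) = int (p * u) mod int (p\<^sup>2)})"
  have small: "p * u < p\<^sup>2" if "u \<in> U" for u
    using that U(1) pp by (auto simp: power2_eq_square)
  have modu: "int (p * u) mod int (p\<^sup>2) = int (p * u)" if "u \<in> U" for u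
    using small[OF that] by (simp only: zmod_int[symmetric] mod_less)
  have low: "real d / (16 * (real p)\<^sup>2) \<le> (\<Sum>r\<in>C u. real (sqrt_count d r))" if u: "u \<in> U" for u
  proof -
    have "real d / (8 * real (p\<^sup>2)) - 2 - count_error d \<le> (\<Sum>r\<in>C u. real (sqrt_count d r))"
      unfolding C_def
    proof (rule class_sum_lower[OF d tn(1)])
      show "coprime (p\<^sup>2) n" using tn by simp
      show "t dvd p\<^sup>2" "t dvd p * u" using tn(2) by (simp_all add: power2_eq_square)
      show "p\<^sup>2 > 0" "0 < p * u" using pp u U(1) by auto
      show "p * u \<le> p\<^sup>2" using small[OF u] by simp
    qed auto
    then show ?thesis using large by (simp add: field_simps)
  qed
  have "real p / 3 \<le> real (card U)"
  proof -
    \<comment> \<open>From \<open>p - 1 \<le> 2 * card U\<close>, with \<open>p \<ge> 3\<close>; the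
      case \<open>p = 3\<close> is the sharp one.\<close>
    have "p \<le> 3 * card U" using U(2) pp by linarith
    then show ?thesis by linarith
  qed
  then have "real p / 3 * (real d / (16 * (real p)\<^sup>2)) \<le> real (card U) * (real d / (16 * (real p)\<^sup>2))"
    by (rule mult_right_mono) simp
  also have "\<dots> = (\<Sum>u\<in>U. real d / (16 * (real p)\<^sup>2))" by simp
  also have "\<dots> \<le> (\<Sum>u\<in>U. \<Sum>r\<in>C u. real (sqrt_count d r))"
    using low by (rule sum_mono)
  also have "\<dots> = (\<Sum>r\<in>(\<Union>u\<in>U. C u). real (sqrt_count d r))"
  proof (rule sum.UNION_disjoint[symmetric])
    show "\<forall>u\<in>U. \<forall>v\<in>U. u \<noteq> v \<longrightarrow> C u \<inter> C v = {}"
    proof (intro ballI impI)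
      fix u v assume uv: "u \<in> U" "v \<in> U" "u \<noteq> v"
      have "p * u \<noteq> p * v" using uv pp by simp
      then have "int (p * u) \<noteq> int (p * v)" by (simp only: of_nat_eq_iff not_False_eq_True)
      then show "C u \<inter> C v = {}" using uv modu unfolding C_def by auto
    qed
  qed (use finU in \<open>auto simp: C_def\<close>)
  also have "\<dots> \<le> (\<Sum>r\<in>bad_multiples d p. real (sqrt_count d r))"
  proof (rule sum_mono2)
    show "(\<Union>u\<in>U. C u) \<subseteq> bad_multiples d p"
    proof
      fix r assume "r \<in> (\<Union>u\<in>U. C u)"
      then obtain u where u: "u \<in> U" "r \<in> candidates d" "r mod int (p\<^sup>2) = int (p * u)"
        unfolding C_def using modu by auto
      have "int p dvd r mod int (p\<^sup>2)" using u(3) by simp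
      moreover have "int p dvd int (p\<^sup>2)" by (simp add: power2_eq_square)
      ultimately have "int p dvd r" by (metis dvd_mod_iff)
      then show "r \<in> bad_multiples d p" using u U(3) by (auto simp: bad_multiples_def)
    qed
  qed auto
  also have "real p / 3 * (real d / (16 * (real p)\<^sup>2)) = real d / (48 * real p)"
    using pp by (simp add: field_simps power2_eq_square)
  finally show ?thesis .
qed

text \<open>Multiples of \<open>p\<close> minus multiples of \<open>p\<^sup>2\<close>: the latter
  need only an upper bound, so \<open>large\<close> is a condition on \<open>p\<close> instead of
  \<open>p\<^sup>2\<close>. With \<open>p \<ge> 8\<close> the subtracted main term is at most half
  of \<open>d / (8 * p)\<close>, and the errors take at most half of the rest.\<close>

lemma inert_multiples_lower:
  assumes d: "odd d" "squarefree d" and p: "bad_prime d p" "\<not> p dvd d" "p \<ge> 8"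
    and large: "2 + 2 * count_error d \<le> real d / (32 * real p)"
  shows "real d / (32 * real p) \<le> (\<Sum>r\<in>bad_multiples d p. real (sqrt_count d r))"
proof -
  have pp: "prime p" "Legendre (- int d) (int p) = -1" using p by (auto simp: bad_prime_def)
  let ?w = "\<lambda>r. real (sqrt_count d r)"
  let ?A = "{r\<in>candidates d. int p dvd r}" and ?B = "{r\<in>candidates d. int (p\<^sup>2) dvd r}"
  have eqA: "?A = {r\<in>candidates d. r mod int p = int p mod int p}" by (auto simp: dvd_eq_mod_eq_0)
  have "real d / (8 * real p) - 2 - count_error d \<le> sum ?w ?A"
    unfolding eqA
  proof (rule class_sum_lower[OF d, of 1 d])
    show "coprime p d" using pp p(2) by (simp add: prime_imp_coprime)
  qed (use p(3) in auto)
  moreover have "sum ?w ?B \<le> real d / (2 * real (p\<^sup>2)) + count_error d"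
    using d p(3) by (intro multiple_sum_upper) auto
  moreover have "sum ?w ?A - sum ?w ?B \<le> sum ?w (?A - ?B)"
  proof -
    have "?B \<subseteq> ?A" by (auto simp: power2_eq_square intro: dvd_mult_left)
    then show ?thesis by (simp add: sum_diff)
  qed
  moreover have "sum ?w (?A - ?B) \<le> sum ?w (bad_multiples d p)"
    using norm_free_inert[OF pp(1) p(2) pp(2)]
    by (intro sum_mono2) (auto simp: bad_multiples_def)
  moreover have "real d / (2 * real (p\<^sup>2)) \<le> real d / (16 * real p)"
  proof -
    have "real d / (2 * real (p\<^sup>2)) = (real d / (2 * real p)) * (1 / real p)"
      by (simp add: power2_eq_square)
    also have "\<dots> \<le> (real d / (2 * real p)) * (1 / 8)"
      using p(3) by (intro mult_left_mono) (auto simp: field_simps)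
    finally show ?thesis by simp
  qed
  moreover have "real d / (8 * real p) - real d / (16 * real p) - real d / (32 * real p) = real d / (32 * real p)"
    by (simp add: field_simps)
  ultimately show ?thesis using large by linarith
qed

text \<open>If \<open>f\<close> sets contain \<open>r\<close>, then
  \<open>f - (f * f - f) \<le> 1\<close>, which is \<open>(f - 1)\<^sup>2 \<ge> 0\<close>. The pairs
  are ordered, so each intersection is subtracted twice.\<close>

lemma bonferroni_lower:
  fixes w :: "'a \<Rightarrow> real" and V :: "'b \<Rightarrow> 'a set"
  assumes P: "finite P" and V: "\<And>p. p \<in> P \<Longrightarrow> finite (V p)" and w: "\<And>r. w r \<ge> 0"
  shows "(\<Sum>p\<in>P. sum w (V p)) - (\<Sum>p\<in>P. \<Sum>q\<in>P - {p}. sum w (V p \<inter> V q)) \<le> sum w (\<Union>p\<in>P. V p)"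
proof -
  let ?R = "\<Union>p\<in>P. V p"
  have finR: "finite ?R" using P V by auto
  define f where "f = (\<lambda>r. real (card {p\<in>P. r \<in> V p}))"
  have fsum: "f r = (\<Sum>p\<in>P. of_bool (r \<in> V p))" for r
    unfolding f_def using P by (simp add: Collect_conj_eq)
  have s1: "sum w (V p) = (\<Sum>r\<in>?R. w r * of_bool (r \<in> V p))" if "p \<in> P" for p
  proof -
    have "sum w (V p) = sum w {r\<in>?R. r \<in> V p}" using that by (intro arg_cong[of _ _ "sum w"]) auto
    also have "\<dots> = (\<Sum>r\<in>?R. if r \<in> V p then w r else 0)" using finR by (rule sum.inter_filter)
    also have "\<dots> = (\<Sum>r\<in>?R. w r * of_bool (r \<in> V p))" by (intro sum.cong refl) auto
    finally show ?thesis .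
  qed
  have s2: "sum w (V p \<inter> V q) = (\<Sum>r\<in>?R. w r * (of_bool (r \<in> V p) * of_bool (r \<in> V q)))"
    if "p \<in> P" "q \<in> P" for p q
  proof -
    have "sum w (V p \<inter> V q) = sum w {r\<in>?R. r \<in> V p \<and> r \<in> V q}"
      using that by (intro arg_cong[of _ _ "sum w"]) auto
    also have "\<dots> = (\<Sum>r\<in>?R. if r \<in> V p \<and> r \<in> V q then w r else 0)" using finR by (rule sum.inter_filter)
    also have "\<dots> = (\<Sum>r\<in>?R. w r * (of_bool (r \<in> V p) * of_bool (r \<in> V q)))" by (intro sum.cong refl) auto
    finally show ?thesis .
  qed
  have 1: "(\<Sum>p\<in>P. sum w (V p)) = (\<Sum>r\<in>?R. w r * f r)"
  proof -
    have "(\<Sum>p\<in>P. sum w (V p)) = (\<Sum>p\<in>P. \<Sum>r\<in>?R. w r * of_bool (r \<in> V p))" using s1 by simp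
    also have "\<dots> = (\<Sum>r\<in>?R. \<Sum>p\<in>P. w r * of_bool (r \<in> V p))" by (rule sum.swap)
    also have "\<dots> = (\<Sum>r\<in>?R. w r * f r)"
      unfolding fsum sum_distrib_left ..
    finally show ?thesis .
  qed
  have 2: "(\<Sum>p\<in>P. \<Sum>q\<in>P - {p}. sum w (V p \<inter> V q)) = (\<Sum>r\<in>?R. w r * (f r * f r - f r))"
  proof -
    have "(\<Sum>p\<in>P. \<Sum>q\<in>P - {p}. sum w (V p \<inter> V q)) = (\<Sum>p\<in>P. (\<Sum>q\<in>P. sum w (V p \<inter> V q)) - sum w (V p))"
      using P by (intro sum.cong refl) (simp add: sum_diff1)
    also have "\<dots> = (\<Sum>p\<in>P. \<Sum>q\<in>P. sum w (V p \<inter> V q)) - (\<Sum>r\<in>?R. w r * f r)"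
      by (simp add: sum_subtractf 1)
    also have "(\<Sum>p\<in>P. \<Sum>q\<in>P. sum w (V p \<inter> V q))
       = (\<Sum>p\<in>P. \<Sum>q\<in>P. \<Sum>r\<in>?R. w r * (of_bool (r \<in> V p) * of_bool (r \<in> V q)))"
      using s2 by simp
    also have "\<dots> = (\<Sum>r\<in>?R. \<Sum>p\<in>P. \<Sum>q\<in>P. w r * (of_bool (r \<in> V p) * of_bool (r \<in> V q)))"
      by (subst (2) sum.swap, subst sum.swap, rule refl)
    also have "\<dots> = (\<Sum>r\<in>?R. w r * (f r * f r))"
      unfolding fsum sum_product by (simp only: sum_distrib_left)
    finally show ?thesis by (simp add: sum_subtractf right_diff_distrib)
  qed
  have "(\<Sum>r\<in>?R. w r * f r) - (\<Sum>r\<in>?R. w r * (f r * f r - f r)) = (\<Sum>r\<in>?R. w r * (2 * f r - f r * f r))"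
    unfolding sum_subtractf[symmetric] by (intro sum.cong refl) (simp add: algebra_simps)
  also have "\<dots> \<le> (\<Sum>r\<in>?R. w r * 1)"
  proof (intro sum_mono mult_left_mono w)
    fix r
    have "0 \<le> (f r - 1) * (f r - 1)" by simp
    then show "2 * f r - f r * f r \<le> 1" by (simp add: algebra_simps)
  qed
  finally show ?thesis using 1 2 by simp
qed

text \<open>The single terms give at least \<open>d * s / 48\<close>. By \<open>pair\<close> the
  error for a product \<open>p * q\<close> does not exceed its main term, so each overlap is at most
  \<open>d / (p * q)\<close> and all together at most \<open>d * s * s\<close>.\<close>

lemma bad_primes_union_lower:
  assumes d: "odd d" "squarefree d" and P: "finite P" "\<And>p. p \<in> P \<Longrightarrow> bad_prime d p"
    and large: "\<And>p. p \<in> P \<Longrightarrow> 2 + count_error d \<le> real d / (16 * (real p)\<^sup>2)"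
    and pair: "\<And>p q. p \<in> P \<Longrightarrow> q \<in> P \<Longrightarrow> count_error d \<le> real d / (2 * (real p * real q))"
    and s: "s = (\<Sum>p\<in>P. 1 / real p)"
  shows "real d * s * (1 / 48 - s) \<le> (\<Sum>r\<in>(\<Union>p\<in>P. bad_multiples d p). real (sqrt_count d r))"
proof -
  let ?w = "\<lambda>r. real (sqrt_count d r)"
  have "(\<Sum>p\<in>P. sum ?w (bad_multiples d p)) \<ge> (\<Sum>p\<in>P. real d / (48 * real p))"
    using bad_multiples_lower[OF d P(2)] large by (intro sum_mono) auto
  also have "(\<Sum>p\<in>P. real d / (48 * real p)) = real d / 48 * s"
    by (simp add: s sum_distrib_left)
  finally have 1: "real d / 48 * s \<le> (\<Sum>p\<in>P. sum ?w (bad_multiples d p))" .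
  have pq: "sum ?w (bad_multiples d p \<inter> bad_multiples d q) \<le> real d * (1 / real p * (1 / real q))"
    if "p \<in> P" "q \<in> P - {p}" for p q
  proof -
    have pr: "prime p" "prime q" "p \<noteq> q" "q \<in> P" using that P(2) by (auto simp: bad_prime_def)
    then have cop: "coprime (int p) (int q)" by (simp add: primes_coprime)
    have pos: "p > 0" "q > 0" using pr prime_gt_0_nat by auto
    have "sum ?w (bad_multiples d p \<inter> bad_multiples d q) \<le> sum ?w {r\<in>candidates d. int (p * q) dvd r}"
      using cop by (intro sum_mono2) (auto simp: bad_multiples_def divides_mult)
    also have "\<dots> \<le> real d / (2 * real (p * q)) + count_error d"
      using d pos by (intro multiple_sum_upper) auto
    also have "\<dots> \<le> real d / (2 * (real p * real q)) + real d / (2 * (real p * real q))"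
      using pair[OF that(1) pr(4)] by simp
    finally show ?thesis by simp
  qed
  have "(\<Sum>p\<in>P. \<Sum>q\<in>P - {p}. sum ?w (bad_multiples d p \<inter> bad_multiples d q))
      \<le> (\<Sum>p\<in>P. \<Sum>q\<in>P - {p}. real d * (1 / real p * (1 / real q)))"
    using pq by (intro sum_mono) auto
  also have "\<dots> \<le> (\<Sum>p\<in>P. \<Sum>q\<in>P. real d * (1 / real p * (1 / real q)))"
    using P(1) by (intro sum_mono sum_mono2) auto
  also have "\<dots> = real d * (s * s)"
    unfolding s sum_product by (simp only: sum_distrib_left)
  finally have 2: "(\<Sum>p\<in>P. \<Sum>q\<in>P - {p}. sum ?w (bad_multiples d p \<inter> bad_multiples d q)) \<le> real d * (s * s)" .
  have "real d / 48 * s - real d * (s * s) \<le> sum ?w (\<Union>p\<in>P. bad_multiples d p)"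
    using 1 2 bonferroni_lower[OF P(1), of "bad_multiples d" ?w] by simp
  then show ?thesis by (simp add: algebra_simps)
qed

lemma sum_le_multiplicity:
  fixes w :: "'a \<Rightarrow> real"
  assumes P: "finite P" "\<And>p. p \<in> P \<Longrightarrow> finite (V p)" and w: "\<And>r. w r \<ge> 0"
    and K: "\<And>r. r \<in> (\<Union>p\<in>P. V p) \<Longrightarrow> card {p\<in>P. r \<in> V p} \<le> K"
  shows "(\<Sum>p\<in>P. sum w (V p)) \<le> real K * sum w (\<Union>p\<in>P. V p)"
proof -
  let ?R = "\<Union>p\<in>P. V p"
  have finR: "finite ?R" using P by auto
  have "(\<Sum>p\<in>P. sum w (V p)) = (\<Sum>p\<in>P. \<Sum>r\<in>?R. if r \<in> V p then w r else 0)"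
  proof (rule sum.cong[OF refl])
    fix p assume "p \<in> P"
    then have "V p = {r\<in>?R. r \<in> V p}" by auto
    then have "sum w (V p) = sum w {r\<in>?R. r \<in> V p}" by simp
    also have "\<dots> = (\<Sum>r\<in>?R. if r \<in> V p then w r else 0)" using finR by (rule sum.inter_filter)
    finally show "sum w (V p) = (\<Sum>r\<in>?R. if r \<in> V p then w r else 0)" .
  qed
  also have "\<dots> = (\<Sum>r\<in>?R. \<Sum>p\<in>P. if r \<in> V p then w r else 0)" by (rule sum.swap)
  also have "\<dots> \<le> (\<Sum>r\<in>?R. real K * w r)"
  proof (rule sum_mono)
    fix r assume r: "r \<in> ?R"
    have "(\<Sum>p\<in>P. if r \<in> V p then w r else 0) = (\<Sum>p\<in>{p\<in>P. r \<in> V p}. w r)"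
      using P(1) by (rule sum.inter_filter[symmetric])
    also have "\<dots> = real (card {p\<in>P. r \<in> V p}) * w r" by simp
    also have "\<dots> \<le> real K * w r" using K[OF r] w by (intro mult_right_mono) auto
    finally show "(\<Sum>p\<in>P. if r \<in> V p then w r else 0) \<le> real K * w r" .
  qed
  finally show ?thesis by (simp add: sum_distrib_left)
qed

lemma prod_primes_dvd:
  fixes r :: int
  assumes "finite A" "\<And>p. p \<in> A \<Longrightarrow> prime p" "\<And>p. p \<in> A \<Longrightarrow> int p dvd r"
  shows "int (\<Prod>A) dvd r"
  using assms
proof (induction A rule: finite_induct)
  case (insert p A)
  have "coprime p (\<Prod>A)"
  proof (rule prod_coprime_right)
    fix q assume "q \<in> A"
    then show "coprime p q" using insert by (intro primes_coprime) auto
  qed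
  then have "coprime (int p) (int (\<Prod>A))" by (simp only: coprime_int_iff)
  then have "int p * int (\<Prod>A) dvd r" using insert by (intro divides_mult) auto
  then show ?case using insert by simp
qed simp

lemma card_large_prime_divisors:
  fixes r :: int and z :: real
  assumes "finite P" "\<And>p. p \<in> P \<Longrightarrow> prime p \<and> z < real p" "z \<ge> 1" "r > 0" "of_int r < z ^ Suc K"
  shows "card {p\<in>P. int p dvd r} \<le> K"
proof (rule ccontr)
  let ?A = "{p\<in>P. int p dvd r}"
  assume "\<not> card ?A \<le> K"
  then have K: "Suc K \<le> card ?A" by simp
  have "int (\<Prod>?A) dvd r" using assms by (intro prod_primes_dvd) auto
  then have "int (\<Prod>?A) \<le> r" using assms(4) by (rule zdvd_imp_le)
  then have "real (\<Prod>?A) \<le> of_int r" by linarith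
  have "z ^ Suc K \<le> z ^ card ?A" using K assms(3) by (rule power_increasing)
  also have "\<dots> = (\<Prod>p\<in>?A. z)" by simp
  also have "\<dots> \<le> (\<Prod>p\<in>?A. real p)"
    using assms(2,3) by (intro prod_mono) (auto intro: less_imp_le)
  also have "\<dots> = real (\<Prod>?A)" by simp
  finally show False using \<open>real (\<Prod>?A) \<le> of_int r\<close> assms(5) by linarith
qed

text \<open>Add elements one at a time until \<open>a\<close> is reached; a single step overshoots
  by at most \<open>a\<close>. This keeps \<open>s\<close> in the range where
  \<open>s * (1 / 48 - s)\<close> is bounded below.\<close>

lemma subset_sum_between:
  fixes f :: "'a \<Rightarrow> real"
  assumes "finite A" "\<And>x. x \<in> A \<Longrightarrow> 0 \<le> f x \<and> f x \<le> a" "a \<le> sum f A" "0 \<le> a"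
  shows "\<exists>B\<subseteq>A. a \<le> sum f B \<and> sum f B \<le> 2 * a"
  using assms
proof (induction A rule: finite_induct)
  case empty
  then show ?case by (intro exI[of _ "{}"]) auto
next
  case (insert x A)
  show ?case
  proof (cases "a \<le> sum f A")
    case True
    then show ?thesis using insert by (metis insertI2 subset_insertI2)
  next
    case False
    then have "sum f (insert x A) \<le> 2 * a" using insert by fastforce
    then show ?thesis using insert.prems(2) by blast
  qed
qed

section \<open>Vinogradov's trick: a lower bound for the reciprocal sum over bad primes\<close>

text \<open>
  Only the odd arguments \<open>2 (i + j) + 1\<close> are summed over, so that the value of the symbol at 2 is irrelevant.
\<close>

lemma jacobi_bad_sum:
  fixes d L :: nat
  assumes d: "squarefree d" "d mod 4 = 3" and L: "L \<le> d" "100 * d \<le> L\<^sup>2"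
  shows "9 / 100 \<le> (\<Sum>p\<in>{p. bad_prime d p \<and> p \<le> 4 * L}. 1 / real p)"
proof -
  have dodd: "odd d" using d(2) by presburger
  have d0: "d > 0" using dodd by (rule odd_pos)
  then have L0: "L > 0" using L(2) by (auto intro: Nat.gr0I)
  let ?B = "{p. bad_prime d p \<and> p \<le> 4 * L}"
  have finB: "finite ?B" by (rule finite_subset[of _ "{..4 * L}"]) auto
  define \<chi> where "\<chi> = (\<lambda>i j::nat. jacobi d (2 * int (i + j) + 1))"
  have "\<bar>\<Sum>i<L. \<Sum>j<L. real_of_int (\<chi> i j)\<bar> \<le> sqrt (real L * (real d * real L))"
    unfolding \<chi>_def using dodd d(1) L(1) by (intro jacobi_bilinear) auto
  also have "\<dots> = real L * sqrt (real d)" by (simp add: real_sqrt_mult)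
  also have "sqrt (real d) \<le> real L / 10"
  proof -
    have "real (100 * d) \<le> real (L\<^sup>2)" using L(2) by (simp only: of_nat_le_iff)
    then have "real d \<le> (real L / 10)\<^sup>2" by (simp add: power_divide)
    then show ?thesis using real_sqrt_le_mono[of "real d" "(real L / 10)\<^sup>2"] by simp
  qed
  finally have S: "\<bar>\<Sum>i<L. \<Sum>j<L. real_of_int (\<chi> i j)\<bar> \<le> real L * (real L / 10)"
    by (simp add: mult_left_mono)
  \<comment> \<open>The left side is at most 2 and vanishes where the symbol is 1; elsewhere some
    bad prime divides the argument, which is below \<open>4 * L\<close>.\<close>
  have point: "1 - real_of_int (\<chi> i j) \<le> 2 * (\<Sum>p\<in>?B. of_bool (int p dvd 2 * int (i + j) + 1))"
    if "i < L" "j < L" for i j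
  proof (cases "\<chi> i j = 1")
    case True
    then show ?thesis by (simp add: sum_nonneg)
  next
    case False
    let ?n = "2 * (i + j) + 1"
    have n: "int ?n = 2 * int (i + j) + 1" by simp
    have "jacobi d (int ?n) \<noteq> 1" using False unfolding \<chi>_def n .
    then obtain p where p: "prime p" "p dvd ?n" "jacobi d (int p) \<noteq> 1"
      using jacobi_eq_1I[OF dodd, of ?n] by auto
    have p2: "p > 2"
    proof -
      have "p \<noteq> 2" using p(2) by auto
      then show ?thesis using p(1) prime_ge_2_nat[of p] by linarith
    qed
    have "bad_prime d p"
    proof (cases "p dvd d")
      case False
      then have "Legendre (- int d) (int p) \<noteq> 1"
        using jacobi_reciprocity[OF dodd d p(1) p2] p(3) by simp
      moreover have "Legendre (- int d) (int p) \<noteq> 0" using False by (simp add: Legendre_eq_0_iff)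
      ultimately show ?thesis using p(1) p2 Legendre_cases by (auto simp: bad_prime_def)
    qed (use p p2 in \<open>auto simp: bad_prime_def\<close>)
    moreover have "p \<le> ?n" using p(2) by (rule dvd_imp_le) simp
    ultimately have pB: "p \<in> ?B" using that by auto
    have "(of_bool (int p dvd 2 * int (i + j) + 1) :: real) \<le> (\<Sum>p\<in>?B. of_bool (int p dvd 2 * int (i + j) + 1))"
      using pB finB by (intro member_le_sum) auto
    moreover have "int p dvd 2 * int (i + j) + 1" using p(2) n by (metis int_dvd_int_iff)
    ultimately have "1 \<le> (\<Sum>p\<in>?B. of_bool (int p dvd 2 * int (i + j) + 1) :: real)" by simp
    moreover have "real_of_int (\<chi> i j) \<ge> -1"
      using jacobi_cases[of d "2 * int (i + j) + 1"] unfolding \<chi>_def by auto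
    ultimately show ?thesis by linarith
  qed
  \<comment> \<open>Since \<open>p\<close> is odd, \<open>j\<close> is restricted to one class
    modulo \<open>p\<close>, so at most \<open>L div p + 1\<close> values occur;
    \<open>p \<le> 4 * L\<close> absorbs the 1 into \<open>4 * L / p\<close>.\<close>
  have col: "(\<Sum>j<L. of_bool (int p dvd 2 * int (i + j) + 1)) \<le> 5 * real L / real p" if p: "p \<in> ?B" for p i
  proof -
    have pp: "p > 2" "prime p" "p \<le> 4 * L" using p by (auto simp: bad_prime_def)
    then have "odd p" using prime_odd_nat by blast
    then obtain k where k: "p = 2 * k + 1" by (meson oddE)
    \<comment> \<open>The root of \<open>2 * (i + j) + 1\<close> in \<open>j\<close> modulo
      \<open>p\<close>, because \<open>k + 1\<close> is the inverse of 2 modulo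
      \<open>p = 2 * k + 1\<close>.\<close>
    define c where "c = - (int i + int k + 1)"
    have eq: "int p dvd 2 * int (i + j) + 1 \<longleftrightarrow> int p dvd int j - c" for j
    proof -
      have a: "2 * (int j - c) = (2 * int (i + j) + 1) + int p" by (simp add: c_def k)
      have "int p dvd 2 * int (i + j) + 1 \<longleftrightarrow> int p dvd 2 * (int j - c)"
        unfolding a by (simp only: dvd_add_left_iff[OF dvd_refl])
      moreover have "coprime (int p) 2" using \<open>odd p\<close> by simp
      ultimately show ?thesis by (simp only: coprime_dvd_mult_right_iff)
    qed
    have "(\<Sum>j<L. of_bool (int p dvd 2 * int (i + j) + 1)) = real (card {j\<in>{..<L}. int p dvd int j - c})"
      unfolding eq by (subst card_filter_eq_sum) (simp_all del: sum_of_bool_eq)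
    also have "card {j\<in>{..<L}. int p dvd int j - c} = card (int ` {j\<in>{..<L}. int p dvd int j - c})"
      by (simp add: card_image)
    also have "\<dots> \<le> card {v\<in>{0..<int L}. int p dvd v - c}"
      by (intro card_mono) auto
    also have "\<dots> \<le> L div p + 1" using pp by (intro card_class_le) auto
    also have "real (L div p + 1) \<le> real L / real p + 1"
      using of_nat_div_le_of_nat[of L p, where 'a = real] by simp
    also have "1 \<le> 4 * real L / real p" using pp by (simp add: field_simps)
    finally show ?thesis by (simp add: add_divide_distrib[symmetric])
  qed
  have "real L * real L - (\<Sum>i<L. \<Sum>j<L. real_of_int (\<chi> i j)) = (\<Sum>i<L. \<Sum>j<L. 1 - real_of_int (\<chi> i j))"
    by (simp add: sum_subtractf)
  also have "\<dots> \<le> (\<Sum>i<L. \<Sum>j<L. 2 * (\<Sum>p\<in>?B. of_bool (int p dvd 2 * int (i + j) + 1)))"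
    using point by (intro sum_mono) auto
  also have "\<dots> = 2 * (\<Sum>i<L. \<Sum>p\<in>?B. \<Sum>j<L. of_bool (int p dvd 2 * int (i + j) + 1))"
  proof -
    have "(\<Sum>j<L. \<Sum>p\<in>?B. of_bool (int p dvd 2 * int (i + j) + 1)) = (\<Sum>p\<in>?B. \<Sum>j<L. (of_bool (int p dvd 2 * int (i + j) + 1) :: real))" for i
      by (rule sum.swap)
    then show ?thesis by (simp only: sum_distrib_left[symmetric])
  qed
  also have "\<dots> \<le> 2 * (\<Sum>i<L. \<Sum>p\<in>?B. 5 * real L / real p)"
    using col by (intro mult_left_mono sum_mono) auto
  also have "\<dots> = 10 * (real L * real L) * (\<Sum>p\<in>?B. 1 / real p)"
    by (simp add: sum_distrib_left mult_ac)
  finally have "real L * real L - (\<Sum>i<L. \<Sum>j<L. real_of_int (\<chi> i j)) \<le> 10 * (real L * real L) * (\<Sum>p\<in>?B. 1 / real p)" .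
  then have "(real L * real L) * (9 / 10) \<le> (real L * real L) * (10 * (\<Sum>p\<in>?B. 1 / real p))"
    using S by (simp add: abs_le_iff)
  then have "9 / 10 \<le> 10 * (\<Sum>p\<in>?B. 1 / real p)"
    using L0 by (simp only: mult_le_cancel_left_pos of_nat_0_less_iff mult_pos_pos)
  then show ?thesis by simp
qed

section \<open>Reciprocal sums over primes\<close>

text \<open>Chebyshev's argument: the primes in the interval divide the central binomial
  coefficient, which is at most \<open>4 ^ n\<close>, so their number times \<open>ln n\<close> is
  at most \<open>n * ln 4\<close>.\<close>

lemma sum_prime_recip_dyadic:
  fixes n :: nat
  assumes "n \<ge> 2"
  shows "(\<Sum>p\<in>{p. prime p \<and> n < p \<and> p \<le> 2 * n}. 1 / real p) \<le> ln 4 / ln (real n)"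
proof -
  let ?P = "{p. prime p \<and> n < p \<and> p \<le> 2 * n}"
  have finP: "finite ?P" by (rule finite_subset[of _ "{..2 * n}"]) auto
  have "int (\<Prod>?P) dvd int ((2 * n) choose n)"
  proof (rule prod_primes_dvd[OF finP])
    fix p assume p: "p \<in> ?P"
    have "p dvd fact (2 * n)" using p by (simp add: prime_dvd_fact_iff)
    also have "fact (2 * n) = fact n * fact n * ((2 * n) choose n)"
      using binomial_fact_lemma[of n "2 * n"] by simp
    finally have "p dvd fact n * fact n * ((2 * n) choose n)" .
    moreover have "\<not> p dvd fact n" using p by (simp add: prime_dvd_fact_iff)
    ultimately have "p dvd (2 * n) choose n" using p by (auto simp: prime_dvd_mult_iff)
    then show "int p dvd int ((2 * n) choose n)" by simp
  qed auto
  then have "\<Prod>?P dvd (2 * n) choose n" by (simp only: int_dvd_int_iff)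
  then have "\<Prod>?P \<le> (2 * n) choose n" by (rule dvd_imp_le) simp
  also have "\<dots> \<le> 2 ^ (2 * n)" by (rule binomial_le_pow2)
  finally have le: "\<Prod>?P \<le> 4 ^ n" by (simp add: power_mult)
  have "n ^ card ?P = (\<Prod>p\<in>?P. n)" by simp
  also have "\<dots> \<le> \<Prod>?P" by (intro prod_mono) auto
  finally have "n ^ card ?P \<le> 4 ^ n" using le by linarith
  then have "real (n ^ card ?P) \<le> real (4 ^ n)" by (simp only: of_nat_le_iff)
  then have "ln (real n ^ card ?P) \<le> ln (4 ^ n)" using assms by (intro ln_mono) auto
  then have "real (card ?P) * ln (real n) \<le> real n * ln 4"
    using assms by (simp add: ln_realpow)
  moreover have "ln (real n) > 0" using assms by simp
  ultimately have c: "real (card ?P) * (1 / real n) \<le> ln 4 / ln (real n)"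
    using assms by (simp add: field_simps)
  have "(\<Sum>p\<in>?P. 1 / real p) \<le> (\<Sum>p\<in>?P. 1 / real n)"
    using assms by (intro sum_mono) (auto simp: frac_le)
  then show ?thesis using c by simp
qed

text \<open>\<open>J\<close> dyadic blocks, each bounded by the value at the lowest starting point
  \<open>n\<close>.\<close>

lemma sum_prime_recip_range:
  fixes n J :: nat
  assumes "n \<ge> 2"
  shows "(\<Sum>p\<in>{p. prime p \<and> n < p \<and> p \<le> 2 ^ J * n}. 1 / real p) \<le> real J * ln 4 / ln (real n)"
proof (induction J)
  case 0
  have empty: "{p. prime p \<and> n < p \<and> p \<le> 2 ^ 0 * n} = {}" by auto
  show ?case unfolding empty by simp
next
  case (Suc J)
  let ?A = "\<lambda>J. {p. prime p \<and> n < p \<and> p \<le> 2 ^ J * n}"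
  let ?m = "2 ^ J * n"
  have nm: "n \<le> ?m" by simp
  have eq: "?A (Suc J) = ?A J \<union> {p. prime p \<and> ?m < p \<and> p \<le> 2 * ?m}"
    using nm by (auto simp: not_le) (metis le_trans linorder_not_le nm)
  have "(\<Sum>p\<in>?A (Suc J). 1 / real p) = (\<Sum>p\<in>?A J. 1 / real p) + (\<Sum>p\<in>{p. prime p \<and> ?m < p \<and> p \<le> 2 * ?m}. 1 / real p)"
    unfolding eq by (rule sum.union_disjoint)
      (auto intro: finite_subset[of _ "{..2 ^ J * n}"] finite_subset[of _ "{..2 * ?m}"])
  also have "\<dots> \<le> real J * ln 4 / ln (real n) + ln 4 / ln (real ?m)"
    using sum_prime_recip_dyadic[of ?m] assms nm Suc.IH by (intro add_mono) auto
  also have "ln 4 / ln (real ?m) \<le> ln 4 / ln (real n)"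
  proof (rule divide_left_mono)
    have "real n \<le> real ?m" using nm by (simp only: of_nat_le_iff)
    then show "ln (real n) \<le> ln (real ?m)" using assms by (intro ln_mono) auto
    have "ln (real n) > 0" using assms by simp
    then show "0 < ln (real ?m) * ln (real n)"
      using \<open>ln (real n) \<le> ln (real ?m)\<close> by (intro mult_pos_pos) linarith+
  qed simp
  finally show ?case by (simp add: add_divide_distrib distrib_right)
qed

section \<open>The divisor bound for squarefree numbers\<close>

lemma card_divisors_prime_mult:
  fixes p m :: nat
  assumes "prime p" "m > 0"
  shows "card {g. g dvd p * m} \<le> 2 * card {g. g dvd m}"
proof -
  have fin: "finite {g. g dvd m}" using assms by simp
  have "{g. g dvd p * m} \<subseteq> {g. g dvd m} \<union> (\<lambda>g. p * g) ` {g. g dvd m}"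
  proof
    fix g assume "g \<in> {g. g dvd p * m}"
    then have g: "g dvd p * m" by simp
    show "g \<in> {g. g dvd m} \<union> (\<lambda>g. p * g) ` {g. g dvd m}"
    proof (cases "p dvd g")
      case True
      then obtain h where "g = p * h" by auto
      then show ?thesis using g assms by (auto simp: prime_gt_0_nat)
    next
      case False
      then have "coprime g p" using assms(1) prime_imp_coprime[of p g] by (simp add: coprime_commute)
      then show ?thesis using g by (simp add: coprime_dvd_mult_right_iff)
    qed
  qed
  then have "card {g. g dvd p * m} \<le> card ({g. g dvd m} \<union> (\<lambda>g. p * g) ` {g. g dvd m})"
    using fin by (intro card_mono) auto
  also have "\<dots> \<le> card {g. g dvd m} + card ((\<lambda>g. p * g) ` {g. g dvd m})" by (rule card_Un_le)
  also have "\<dots> \<le> 2 * card {g. g dvd m}" using card_image_le[OF fin, of "\<lambda>g. p * g"] by simp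
  finally show ?thesis .
qed

text \<open>Every prime factor doubles the number of divisors. A prime \<open>p \<ge> B\<close> pays
  for this with \<open>p powr \<epsilon> \<ge> 2\<close>; only the primes below \<open>B\<close> are
  left to be counted in the power of 2.\<close>

lemma card_divisors_bound:
  fixes B :: nat and \<epsilon> :: real
  assumes B: "2 \<le> real B powr \<epsilon>" and e: "\<epsilon> > 0" and d: "squarefree d"
  shows "real (card {g. g dvd d}) \<le> 2 ^ card {p\<in>prime_factors d. p < B} * real d powr \<epsilon>"
  using d
proof (induction d rule: less_induct)
  case (less d)
  have d0: "d > 0" using less.prems by (metis not_squarefree_0 gr0I)
  show ?case
  proof (cases "d = 1")
    case False
    then obtain p where p: "prime p" "p dvd d" using prime_factor_nat by blast
    then obtain m where m: "d = p * m" by auto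
    have p1: "p > 1" using p(1) by (rule prime_gt_1_nat)
    have m0: "m > 0" using m d0 by auto
    have "coprime p m" using less.prems m squarefree_mult_imp_coprime by blast
    then have npm: "\<not> p dvd m" using p(1) by (metis coprime_absorb_left not_prime_unit)
    have sm: "squarefree m" using less.prems m squarefree_multD by blast
    let ?S = "\<lambda>d. {p\<in>prime_factors d. p < B}"
    have IH: "real (card {g. g dvd m}) \<le> 2 ^ card (?S m) * real m powr \<epsilon>"
      using less.IH[of m] sm m p1 m0 by auto
    have pf: "prime_factors d = insert p (prime_factors m)"
      using m m0 p p1 by (simp add: prime_factors_product prime_prime_factors)
    have pm: "p \<notin> prime_factors m" using npm by auto
    have "real (card {g. g dvd d}) \<le> real (2 * card {g. g dvd m})"
      unfolding m using card_divisors_prime_mult[OF p(1) m0] by (simp only: of_nat_le_iff)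
    also have "\<dots> \<le> 2 * (2 ^ card (?S m) * real m powr \<epsilon>)" using IH by simp
    also have "\<dots> \<le> 2 ^ card (?S d) * real d powr \<epsilon>"
    proof (cases "p < B")
      case True
      then have "?S d = insert p (?S m)" using pf by auto
      then have "card (?S d) = Suc (card (?S m))" using pm by simp
      moreover have "m \<le> d" using m p1 by simp
      then have "real m powr \<epsilon> \<le> real d powr \<epsilon>" using e by (intro powr_mono2) auto
      ultimately show ?thesis by (simp add: mult_left_mono)
    next
      case False
      then have S: "?S d = ?S m" using pf by auto
      have "real B powr \<epsilon> \<le> real p powr \<epsilon>" using False e by (intro powr_mono2) auto
      then have "2 * real m powr \<epsilon> \<le> real p powr \<epsilon> * real m powr \<epsilon>"
        using B by (intro mult_right_mono) auto
      also have "\<dots> = real d powr \<epsilon>" using m by (simp add: powr_mult)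
      finally have "2 ^ card (?S m) * (2 * real m powr \<epsilon>) \<le> 2 ^ card (?S m) * real d powr \<epsilon>"
        by (intro mult_left_mono) auto
      then show ?thesis unfolding S by (simp add: mult_ac)
    qed
    finally show ?thesis .
  qed simp
qed

lemma card_divisors_powr:
  fixes \<epsilon> :: real
  assumes "\<epsilon> > 0"
  obtains C where "C \<ge> 1" "\<And>d. squarefree d \<Longrightarrow> real (card {g. g dvd d}) \<le> C * real d powr \<epsilon>"
proof -
  define B where "B = nat \<lceil>2 powr (1 / \<epsilon>)\<rceil>"
  have "2 powr (1 / \<epsilon>) \<le> real B" unfolding B_def by linarith
  then have "(2 powr (1 / \<epsilon>)) powr \<epsilon> \<le> real B powr \<epsilon>" using assms by (intro powr_mono2) auto
  then have B: "2 \<le> real B powr \<epsilon>" using assms by (simp add: powr_powr)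
  have "real (card {g. g dvd d}) \<le> 2 ^ B * real d powr \<epsilon>" if d: "squarefree d" for d
  proof -
    have "card {p\<in>prime_factors d. p < B} \<le> card {..<B}" by (intro card_mono) auto
    then have "(2::real) ^ card {p\<in>prime_factors d. p < B} \<le> 2 ^ B" by (intro power_increasing) auto
    then have "2 ^ card {p\<in>prime_factors d. p < B} * real d powr \<epsilon> \<le> 2 ^ B * real d powr \<epsilon>"
      by (intro mult_right_mono) auto
    then show ?thesis using card_divisors_bound[OF B assms d] by linarith
  qed
  then show ?thesis by (intro that[of "2 ^ B"]) auto
qed

section \<open>The lower bound\<close>

text \<open>The window has length about \<open>2 * ln y\<close> on the logarithmic scale and starts
  at \<open>198 * ln y\<close>. Chebyshev costs a factor 2, and \<open>ln 176 \<le> ln y\<close>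
  absorbs the constants: this is the 6 over 197.\<close>

lemma top_range_sum:
  fixes y :: real
  assumes y: "y \<ge> 200"
  shows "(\<Sum>p\<in>{p. prime p \<and> y ^ 198 < real p \<and> real p \<le> 44 * y ^ 200}. 1 / real p) \<le> 6 / 197"
proof -
  define x where "x = nat \<lfloor>y ^ 198\<rfloor>"
  \<comment> \<open>Since \<open>x\<close> is at least half of \<open>y ^ 198\<close>, the factor
    \<open>88 * y\<^sup>2\<close> carries it past \<open>44 * y ^ 200\<close>.\<close>
  define J where "J = nat \<lceil>log 2 (88 * y\<^sup>2)\<rceil>"
  have y198: "y ^ 198 \<ge> 200"
    using power_increasing[of 1 198 y] y by simp
  have xlow: "y ^ 198 / 2 \<le> real x" and xup: "real x \<le> y ^ 198" and x2: "x \<ge> 2"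
    unfolding x_def using y198 by linarith+
  have y2: "y\<^sup>2 \<ge> 1" using y by (simp add: power2_eq_square) (smt (verit) mult_le_cancel_left1)
  have logpos: "log 2 (88 * y\<^sup>2) \<ge> 0"
    by (subst zero_le_log_cancel_iff) (use y2 in auto)
  have J1: "log 2 (88 * y\<^sup>2) \<le> real J" and J2: "real J \<le> log 2 (88 * y\<^sup>2) + 1"
    unfolding J_def using logpos by linarith+
  have "88 * y\<^sup>2 = 2 powr (log 2 (88 * y\<^sup>2))"
    by (subst powr_log_cancel) (use y2 in auto)
  also have "\<dots> \<le> 2 powr real J" using J1 by (intro powr_mono) auto
  finally have J3: "88 * y\<^sup>2 \<le> 2 ^ J" by (simp add: powr_realpow)
  have "y ^ 200 = y\<^sup>2 * y ^ 198" by (simp flip: power_add)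
  then have "44 * y ^ 200 = 88 * y\<^sup>2 * (y ^ 198 / 2)" by simp
  also have "\<dots> \<le> 2 ^ J * real x" using J3 xlow y198 by (intro mult_mono) auto
  finally have top: "44 * y ^ 200 \<le> real (2 ^ J * x)" by simp
  have "(\<Sum>p\<in>{p. prime p \<and> y ^ 198 < real p \<and> real p \<le> 44 * y ^ 200}. 1 / real p)
     \<le> (\<Sum>p\<in>{p. prime p \<and> x < p \<and> p \<le> 2 ^ J * x}. 1 / real p)"
  proof (rule sum_mono2)
    show "finite {p. prime p \<and> x < p \<and> p \<le> 2 ^ J * x}"
      by (rule finite_subset[of _ "{..2 ^ J * x}"]) auto
    show "{p. prime p \<and> y ^ 198 < real p \<and> real p \<le> 44 * y ^ 200} \<subseteq> {p. prime p \<and> x < p \<and> p \<le> 2 ^ J * x}"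
    proof safe
      fix p :: nat assume "y ^ 198 < real p"
      then have "real x < real p" using xup by linarith
      then show "x < p" by simp
    next
      fix p :: nat assume "real p \<le> 44 * y ^ 200"
      then have "real p \<le> real (2 ^ J * x)" using top by linarith
      then show "p \<le> 2 ^ J * x" by (simp only: of_nat_le_iff)
    qed
  qed auto
  also have "\<dots> \<le> real J * ln 4 / ln (real x)" using x2 by (rule sum_prime_recip_range)
  also have "\<dots> \<le> 6 / 197"
  proof -
    have l4: "ln (4::real) = 2 * ln 2" using ln_realpow[of "2::real" 2] by (simp add: power2_eq_square)
    have lny: "ln 2 \<le> ln y" "ln 176 \<le> ln y" using y by (auto intro: ln_mono)
    have lny0: "ln y > 0" using y by simp
    have "real J * ln 4 \<le> (log 2 (88 * y\<^sup>2) + 1) * (2 * ln 2)"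
      unfolding l4 using J2 by (intro mult_right_mono) auto
    also have "\<dots> = 2 * (ln (88 * y\<^sup>2) + ln 2)"
      by (simp add: log_def field_simps)
    also have "ln (88 * y\<^sup>2) + ln 2 = ln (176 * y\<^sup>2)"
    proof -
      have "ln (88 * y\<^sup>2) + ln 2 = ln (88 * y\<^sup>2 * 2)" using y by (subst ln_mult) auto
      then show ?thesis by (simp add: mult.commute)
    qed
    also have "ln (176 * y\<^sup>2) = ln 176 + 2 * ln y"
    proof -
      have "ln (176 * y\<^sup>2) = ln 176 + ln (y\<^sup>2)" using y by (subst ln_mult) auto
      then show ?thesis using y by (simp add: ln_realpow)
    qed
    also have "2 * (ln 176 + 2 * ln y) \<le> 6 * ln y" using lny(2) by simp
    finally have num: "real J * ln 4 \<le> 6 * ln y" .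
    have "ln (y ^ 198 / 2) \<le> ln (real x)" using xlow y198 by (intro ln_mono) auto
    moreover have "ln (y ^ 198 / 2) = 198 * ln y - ln 2"
    proof -
      have "ln (y ^ 198 / 2) = ln (y ^ 198) - ln 2" using y by (subst ln_div) auto
      also have "ln (y ^ 198) = 198 * ln y" using y ln_realpow[of y 198] by simp
      finally show ?thesis .
    qed
    ultimately have den: "197 * ln y \<le> ln (real x)" using lny(1) by linarith
    then have "ln (real x) > 0" using lny0 by linarith
    moreover have "real J * ln 4 * 197 \<le> 6 * ln (real x)" using num den by linarith
    ultimately show ?thesis by (simp add: field_simps)
  qed
  finally show ?thesis .
qed

text \<open>With \<open>y\<close> the 400th root of \<open>d\<close>, all relevant powers of
  \<open>d\<close> are integral powers of \<open>y\<close>: \<open>y ^ 200\<close> is the square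
  root of \<open>d\<close>, \<open>y ^ 80\<close> is its fifth root. The divisor bound puts
  \<open>count_error d\<close> only one factor \<open>y\<close> above the square root, and
  \<open>y \<ge> 200\<close> absorbs numerical constants.\<close>

locale large_modulus =
  fixes d :: nat and y :: real
  assumes sqf: "squarefree d" and y: "y \<ge> 200" and yd: "y ^ 400 = real d"
    and tau: "real (card {g. g dvd d}) \<le> y\<^sup>2 / 2"
begin

lemma y_nonneg: "0 \<le> y"
  using y by simp

lemma power_mono_y: "a \<le> b \<Longrightarrow> y ^ a \<le> y ^ b"
  using y by (intro power_increasing) auto

lemma d_pos: "d > 0"
  using sqf by (metis not_squarefree_0 gr0I)

lemma error_le: "count_error d \<le> y ^ 201"
proof -
  have "2 * (real d * real (card {g. g dvd d})) \<le> 2 * (real d * (y\<^sup>2 / 2))"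
    using tau by (intro mult_left_mono) auto
  also have "\<dots> = y ^ 400 * y\<^sup>2" using yd by simp
  also have "\<dots> = (y ^ 201)\<^sup>2" by (simp flip: power_add power_mult)
  finally have "count_error d \<le> sqrt ((y ^ 201)\<^sup>2)"
    unfolding count_error_def by (rule real_sqrt_le_mono)
  then show ?thesis unfolding real_sqrt_abs using y by simp
qed

lemma y201: "2 \<le> y ^ 201"
  using power_mono_y[of 1 201] y by simp

text \<open>Room above the error \<open>y ^ 201\<close> in three situations: bounded moduli, moduli
  up to \<open>y ^ 160\<close> (products of two primes up to \<open>y ^ 80\<close>), and single
  inert primes up to \<open>y ^ 198\<close>, where one factor \<open>y\<close> is left for
  constants.\<close>

lemma split_power:
  "y ^ 199 * y ^ 201 = real d" "y ^ 160 * (y ^ 39 * y ^ 201) = real d" "y ^ 198 * (y * y ^ 201) = real d"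
  unfolding yd[symmetric] by (simp_all flip: power_add power_Suc)

lemma Dset_sum_2adic_large:
  assumes "d mod 8 \<noteq> 7"
  shows "real d / 20000 \<le> (\<Sum>r\<in>Dset d. 2 ^ (omega d - omega (gcd d (nat r))))"
proof -
  have "200 * y ^ 201 \<le> y * y ^ 201" using y y201 by (intro mult_right_mono) auto
  also have "\<dots> \<le> y ^ 199 * y ^ 201"
    using power_mono_y[of 1 199] y_nonneg by (intro mult_right_mono) auto
  also have "\<dots> = real d" by (rule split_power)
  finally have "real d / 20000 \<le> real d / 64 - 2 - count_error d"
    using error_le y201 by linarith
  then show ?thesis using Dset_sum_2adic[OF sqf assms] by linarith
qed

context
  assumes mod8: "d mod 8 = 7"
begin

lemma odd_d: "odd d" and mod4: "d mod 4 = 3"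
  using mod8 by presburger+

lemma Dset_sum_ge_bad_multiples:
  "(\<Sum>r\<in>(\<Union>p\<in>P. bad_multiples d p). real (sqrt_count d r))
     \<le> (\<Sum>r\<in>Dset d. 2 ^ (omega d - omega (gcd d (nat r))))"
  by (rule Dset_sum_ge[OF sqf odd_d]) (auto simp: bad_multiples_def)

text \<open>A single bounded bad prime already suffices, as \<open>48 * 192\<close> is below 20000.
  Excluding such primes makes every reciprocal at most 1/192, which the subset selection for medium
  primes relies on.\<close>

lemma small_bad_prime:
  assumes p: "bad_prime d p" "p < 192"
  shows "real d / 20000 \<le> (\<Sum>r\<in>Dset d. 2 ^ (omega d - omega (gcd d (nat r))))"
proof -
  have p0: "p > 2" using p by (auto simp: bad_prime_def)
  have "(real p)\<^sup>2 \<le> 192\<^sup>2" using p by (intro power_mono) auto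
  then have p2: "16 * (real p)\<^sup>2 \<le> 600000" by simp
  have "(2 + count_error d) * (16 * (real p)\<^sup>2) \<le> (2 * y ^ 201) * 600000"
    using error_le y201 y_nonneg p2 by (intro mult_mono) auto
  also have "\<dots> = 1200000 * y ^ 201" by simp
  also have "\<dots> \<le> y ^ 199 * y ^ 201"
  proof (rule mult_right_mono)
    have "200 ^ 3 \<le> y ^ 3" using y by (intro power_mono) auto
    then show "1200000 \<le> y ^ 199" using power_mono_y[of 3 199] by simp
  qed (use y_nonneg in simp)
  also have "\<dots> = real d" by (rule split_power)
  finally have "2 + count_error d \<le> real d / (16 * (real p)\<^sup>2)"
    using p0 by (simp add: le_divide_eq)
  then have "real d / (48 * real p) \<le> (\<Sum>r\<in>bad_multiples d p. real (sqrt_count d r))"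
    by (rule bad_multiples_lower[OF odd_d sqf p(1)])
  also have "\<dots> \<le> (\<Sum>r\<in>Dset d. 2 ^ (omega d - omega (gcd d (nat r))))"
    using Dset_sum_ge_bad_multiples[of "{p}"] by simp
  moreover have "real d / 20000 \<le> real d / (48 * real p)"
    using p p0 by (intro divide_left_mono) auto
  ultimately show ?thesis by linarith
qed

text \<open>Inclusion-exclusion loses if the reciprocal sum \<open>s\<close> is too large, so a
  subset with \<open>s\<close> between 1/192 and 1/96 is chosen.\<close>

lemma medium_bad_primes:
  assumes none: "\<And>p. bad_prime d p \<Longrightarrow> p \<ge> 192"
    and sum: "1 / 192 \<le> (\<Sum>p\<in>{p. bad_prime d p \<and> real p \<le> y ^ 80}. 1 / real p)"
  shows "real d / 20000 \<le> (\<Sum>r\<in>Dset d. 2 ^ (omega d - omega (gcd d (nat r))))"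
proof -
  let ?A = "{p. bad_prime d p \<and> real p \<le> y ^ 80}"
  have finA: "finite ?A"
    by (rule finite_subset[of _ "{..nat \<lfloor>y ^ 80\<rfloor>}"]) (auto simp: le_nat_floor)
  have le: "1 / real p \<le> 1 / 192" if "p \<in> ?A" for p
    using none[of p] that by (intro frac_le) auto
  have "\<exists>P\<subseteq>?A. 1 / 192 \<le> (\<Sum>p\<in>P. 1 / real p) \<and> (\<Sum>p\<in>P. 1 / real p) \<le> 2 * (1 / 192)"
    by (rule subset_sum_between[OF finA]) (use le sum in auto)
  then obtain P where P: "P \<subseteq> ?A" "1 / 192 \<le> (\<Sum>p\<in>P. 1 / real p)" "(\<Sum>p\<in>P. 1 / real p) \<le> 1 / 96"
    by auto
  define s where "s = (\<Sum>p\<in>P. 1 / real p)"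
  have big: "32 * y ^ 201 * (real p * real q) \<le> real d" if "p \<in> P" "q \<in> P" for p q
  proof -
    have "real p * real q \<le> y ^ 80 * y ^ 80" using that P(1) y by (intro mult_mono) auto
    also have "\<dots> = y ^ 160" by (simp flip: power_add)
    finally have "(real p * real q) * (32 * y ^ 201) \<le> y ^ 160 * (y ^ 39 * y ^ 201)"
      using power_mono_y[of 1 39] y by (intro mult_mono) auto
    then show ?thesis unfolding split_power by (simp only: mult.commute)
  qed
  have pos: "real p > 0" if "p \<in> P" for p using that P(1) none by force
  have "real d * s * (1 / 48 - s) \<le> (\<Sum>r\<in>(\<Union>p\<in>P. bad_multiples d p). real (sqrt_count d r))"
  proof (rule bad_primes_union_lower[OF odd_d sqf])
    show "finite P" using P(1) finA finite_subset by blast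
    show "bad_prime d p" if "p \<in> P" for p using that P(1) by auto
    fix p assume p: "p \<in> P"
    have "(2 + count_error d) * (16 * (real p)\<^sup>2) \<le> (2 * y ^ 201) * (16 * (real p)\<^sup>2)"
      using error_le y201 by (intro mult_right_mono) auto
    also have "\<dots> \<le> real d" using big[OF p p] by (simp add: power2_eq_square)
    finally show "2 + count_error d \<le> real d / (16 * (real p)\<^sup>2)"
      using pos[OF p] by (simp add: le_divide_eq)
    fix q assume q: "q \<in> P"
    have pq: "real p * real q > 0" using pos p q by simp
    have "count_error d * (2 * (real p * real q)) \<le> (16 * y ^ 201) * (2 * (real p * real q))"
      using error_le y201 pq by (intro mult_right_mono) auto
    also have "\<dots> \<le> real d" using big[OF p q] by simp
    finally show "count_error d \<le> real d / (2 * (real p * real q))"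
      using pq by (simp add: le_divide_eq)
  qed (simp add: s_def)
  moreover have "real d / 20000 \<le> real d * s * (1 / 48 - s)"
  proof -
    \<comment> \<open>The product is 1/18432, which is the case that determines the final constant
      1/20000.\<close>
    have "(1 / 192) * (1 / 96) \<le> s * (1 / 48 - s)"
      using P(2,3) unfolding s_def by (intro mult_mono) auto
    then have "real d * (1 / 20000) \<le> real d * (s * (1 / 48 - s))"
      by (intro mult_left_mono) auto
    then show ?thesis by simp
  qed
  ultimately show ?thesis using Dset_sum_ge_bad_multiples[of P] by linarith
qed

text \<open>From the 9/100 of \<open>jacobi_bad_sum\<close> are removed the primes up to
  \<open>y ^ 80\<close>, the larger prime factors of \<open>d\<close>, and the primes above
  \<open>y ^ 198\<close>; every bad prime that remains is inert.\<close>

lemma inert_prime_sum: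
  assumes sum: "(\<Sum>p\<in>{p. bad_prime d p \<and> real p \<le> y ^ 80}. 1 / real p) < 1 / 192"
  shows "1 / 25 \<le> (\<Sum>p\<in>{p. bad_prime d p \<and> \<not> p dvd d \<and> y ^ 80 < real p \<and> real p \<le> y ^ 198}. 1 / real p)"
    (is "_ \<le> ?I")
proof -
  \<comment> \<open>Ten times the square root of \<open>d\<close>, as the condition
    \<open>100 * d \<le> L\<^sup>2\<close> demands; then \<open>4 * L\<close> is at most
    \<open>44 * y ^ 200\<close>.\<close>
  define L where "L = nat \<lceil>10 * y ^ 200\<rceil>"
  have y200: "y ^ 200 \<ge> 200" using power_mono_y[of 1 200] y by simp
  have L1: "10 * y ^ 200 \<le> real L" and L2: "real L \<le> 11 * y ^ 200"
    unfolding L_def using y200 by linarith+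
  have sq: "y ^ 200 * y ^ 200 = real d" using yd by (simp flip: power_add)
  have "L \<le> d"
  proof -
    have "11 * y ^ 200 \<le> y ^ 200 * y ^ 200" using y200 by (intro mult_right_mono) auto
    then have "real L \<le> real d" using L2 sq by linarith
    then show ?thesis by simp
  qed
  moreover have "100 * d \<le> L\<^sup>2"
  proof -
    have "100 * real d = (10 * y ^ 200) * (10 * y ^ 200)" using sq by simp
    also have "\<dots> \<le> real L * real L" using L1 y200 by (intro mult_mono) auto
    finally have "real (100 * d) \<le> real (L\<^sup>2)" by (simp add: power2_eq_square)
    then show ?thesis by (simp only: of_nat_le_iff)
  qed
  ultimately have all: "9 / 100 \<le> (\<Sum>p\<in>{p. bad_prime d p \<and> p \<le> 4 * L}. 1 / real p)"
    by (rule jacobi_bad_sum[OF sqf mod4])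
  let ?A = "{p. bad_prime d p \<and> real p \<le> y ^ 80}"
  let ?R = "{p\<in>prime_factors d. y ^ 80 < real p}"
  let ?I = "{p. bad_prime d p \<and> \<not> p dvd d \<and> y ^ 80 < real p \<and> real p \<le> y ^ 198}"
  let ?T = "{p. prime p \<and> y ^ 198 < real p \<and> real p \<le> 44 * y ^ 200}"
  have fin: "finite {p::nat. Q p \<and> real p \<le> z}" for Q z
    by (rule finite_subset[of _ "{..nat \<lfloor>z\<rfloor>}"]) (auto simp: le_nat_floor)
  have finA: "finite ?A" by (rule fin)
  have finT: "finite ?T" using fin[of "\<lambda>p. prime p \<and> y ^ 198 < real p" "44 * y ^ 200"] by (simp add: conj_assoc)
  have finI: "finite ?I"
    using fin[of "\<lambda>p. bad_prime d p \<and> \<not> p dvd d \<and> y ^ 80 < real p" "y ^ 198"] by (simp add: conj_assoc)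
  let ?f = "\<lambda>p. 1 / real p"
  have "{p. bad_prime d p \<and> p \<le> 4 * L} \<subseteq> (?A \<union> ?R) \<union> (?I \<union> ?T)"
  proof
    fix p assume p: "p \<in> {p. bad_prime d p \<and> p \<le> 4 * L}"
    then have "real p \<le> 4 * real L" by auto
    then have "real p \<le> 44 * y ^ 200" using L2 by linarith
    then show "p \<in> (?A \<union> ?R) \<union> (?I \<union> ?T)"
      using p d_pos by (auto simp: bad_prime_def prime_factors_dvd not_le)
  qed
  then have "(\<Sum>p\<in>{p. bad_prime d p \<and> p \<le> 4 * L}. ?f p) \<le> sum ?f ((?A \<union> ?R) \<union> (?I \<union> ?T))"
    using finA finT finI by (intro sum_mono2) auto
  also have "\<dots> \<le> (sum ?f ?A + sum ?f ?R) + (sum ?f ?I + sum ?f ?T)"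
  proof -
    have un: "sum ?f (B \<union> C) \<le> sum ?f B + sum ?f C" if "finite B" "finite C" for B C :: "nat set"
      using sum.union_inter[OF that, of ?f] sum_nonneg[of "B \<inter> C" ?f] by simp
    have "sum ?f ((?A \<union> ?R) \<union> (?I \<union> ?T)) \<le> sum ?f (?A \<union> ?R) + sum ?f (?I \<union> ?T)"
      using finA finT finI by (intro un) auto
    moreover have "sum ?f (?A \<union> ?R) \<le> sum ?f ?A + sum ?f ?R" using finA by (intro un) auto
    moreover have "sum ?f (?I \<union> ?T) \<le> sum ?f ?I + sum ?f ?T" using finI finT by (intro un) auto
    ultimately show ?thesis by linarith
  qed
  finally have tot: "9 / 100 \<le> (sum ?f ?A + sum ?f ?R) + (sum ?f ?I + sum ?f ?T)" using all by linarith
  \<comment> \<open>The number of prime factors is at most the number of divisors, hence at most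
    \<open>y\<^sup>2\<close>, against \<open>y ^ 80\<close> in the denominators.\<close>
  have "sum ?f ?R \<le> 1 / 100"
  proof -
    have y80: "y ^ 80 > 0" using y by simp
    have "sum ?f ?R \<le> (\<Sum>p\<in>?R. 1 / y ^ 80)"
      using y80 by (intro sum_mono frac_le) auto
    also have "\<dots> = real (card ?R) / y ^ 80" by simp
    also have "\<dots> \<le> y\<^sup>2 / y ^ 80"
    proof (rule divide_right_mono)
      have "card ?R \<le> card {g. g dvd d}"
        using d_pos by (intro card_mono) (auto simp: prime_factors_dvd)
      then show "real (card ?R) \<le> y\<^sup>2" using tau by (smt (verit) of_nat_le_iff zero_le_power2 field_sum_of_halves)
    qed (use y80 in simp)
    also have "\<dots> \<le> 1 / 100"
    proof -
      have "y ^ 80 = y ^ 78 * y\<^sup>2" by (simp flip: power_add)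
      moreover have "100 * y\<^sup>2 \<le> y ^ 78 * y\<^sup>2"
        using power_mono_y[of 1 78] y by (intro mult_right_mono) auto
      ultimately show ?thesis using y80 by (simp add: field_simps)
    qed
    finally show ?thesis .
  qed
  \<comment> \<open>The balance is 9/100 - 1/192 - 1/100 - 6/197, about 0.044.\<close>
  then show ?thesis using tot sum top_range_sum[OF y] by linarith
qed

text \<open>Since \<open>(y ^ 80) ^ 5 = d\<close>, a candidate is divisible by at most four of these
  primes, so bounded multiplicity replaces inclusion-exclusion, whose products \<open>p * q\<close>
  could exceed \<open>d\<close>. The constant obtained is 1 / (32 * 25 * 4).\<close>

lemma large_inert_primes:
  assumes sum: "(\<Sum>p\<in>{p. bad_prime d p \<and> real p \<le> y ^ 80}. 1 / real p) < 1 / 192"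
  shows "real d / 20000 \<le> (\<Sum>r\<in>Dset d. 2 ^ (omega d - omega (gcd d (nat r))))"
proof -
  let ?I = "{p. bad_prime d p \<and> \<not> p dvd d \<and> y ^ 80 < real p \<and> real p \<le> y ^ 198}"
  let ?w = "\<lambda>r. real (sqrt_count d r)"
  have finI: "finite ?I"
    by (rule finite_subset[of _ "{..nat \<lfloor>y ^ 198\<rfloor>}"]) (auto simp: le_nat_floor)
  have y80: "y ^ 80 \<ge> 200" using power_mono_y[of 1 80] y by simp
  have low: "real d / (32 * real p) \<le> sum ?w (bad_multiples d p)" if p: "p \<in> ?I" for p
  proof (rule inert_multiples_lower[OF odd_d sqf])
    have pb: "200 \<le> real p" "real p \<le> y ^ 198" using p y80 by auto
    show "8 \<le> p" using pb by linarith
    have "(2 + 2 * count_error d) * (32 * real p) \<le> (3 * y ^ 201) * (32 * y ^ 198)"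
      using error_le y201 y_nonneg pb by (intro mult_mono) auto
    also have "\<dots> = 96 * y ^ 201 * y ^ 198" by simp
    also have "\<dots> \<le> y * y ^ 201 * y ^ 198"
      using y y201 by (intro mult_right_mono) auto
    also have "\<dots> = real d" by (subst mult.commute) (rule split_power)
    finally show "2 + 2 * count_error d \<le> real d / (32 * real p)"
      using pb by (simp add: le_divide_eq)
  qed (use p in auto)
  have "real d / 32 * (1 / 25) \<le> real d / 32 * (\<Sum>p\<in>?I. 1 / real p)"
    using inert_prime_sum[OF sum] by (intro mult_left_mono) auto
  also have "\<dots> = (\<Sum>p\<in>?I. real d / (32 * real p))" by (simp add: sum_distrib_left)
  also have "\<dots> \<le> (\<Sum>p\<in>?I. sum ?w (bad_multiples d p))" using low by (intro sum_mono) auto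
  also have "\<dots> \<le> real 4 * sum ?w (\<Union>p\<in>?I. bad_multiples d p)"
  proof (rule sum_le_multiplicity[OF finI])
    fix r assume "r \<in> (\<Union>p\<in>?I. bad_multiples d p)"
    then have r: "r > 0" "4 * r < int d" by (auto simp: bad_multiples_def candidates_def)
    have "card {p\<in>?I. int p dvd r} \<le> 4"
    proof (rule card_large_prime_divisors[OF finI])
      show "prime p \<and> y ^ 80 < real p" if "p \<in> ?I" for p using that by (auto simp: bad_prime_def)
      have "of_int r < real d" using r by linarith
      also have "real d = (y ^ 80) ^ Suc 4" using yd by (simp flip: power_mult)
      finally show "of_int r < (y ^ 80) ^ Suc 4" .
    qed (use y80 r in auto)
    moreover have "card {p\<in>?I. r \<in> bad_multiples d p} \<le> card {p\<in>?I. int p dvd r}"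
      by (intro card_mono finite_subset[OF _ finI]) (auto simp: bad_multiples_def)
    ultimately show "card {p\<in>?I. r \<in> bad_multiples d p} \<le> 4" by linarith
  qed auto
  finally have "real d / 20000 \<le> sum ?w (\<Union>p\<in>?I. bad_multiples d p)" by simp
  then show ?thesis using Dset_sum_ge_bad_multiples[of ?I] by linarith
qed

end

lemma Dset_sum_lower:
  "real d / 20000 \<le> (\<Sum>r\<in>Dset d. 2 ^ (omega d - omega (gcd d (nat r))))"
proof (cases "d mod 8 = 7")
  case True
  show ?thesis
  proof (cases "\<exists>p<192. bad_prime d p")
    case False
    then have none: "p \<ge> 192" if "bad_prime d p" for p using that by (meson not_le)
    show ?thesis
      using medium_bad_primes[OF True none] large_inert_primes[OF True] by linarith
  qed (use small_bad_prime[OF True] in blast)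
qed (rule Dset_sum_2adic_large)

end

theorem theorem4p3:
  shows "\<exists>c::real. c > 0 \<and> (\<exists>N::nat. \<forall>d::nat. d \<ge> N \<longrightarrow> d > 0 \<longrightarrow> squarefree d \<longrightarrow>
     (\<Sum>r\<in>Dset d. (2::real) ^ (omega d - omega (gcd d (nat r)))) \<ge> c * real d)"
proof -
  obtain C where C: "C \<ge> 1" "\<And>d. squarefree d \<Longrightarrow> real (card {g. g dvd d}) \<le> C * real d powr (1 / 400)"
    using card_divisors_powr[of "1 / 400"] by auto
  \<comment> \<open>With \<open>y \<ge> 2 * C\<close>, the divisor bound \<open>C * y\<close> is at
    most \<open>y\<^sup>2 / 2\<close>, as the locale requires.\<close>
  define Y where "Y = max 200 (2 * C)"
  define N where "N = nat \<lceil>Y ^ 400\<rceil>"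
  have "1 / 20000 * real d \<le> (\<Sum>r\<in>Dset d. (2::real) ^ (omega d - omega (gcd d (nat r))))"
    if d: "d \<ge> N" "d > 0" "squarefree d" for d
  proof -
    define y where "y = real d powr (1 / 400)"
    have yd: "y ^ 400 = real d"
      using d(2) by (simp add: y_def powr_realpow[symmetric] powr_powr)
    have y0: "y \<ge> 0" by (simp add: y_def)
    have "Y ^ 400 \<le> real N" unfolding N_def by linarith
    also have "\<dots> \<le> y ^ 400" using d(1) yd by simp
    finally have "Y \<le> y" using power_mono_iff[of Y y 400] y0 by (simp add: Y_def)
    then have y: "y \<ge> 200" "2 * C \<le> y" by (auto simp: Y_def)
    have "real (card {g. g dvd d}) \<le> C * y" using C(2)[OF d(3)] by (simp add: y_def)
    also have "\<dots> \<le> (y / 2) * y" using y by (intro mult_right_mono) auto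
    finally have "real (card {g. g dvd d}) \<le> y\<^sup>2 / 2" by (simp add: power2_eq_square)
    then interpret large_modulus d y using d(3) y(1) yd by unfold_locales
    show ?thesis using Dset_sum_lower by simp
  qed
  then show ?thesis by (intro exI[of _ "1 / 20000"] conjI exI[of _ N]) auto
qed

end
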